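(* 1) There exists a unique algebra automorphism $\tau_n^-$ of $U_q'(\mathfrak k)$ such that $\tau_n^-(x)=T_nT_{n+1}(x)$ for $x\in kT_\theta$ and, for $j=1,\dots,n+1$, $$\tau_n^-(B_j)=\begin{cases} q^{-1}[B_n,[B_{n+1},B_{n-1}]_q]_q+B_{n-1}K_nK_{n+1}^{-1} & \text{if } j=n-1,\\ q^{-1}K_nK_{n+1}^{-1}B_{n+1} & \text{if } j=n,\\ q^{-1}K_{n+1}K_n^{-1}B_n & \text{if } j=n+1,\\ B_j & \text{else.}\end{cases}$$ 2) The inverse automorphism $\tau_n$ of $\tau_n^-$ is determined by $\tau_n(x)=T_nT_{n+1}(x)$ for $x\in kT_\theta$ and $$\tau_n(B_j)=\begin{cases} q^{-1}[[B_{n-1},B_n]_q,B_{n+1}]_q+B_{n-1}K_nK_{n+1}^{-1} & \text{if } j=n-1,\\ qK_{n+1}K_n^{-1}B_{n+1} & \text{if } j=n,\\ qK_nK_{n+1}^{-1}B_n & \text{if } j=n+1,\\ B_j & \text{else.}\end{cases}$$ 3) The relation $\tau_{n-1}\tau_n\tau_{n-1}\tau_n=\tau_n\tau_{n-1}\tau_n\tau_{n-1}$ holds. Moreover, $\tau_n\tau_j=\tau_j\tau_n$ if $j=1,\dots,n-2$.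
   Context: Let $k$ be a field containing $q\neq0$, not a root of unity, and a square root $q^{1/2}$ of $q$. Let $\mathfrak g=\mathfrak{so}_{2n+2}(\mathbb C)$ of type $D_{n+1}$ ($n+1\ge4$), with simple roots $\alpha_1,\dots,\alpha_{n+1}$ in Bourbaki ordering (so $\alpha_n$ and $\alpha_{n+1}$ are the two end nodes both joined to $\alpha_{n-1}$), and Cartan matrix $(a_{ij})$. $U_q(\mathfrak g)$ is the $k$-algebra with generators $E_i,F_i,K_i^{\pm1}$ ($1\le i\le n+1$) and relations $K_iK_i^{-1}=K_i^{-1}K_i=1$, $K_iK_j=K_jK_i$, $K_iE_jK_i^{-1}=q^{a_{ij}}E_j$, $K_iF_jK_i^{-1}=q^{-a_{ij}}F_j$, $E_iF_j-F_jE_i=\delta_{ij}(K_i-K_i^{-1})/(q-q^{-1})$, and quantum Serre relations ($X_iX_j=X_jX_i$ if $a_{ij}=0$; $X_i^2X_j-(q+q^{-1})X_iX_jX_i+X_jX_i^2=0$ if $a_{ij}=-1$; for $X=E$ and $X=F$). $U_q'(\mathfrak k)$ is the $k$-subalgebra of $U_q(\mathfrak g)$ generated by $B_i=F_i-K_i^{-1}E_i$ for $1\le i\le n-1$, $B_n=F_n-K_n^{-1}E_{n+1}$, $B_{n+1}=F_{n+1}-K_{n+1}^{-1}E_n$, and $K_nK_{n+1}^{-1}$, $K_n^{-1}K_{n+1}$. $kT_\theta$ is the subalgebra generated by $(K_nK_{n+1}^{-1})^{\pm1}$. $T_i$ denotes the Lusztig automorphism of $U_q(\mathfrak g)$; on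 the $K_j$ it acts by $T_i(K_j)=K_jK_i^{-a_{ij}}$. Write $[a,b]_q=ab-qba$. For $1\le i\le n-1$, $\tau_i$ is the algebra automorphism of $U_q'(\mathfrak k)$ determined by $\tau_i(x)=T_i(x)$ for $x\in kT_\theta$, $\tau_i(B_j)=[B_j,B_i]_q$ if $a_{ij}=-1$, and $\tau_i(B_j)=B_j$ otherwise ($1\le j\le n+1$). *)

theory Defs
  imports "HOL-Algebra.Algebra" "HOL-Library.Poly_Mapping"
begin

section \<open>Algebras given by generators and relations\<close>

text \<open>The free monoid is written additively because the convolution product on \<open>\<Rightarrow>\<^sub>0\<close> uses addition
  of exponents; thus \<open>'a word \<Rightarrow>\<^sub>0 'k\<close> is the free associative algebra on \<open>'a\<close>.\<close>

datatype 'a word = Word (letters: "'a list")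

instantiation word :: (type) monoid_add
begin

definition zero_word :: "'a word" where
  "0 = Word []"

definition plus_word :: "'a word \<Rightarrow> 'a word \<Rightarrow> 'a word" where
  "u + v = Word (letters u @ letters v)"

instance
  by standard (simp_all add: zero_word_def plus_word_def)

end

definition scalar :: "'k::field \<Rightarrow> 'a word \<Rightarrow>\<^sub>0 'k" where
  "scalar c = Poly_Mapping.single 0 c"

definition letter :: "'a \<Rightarrow> 'a word \<Rightarrow>\<^sub>0 'k::field" where
  "letter x = Poly_Mapping.single (Word [x]) 1"

definition free_algebra :: "'a set \<Rightarrow> ('a word \<Rightarrow>\<^sub>0 'k::field) ring" where
  "free_algebra G =
     \<lparr>carrier = {p. \<forall>w \<in> Poly_Mapping.keys p. set (letters w) \<subseteq> G},
      monoid.mult = (*), one = 1, ring.zero = 0, add = (+)\<rparr>"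

lemma free_algebra_mult_closed:
  assumes "p \<in> carrier (free_algebra G)" "r \<in> carrier (free_algebra G)"
  shows "p * r \<in> carrier (free_algebra G)"
  using assms keys_mult[of p r] by (fastforce simp: free_algebra_def plus_word_def)

lemma free_algebra_add_closed:
  assumes "p \<in> carrier (free_algebra G)" "r \<in> carrier (free_algebra G)"
  shows "p + r \<in> carrier (free_algebra G)"
  using assms Poly_Mapping.keys_add[of p r] by (fastforce simp: free_algebra_def)

lemma free_algebra_uminus_closed:
  assumes "p \<in> carrier (free_algebra G)"
  shows "- p \<in> carrier (free_algebra G)"
  using assms by (simp add: free_algebra_def)

lemma free_algebra_diff_closed:
  assumes "p \<in> carrier (free_algebra G)" "r \<in> carrier (free_algebra G)"
  shows "p - r \<in> carrier (free_algebra G)"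
  using free_algebra_add_closed[OF assms(1) free_algebra_uminus_closed[OF assms(2)]] by simp

lemma scalar_closed: "scalar c \<in> carrier (free_algebra G)"
  by (simp add: free_algebra_def scalar_def zero_word_def)

lemma letter_closed: "x \<in> G \<Longrightarrow> letter x \<in> carrier (free_algebra G)"
  by (simp add: free_algebra_def letter_def)

lemma one_closed_free_algebra: "1 \<in> carrier (free_algebra G)"
  by (simp add: free_algebra_def zero_word_def)

lemma zero_closed_free_algebra: "0 \<in> carrier (free_algebra G)"
  by (simp add: free_algebra_def)

lemmas free_algebra_closed =
  free_algebra_mult_closed free_algebra_add_closed free_algebra_uminus_closed
  free_algebra_diff_closed scalar_closed letter_closed one_closed_free_algebra
  zero_closed_free_algebra

lemma free_algebra_simps:
  "monoid.mult (free_algebra G) = (*)" "ring.add (free_algebra G) = (+)"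
  "monoid.one (free_algebra G) = 1" "ring.zero (free_algebra G) = 0"
  by (simp_all add: free_algebra_def)

lemma ring_free_algebra: "ring (free_algebra G)"
proof (rule ringI)
  show "abelian_group (free_algebra G)"
  proof (rule abelian_groupI)
    fix x assume x: "x \<in> carrier (free_algebra G)"
    show "\<exists>y \<in> carrier (free_algebra G).
      y \<oplus>\<^bsub>free_algebra G\<^esub> x = \<zero>\<^bsub>free_algebra G\<^esub>"
      by (rule bexI[OF _ free_algebra_uminus_closed[OF x]]) (simp add: free_algebra_simps)
  qed (use free_algebra_closed in \<open>auto simp: free_algebra_simps ac_simps\<close>)
  show "monoid (free_algebra G)"
    by (rule monoidI) (use free_algebra_closed in \<open>auto simp: free_algebra_simps ac_simps\<close>)
qed (auto simp: free_algebra_simps algebra_simps)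

text \<open>\<^const>\<open>genideal\<close> is the generated two-sided ideal, also in a noncommutative ring.
  A relation \<open>l = r\<close> is encoded by the element \<open>l - r\<close>.\<close>

definition presented_algebra ::
    "'a set \<Rightarrow> ('a word \<Rightarrow>\<^sub>0 'k::field) set \<Rightarrow> ('k, ('a word \<Rightarrow>\<^sub>0 'k) set) module" where
  "presented_algebra G R =
     (let A = free_algebra G; I = Idl\<^bsub>A\<^esub> R; Q = A Quot I
      in ring.extend Q (module.fields (\<lambda>c x. (I +>\<^bsub>A\<^esub> scalar c) \<otimes>\<^bsub>Q\<^esub> x)))"

lemma ring_presented_algebra:
  assumes "R \<subseteq> carrier (free_algebra G)"
  shows "ring (presented_algebra G R)"
proof -
  have "ideal (Idl\<^bsub>free_algebra G\<^esub> R) (free_algebra G)"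
    using ring.genideal_ideal[OF ring_free_algebra assms] .
  then have r: "ring (free_algebra G Quot Idl\<^bsub>free_algebra G\<^esub> R)" (is "ring ?Q")
    by (rule ideal.quotient_is_ring)
  interpret Q: ring ?Q by (rule r)
  have eqs: "carrier (presented_algebra G R) = carrier ?Q"
    "monoid.mult (presented_algebra G R) = monoid.mult ?Q" "ring.add (presented_algebra G R) = ring.add ?Q"
    "monoid.one (presented_algebra G R) = monoid.one ?Q" "ring.zero (presented_algebra G R) = ring.zero ?Q"
    by (simp_all add: presented_algebra_def Let_def ring.defs module.defs)
  show ?thesis
  proof (rule ringI)
    show "abelian_group (presented_algebra G R)"
      by (rule abelian_groupI) (auto simp: eqs Q.a_ac intro: Q.add.l_inv_ex)
    show "monoid (presented_algebra G R)"
      by (rule monoidI) (auto simp: eqs Q.m_assoc)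
  qed (auto simp: eqs Q.l_distr Q.r_distr)
qed

definition generator_class ::
    "'a set \<Rightarrow> ('a word \<Rightarrow>\<^sub>0 'k::field) set \<Rightarrow> 'a \<Rightarrow> ('a word \<Rightarrow>\<^sub>0 'k) set" where
  "generator_class G R x = (Idl\<^bsub>free_algebra G\<^esub> R) +>\<^bsub>free_algebra G\<^esub> letter x"

definition generated_subalgebra :: "('k, 'b) module \<Rightarrow> 'b set \<Rightarrow> 'b set" where
  "generated_subalgebra A S = generate_ring A (range (\<lambda>c. c \<odot>\<^bsub>A\<^esub> \<one>\<^bsub>A\<^esub>) \<union> S)"

text \<open>Algebra automorphisms are normalised to be undefined off the carrier (as in
  \<^const>\<open>Bij\<close>), so that two of them are equal as soon as they agree on the carrier.\<close>

definition algebra_auto :: "('k, 'b) module \<Rightarrow> ('b \<Rightarrow> 'b) set" where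
  "algebra_auto A =
     {f \<in> ring_iso A A \<inter> extensional (carrier A).
        \<forall>c. \<forall>x \<in> carrier A. f (c \<odot>\<^bsub>A\<^esub> x) = c \<odot>\<^bsub>A\<^esub> f x}"

definition q_comm :: "('k, 'b) module \<Rightarrow> 'k \<Rightarrow> 'b \<Rightarrow> 'b \<Rightarrow> 'b" where
  "q_comm A q a b = a \<otimes>\<^bsub>A\<^esub> b \<ominus>\<^bsub>A\<^esub> q \<odot>\<^bsub>A\<^esub> (b \<otimes>\<^bsub>A\<^esub> a)"


section \<open>The quantized enveloping algebra of type D\<close>

text \<open>Cartan matrix of type \<open>D\<^bsub>n+1\<^esub>\<close>, meaningful for indices in \<open>{1..n+1}\<close>: the
  chain \<open>1 - 2 - \<dots> - n\<close> together with an edge joining \<open>n-1\<close> and \<open>n+1\<close>.\<close>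

definition cartan_D :: "nat \<Rightarrow> nat \<Rightarrow> nat \<Rightarrow> int" where
  "cartan_D n i j =
     (if i = j then 2
      else if (j = i + 1 \<and> j \<le> n) \<or> (i = j + 1 \<and> i \<le> n)
            \<or> (i = n - 1 \<and> j = n + 1) \<or> (i = n + 1 \<and> j = n - 1) then -1
      else 0)"

text \<open>\<open>GKi i\<close> stands for the inverse of \<open>GK i\<close>.\<close>

datatype uq_gen = GE nat | GF nat | GK nat | GKi nat

definition Uq_gens :: "nat \<Rightarrow> uq_gen set" where
  "Uq_gens n = GE ` {1..n+1} \<union> GF ` {1..n+1} \<union> GK ` {1..n+1} \<union> GKi ` {1..n+1}"

definition Uq_rels :: "nat \<Rightarrow> 'k::field \<Rightarrow> (uq_gen word \<Rightarrow>\<^sub>0 'k) set" where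
  "Uq_rels n q =
     (let I = {1..n+1}; a = cartan_D n;
          E = (\<lambda>i. letter (GE i)); F = (\<lambda>i. letter (GF i));
          K = (\<lambda>i. letter (GK i)); Ki = (\<lambda>i. letter (GKi i))
      in {K i * Ki i - 1 | i. i \<in> I}
       \<union> {Ki i * K i - 1 | i. i \<in> I}
       \<union> {K i * K j - K j * K i | i j. i \<in> I \<and> j \<in> I}
       \<union> {K i * E j * Ki i - scalar (q powi a i j) * E j | i j. i \<in> I \<and> j \<in> I}
       \<union> {K i * F j * Ki i - scalar (q powi (- a i j)) * F j | i j. i \<in> I \<and> j \<in> I}
       \<union> {E i * F j - F j * E i
             - (if i = j then scalar (inverse (q - inverse q)) * (K i - Ki i) else 0)
            | i j. i \<in> I \<and> j \<in> I}
       \<union> {Z i * Z j - Z j * Z i | Z i j. Z \<in> {E, F} \<and> i \<in> I \<and> j \<in> I \<and> a i j = 0}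
       \<union> {Z i * Z i * Z j - scalar (q + inverse q) * Z i * Z j * Z i + Z j * Z i * Z i
            | Z i j. Z \<in> {E, F} \<and> i \<in> I \<and> j \<in> I \<and> a i j = -1})"

lemma Uq_rels_closed: "Uq_rels n q \<subseteq> carrier (free_algebra (Uq_gens n))"
  by (auto simp: Uq_rels_def Let_def Uq_gens_def intro!: free_algebra_closed)

definition Uq :: "nat \<Rightarrow> 'k::field \<Rightarrow> ('k, (uq_gen word \<Rightarrow>\<^sub>0 'k) set) module" where
  "Uq n q = presented_algebra (Uq_gens n) (Uq_rels n q)"

lemma ring_Uq: "ring (Uq n q)"
  unfolding Uq_def by (rule ring_presented_algebra[OF Uq_rels_closed])

definition uqE :: "nat \<Rightarrow> 'k::field \<Rightarrow> nat \<Rightarrow> (uq_gen word \<Rightarrow>\<^sub>0 'k) set" where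
  "uqE n q i = generator_class (Uq_gens n) (Uq_rels n q) (GE i)"

definition uqF :: "nat \<Rightarrow> 'k::field \<Rightarrow> nat \<Rightarrow> (uq_gen word \<Rightarrow>\<^sub>0 'k) set" where
  "uqF n q i = generator_class (Uq_gens n) (Uq_rels n q) (GF i)"

definition uqK :: "nat \<Rightarrow> 'k::field \<Rightarrow> nat \<Rightarrow> (uq_gen word \<Rightarrow>\<^sub>0 'k) set" where
  "uqK n q i = generator_class (Uq_gens n) (Uq_rels n q) (GK i)"

definition uqKi :: "nat \<Rightarrow> 'k::field \<Rightarrow> nat \<Rightarrow> (uq_gen word \<Rightarrow>\<^sub>0 'k) set" where
  "uqKi n q i = generator_class (Uq_gens n) (Uq_rels n q) (GKi i)"

text \<open>The Lusztig automorphism \<open>T\<^sub>i\<close> in the normalisation \<open>T''\<^bsub>i,1\<^esub>\<close> of Lusztig's book,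
  specialised to simply laced Cartan matrices.\<close>

definition lusztig_auto ::
    "nat \<Rightarrow> 'k::field \<Rightarrow> nat
     \<Rightarrow> ((uq_gen word \<Rightarrow>\<^sub>0 'k) set \<Rightarrow> (uq_gen word \<Rightarrow>\<^sub>0 'k) set) \<Rightarrow> bool" where
  "lusztig_auto n q i f \<longleftrightarrow>
     (let U = Uq n q; E = uqE n q; F = uqF n q; K = uqK n q; Ki = uqKi n q; a = cartan_D n
      in f \<in> algebra_auto U \<and>
         (\<forall>j \<in> {1..n+1}.
            f (K j) = K j \<otimes>\<^bsub>U\<^esub> (K i [^]\<^bsub>U\<^esub> (- a i j)) \<and>
            f (E j) = (if j = i then \<ominus>\<^bsub>U\<^esub> (F i \<otimes>\<^bsub>U\<^esub> K i)
                       else if a i j = -1 then q_comm U (inverse q) (E i) (E j)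
                       else E j) \<and>
            f (F j) = (if j = i then \<ominus>\<^bsub>U\<^esub> (Ki i \<otimes>\<^bsub>U\<^esub> E i)
                       else if a i j = -1 then q_comm U q (F j) (F i)
                       else F j)))"


section \<open>The coideal subalgebra and its braid group operators\<close>

definition uqB :: "nat \<Rightarrow> 'k::field \<Rightarrow> nat \<Rightarrow> (uq_gen word \<Rightarrow>\<^sub>0 'k) set" where
  "uqB n q i =
     (let U = Uq n q; E = uqE n q; F = uqF n q; Ki = uqKi n q
      in if i = n then F n \<ominus>\<^bsub>U\<^esub> Ki n \<otimes>\<^bsub>U\<^esub> E (n+1)
         else if i = n + 1 then F (n+1) \<ominus>\<^bsub>U\<^esub> Ki (n+1) \<otimes>\<^bsub>U\<^esub> E n
         else F i \<ominus>\<^bsub>U\<^esub> Ki i \<otimes>\<^bsub>U\<^esub> E i)"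

definition theta_torus_gens :: "nat \<Rightarrow> 'k::field \<Rightarrow> (uq_gen word \<Rightarrow>\<^sub>0 'k) set set" where
  "theta_torus_gens n q =
     {uqK n q n \<otimes>\<^bsub>Uq n q\<^esub> uqKi n q (n+1), uqKi n q n \<otimes>\<^bsub>Uq n q\<^esub> uqK n q (n+1)}"

definition theta_torus :: "nat \<Rightarrow> 'k::field \<Rightarrow> (uq_gen word \<Rightarrow>\<^sub>0 'k) set set" where
  "theta_torus n q = generated_subalgebra (Uq n q) (theta_torus_gens n q)"

definition Uqk :: "nat \<Rightarrow> 'k::field \<Rightarrow> ('k, (uq_gen word \<Rightarrow>\<^sub>0 'k) set) module" where
  "Uqk n q =
     (Uq n q)\<lparr>carrier :=
        generated_subalgebra (Uq n q) (uqB n q ` {1..n+1} \<union> theta_torus_gens n q)\<rparr>"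

text \<open>The operators \<open>\<tau>\<^sub>i\<close> for \<open>1 \<le> i \<le> n - 1\<close>; the family \<open>T\<close> stands for the Lusztig
  automorphisms.\<close>

definition is_tau ::
    "nat \<Rightarrow> 'k::field
     \<Rightarrow> (nat \<Rightarrow> (uq_gen word \<Rightarrow>\<^sub>0 'k) set \<Rightarrow> (uq_gen word \<Rightarrow>\<^sub>0 'k) set) \<Rightarrow> nat
     \<Rightarrow> ((uq_gen word \<Rightarrow>\<^sub>0 'k) set \<Rightarrow> (uq_gen word \<Rightarrow>\<^sub>0 'k) set) \<Rightarrow> bool" where
  "is_tau n q T i f \<longleftrightarrow>
     (let A = Uqk n q; B = uqB n q
      in f \<in> algebra_auto A \<and>
         (\<forall>x \<in> theta_torus n q. f x = T i x) \<and>
         (\<forall>j \<in> {1..n+1}.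
            f (B j) = (if cartan_D n i j = -1 then q_comm A q (B j) (B i) else B j)))"

definition is_tau_n_minus ::
    "nat \<Rightarrow> 'k::field
     \<Rightarrow> (nat \<Rightarrow> (uq_gen word \<Rightarrow>\<^sub>0 'k) set \<Rightarrow> (uq_gen word \<Rightarrow>\<^sub>0 'k) set)
     \<Rightarrow> ((uq_gen word \<Rightarrow>\<^sub>0 'k) set \<Rightarrow> (uq_gen word \<Rightarrow>\<^sub>0 'k) set) \<Rightarrow> bool" where
  "is_tau_n_minus n q T f \<longleftrightarrow>
     (let A = Uqk n q; B = uqB n q; K = uqK n q; Ki = uqKi n q
      in f \<in> algebra_auto A \<and>
         (\<forall>x \<in> theta_torus n q. f x = T n (T (n+1) x)) \<and>
         (\<forall>j \<in> {1..n+1}.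
            f (B j) =
              (if j = n - 1 then
                 inverse q \<odot>\<^bsub>A\<^esub> q_comm A q (B n) (q_comm A q (B (n+1)) (B (n-1)))
                 \<oplus>\<^bsub>A\<^esub> B (n-1) \<otimes>\<^bsub>A\<^esub> K n \<otimes>\<^bsub>A\<^esub> Ki (n+1)
               else if j = n then
                 inverse q \<odot>\<^bsub>A\<^esub> (K n \<otimes>\<^bsub>A\<^esub> Ki (n+1) \<otimes>\<^bsub>A\<^esub> B (n+1))
               else if j = n + 1 then
                 inverse q \<odot>\<^bsub>A\<^esub> (K (n+1) \<otimes>\<^bsub>A\<^esub> Ki n \<otimes>\<^bsub>A\<^esub> B n)
               else B j)))"

definition is_tau_n ::
    "nat \<Rightarrow> 'k::field
     \<Rightarrow> (nat \<Rightarrow> (uq_gen word \<Rightarrow>\<^sub>0 'k) set \<Rightarrow> (uq_gen word \<Rightarrow>\<^sub>0 'k) set)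
     \<Rightarrow> ((uq_gen word \<Rightarrow>\<^sub>0 'k) set \<Rightarrow> (uq_gen word \<Rightarrow>\<^sub>0 'k) set) \<Rightarrow> bool" where
  "is_tau_n n q T f \<longleftrightarrow>
     (let A = Uqk n q; B = uqB n q; K = uqK n q; Ki = uqKi n q
      in f \<in> algebra_auto A \<and>
         (\<forall>x \<in> theta_torus n q. f x = T n (T (n+1) x)) \<and>
         (\<forall>j \<in> {1..n+1}.
            f (B j) =
              (if j = n - 1 then
                 inverse q \<odot>\<^bsub>A\<^esub> q_comm A q (q_comm A q (B (n-1)) (B n)) (B (n+1))
                 \<oplus>\<^bsub>A\<^esub> B (n-1) \<otimes>\<^bsub>A\<^esub> K n \<otimes>\<^bsub>A\<^esub> Ki (n+1)
               else if j = n then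
                 q \<odot>\<^bsub>A\<^esub> (K (n+1) \<otimes>\<^bsub>A\<^esub> Ki n \<otimes>\<^bsub>A\<^esub> B (n+1))
               else if j = n + 1 then
                 q \<odot>\<^bsub>A\<^esub> (K n \<otimes>\<^bsub>A\<^esub> Ki (n+1) \<otimes>\<^bsub>A\<^esub> B n)
               else B j)))"

end

theory Submission
  imports Defs
begin

text \<open>The coideal subalgebra \<open>U'\<^sub>q(k)\<close> is presented by the \<open>q\<close>-Serre relations of the \<open>B\<^sub>j\<close> with right-hand sides
  of lower degree: modulo such relations a relation among the generators can be lowered in degree, because
  its leading part acts on highest weight vectors of Verma modules like the same expression in the \<open>F\<^sub>j\<close>.
  Endomorphisms can therefore be defined on generators.

  The relations for the images under \<open>\<tau>\<^sub>n\<^sup>-\<close> follow by normal form computations in the orbit of \<open>B\<^bsub>n-1\<^esub>\<close> under the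
  copy of \<open>U\<^sub>q(sl\<^sub>2)\<close> generated by \<open>B\<^sub>n\<close>, \<open>B\<^bsub>n+1\<^esub>\<close> and \<open>K\<^sub>nK\<^bsub>n+1\<^esub>\<^sup>-\<^sup>1\<close>. Passing to the opposite ring and exchanging
  \<open>n\<close> and \<open>n+1\<close> turns \<open>\<tau>\<^sub>n\<^sup>-\<close> into \<open>\<tau>\<^sub>n\<close>. The braid relation rests on \<open>\<tau>\<^bsub>n-1\<^esub>\<tau>\<^sub>n(B\<^bsub>n-1\<^esub>) = \<tau>\<^sub>n\<^sup>-(B\<^bsub>n-1\<^esub>)\<close>,
  which makes \<open>B\<^bsub>n-1\<^esub>\<close> a fixed point of \<open>\<tau>\<^sub>n\<tau>\<^bsub>n-1\<^esub>\<tau>\<^sub>n\<close> while \<open>\<tau>\<^bsub>n-1\<^esub>\<tau>\<^sub>n\<tau>\<^bsub>n-1\<^esub>\<close> swaps \<open>B\<^sub>n\<close> and \<open>B\<^bsub>n+1\<^esub>\<close>.\<close>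

section \<open>Evaluation of noncommutative polynomials\<close>

text \<open>Two obstacles shape the proof. \<open>Uq n q\<close> is a record with an explicit
  carrier, whereas the relation checks need simplification in a noncommutative ring given by a type
  class. So U_q(g) is embedded into a ring type by \<open>emb\<close>, the work is done there, and
  \<open>th\<close> carries the results back. Secondly, completeness of the relations of the B_j is
  proved without a basis of U_q(g). Leading terms suffice, and a module detects them: on the free
  algebra in the F_j, each F_j acts by left multiplication and E_j, K_j act as on a Verma module. Of
  the defining relations only the Serre relations of the F_j fail there, and they hold modulo the
  two-sided Serre ideal, which is stable under the action. Powers of K_nK_(n+1)^{-1} are separated
  by varying the highest weight, where q must not be a root of unity. Rules for the normal forms
  come from overlaps: a product such as \<open>b * z * x\<close>, reduced in two ways, yields the
  next rule, at times only after division by q or q + 1/q.\<close>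

locale central_scalars =
  fixes sc :: "'k::field \<Rightarrow> 'r::ring_1"
  assumes sc_add: "sc (c + d) = sc c + sc d"
    and sc_mult: "sc (c * d) = sc c * sc d"
    and sc_one [simp]: "sc 1 = 1"
    and sc_central: "sc c * x = x * sc c"
begin

lemma sc_zero [simp]: "sc 0 = 0"
  using sc_add[of 0 0] by simp

lemma sc_minus: "sc (- c) = - sc c"
  using sc_add[of c "- c"] by (simp add: eq_neg_iff_add_eq_0 add.commute)

lemma sc_diff: "sc (c - d) = sc c - sc d"
  using sc_add[of c "- d"] by (simp add: sc_minus)

lemma sc_left_commute: "x * (sc c * y) = sc c * (x * y)"
  by (metis mult.assoc sc_central)

definition eval_word :: "('a \<Rightarrow> 'r) \<Rightarrow> 'a word \<Rightarrow> 'r" where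
  "eval_word g w = prod_list (map g (letters w))"

text \<open>The same polynomials are evaluated in several rings: the free algebra itself, the field
  (for the augmentation), the operators on the Verma module, \<open>residues\<close>, and the target
  of a \<open>kolb_tuple\<close>. Only the central map \<open>sc\<close> varies.\<close>

definition ev :: "('a \<Rightarrow> 'r) \<Rightarrow> ('a word \<Rightarrow>\<^sub>0 'k) \<Rightarrow> 'r" where
  "ev g p = (\<Sum>w\<in>Poly_Mapping.keys p. sc (Poly_Mapping.lookup p w) * eval_word g w)"

lemma eval_word_zero [simp]: "eval_word g 0 = 1"
  by (simp add: eval_word_def zero_word_def)

lemma eval_word_Nil [simp]: "eval_word g (Word []) = 1"
  by (simp add: eval_word_def)

lemma eval_word_Cons: "eval_word g (Word (a # l)) = g a * eval_word g (Word l)"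
  by (simp add: eval_word_def)

lemma eval_word_plus: "eval_word g (u + v) = eval_word g u * eval_word g v"
  by (simp add: eval_word_def plus_word_def)

lemma ev_superset:
  assumes "finite S" "Poly_Mapping.keys p \<subseteq> S"
  shows "ev g p = (\<Sum>w\<in>S. sc (Poly_Mapping.lookup p w) * eval_word g w)"
  unfolding ev_def using assms by (intro sum.mono_neutral_left) (auto simp: in_keys_iff)

lemma ev_zero [simp]: "ev g 0 = 0"
  by (simp add: ev_def)

lemma ev_add: "ev g (p + r) = ev g p + ev g r"
proof -
  let ?S = "Poly_Mapping.keys p \<union> Poly_Mapping.keys r"
  have "Poly_Mapping.keys (p + r) \<subseteq> ?S" by (rule Poly_Mapping.keys_add)
  then have "ev g (p + r) = (\<Sum>w\<in>?S. sc (Poly_Mapping.lookup (p + r) w) * eval_word g w)"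
    by (intro ev_superset) auto
  also have "\<dots> = (\<Sum>w\<in>?S. sc (Poly_Mapping.lookup p w) * eval_word g w) + (\<Sum>w\<in>?S. sc (Poly_Mapping.lookup r w) * eval_word g w)"
    by (simp add: lookup_add sc_add distrib_right sum.distrib)
  also have "\<dots> = ev g p + ev g r"
    by (simp add: ev_superset[symmetric])
  finally show ?thesis .
qed

lemma ev_uminus: "ev g (- p) = - ev g p"
  using ev_add[of g p "- p"] by (simp add: eq_neg_iff_add_eq_0 add.commute)

lemma ev_diff: "ev g (p - r) = ev g p - ev g r"
  using ev_add[of g p "- r"] by (simp add: ev_uminus)

lemma ev_sum: "ev g (sum f S) = (\<Sum>s\<in>S. ev g (f s))"
  by (induction S rule: infinite_finite_induct) (simp_all add: ev_add)

lemma ev_single: "ev g (Poly_Mapping.single w c) = sc c * eval_word g w"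
  by (simp add: ev_def)

lemma ev_scalar [simp]: "ev g (scalar c) = sc c"
  by (simp add: scalar_def ev_single)

lemma ev_letter [simp]: "ev g (letter a) = g a"
  by (simp add: letter_def ev_single eval_word_def)

lemma ev_one [simp]: "ev g 1 = 1"
  using ev_scalar[of g 1] by (simp add: scalar_def)

end

lemma poly_mapping_sum_singles: "(\<Sum>w\<in>Poly_Mapping.keys p. Poly_Mapping.single w (Poly_Mapping.lookup p w)) = p"
  by (rule poly_mapping_eqI) (auto simp: lookup_sum lookup_single when_def in_keys_iff)

lemma poly_mapping_additive_induct [case_names single add]:
  fixes p :: "'a \<Rightarrow>\<^sub>0 'b::comm_monoid_add"
  assumes "\<And>w c. P (Poly_Mapping.single w c)" "\<And>p r. P p \<Longrightarrow> P r \<Longrightarrow> P (p + r)"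
  shows "P p"
proof -
  have "P (\<Sum>w\<in>S. Poly_Mapping.single w (Poly_Mapping.lookup p w))" for S
  proof (induction S rule: infinite_finite_induct)
    case (infinite A)
    then show ?case using assms(1)[of undefined 0] by simp
  next
    case empty
    then show ?case using assms(1)[of undefined 0] by simp
  qed (simp add: assms)
  from this[of "Poly_Mapping.keys p"] show ?thesis by (simp add: poly_mapping_sum_singles)
qed

context central_scalars
begin

lemma ev_mult: "ev g (p * r) = ev g p * ev g r"
proof (induction p rule: poly_mapping_additive_induct)
  case (single w c)
  show ?case
  proof (induction r rule: poly_mapping_additive_induct)
    case (single w' c')
    then show ?case
      by (simp add: mult_single ev_single sc_mult eval_word_plus mult.assoc
          sc_left_commute[of "eval_word g w"])
  qed (simp add: distrib_left ev_add)
qed (simp add: distrib_right ev_add)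

lemmas ev_simps = ev_add ev_uminus ev_diff ev_mult

end

lemma lookup_scalar_mult: "Poly_Mapping.lookup (scalar c * p) w = c * Poly_Mapping.lookup p w" for p :: "'a word \<Rightarrow>\<^sub>0 'k::field"
  unfolding scalar_def mult_map_scale_conv_mult[symmetric]
  by (simp only: Poly_Mapping.map.rep_eq when_def) simp

lemma central_scalars_scalar: "central_scalars (scalar :: 'k::field \<Rightarrow> 'a word \<Rightarrow>\<^sub>0 'k)"
proof
  fix c :: 'k and p :: "'a word \<Rightarrow>\<^sub>0 'k"
  show "scalar c * p = p * scalar c"
    by (induction p rule: poly_mapping_additive_induct)
       (simp_all add: scalar_def mult_single distrib_left distrib_right mult.commute)
qed (simp_all only: scalar_def single_add mult_single add_0_left single_one)

interpretation scalar: central_scalars "scalar :: 'k::field \<Rightarrow> 'a word \<Rightarrow>\<^sub>0 'k"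
  by (rule central_scalars_scalar)

lemma central_scalars_id: "central_scalars (\<lambda>c::'k::field. c)"
  by standard (simp_all only: mult.commute)

lemma poly_mapping_linear_induct [case_names word scale add]:
  fixes p :: "'a word \<Rightarrow>\<^sub>0 'k::field"
  assumes "\<And>l. P (Poly_Mapping.single (Word l) 1)"
    "\<And>c p. P p \<Longrightarrow> P (scalar c * p)" "\<And>p r. P p \<Longrightarrow> P r \<Longrightarrow> P (p + r)"
  shows "P p"
proof (induction p rule: poly_mapping_additive_induct)
  case (single w c)
  have "Poly_Mapping.single w c = scalar c * Poly_Mapping.single (Word (letters w)) 1"
    by (simp add: scalar_def mult_single)
  then show ?case using assms(1,2) by metis
qed (rule assms(3))

section \<open>Computations with the defining relations\<close>

text \<open>With products associated to the right, a rule for \<open>a * b\<close> misses its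
  occurrences inside \<open>a * (b * t)\<close>. Every rewrite rule below is therefore used in both
  forms.\<close>

lemma mult_assoc_ext: "a * b = r \<Longrightarrow> a * (b * t) = r * t" for a :: "'a::semigroup_mult"
  by (metis mult.assoc)

text \<open>The scalars q, 1/q, h = 1/(q - 1/q) and e = 1/(q + 1/q) enter as central ring elements,
  so that simplification handles them like other letters. The rules are oriented so that, with at
  most one factor \<open>h\<close>, only powers of \<open>q\<close> or of \<open>qi\<close>,
  \<open>h\<close> and \<open>qi * h\<close> survive.\<close>

locale q_scalars =
  fixes q qi h e :: "'a::ring_1"
  assumes q_comm: "u * q = q * u" and qi_comm: "u * qi = qi * u" and h_comm: "u * h = h * u"
    and q_qi: "q * qi = 1" and qh: "q * h = 1 + qi * h" and two_e: "e * (q + qi) = 1"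
begin

lemma qi_q: "qi * q = 1"
  using q_qi q_comm by metis

lemma qiqih: "qi * (qi * h) = h - qi"
proof -
  have "h = qi * (q * h)" by (simp add: mult.assoc[symmetric] qi_q)
  also have "\<dots> = qi + qi * (qi * h)" by (simp add: qh distrib_left)
  finally show ?thesis by (metis add_diff_cancel_left')
qed

lemmas scalar_rules = q_qi qi_q qh q_comm[of h] qi_comm[of h]
lemmas scalar_rw = scalar_rules scalar_rules[THEN mult_assoc_ext]
  qiqih qiqih[folded mult.assoc, THEN mult_assoc_ext, unfolded mult.assoc]

text \<open>Several overlaps give a relation only up to the factor q + 1/q; the element
  \<open>e\<close> exists for this division.\<close>

lemma two_cancel: "q * u + qi * u = 0 \<Longrightarrow> u = 0"
  by (metis distrib_right mult.assoc mult.left_neutral mult_zero_right two_e)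

lemma scale_cancel: "q * u = 0 \<Longrightarrow> u = 0" "qi * u = 0 \<Longrightarrow> u = 0"
  by (metis mult.assoc mult.left_neutral mult_zero_right qi_q q_qi)+

end

text \<open>Here \<open>b\<close>, \<open>c\<close>, \<open>k\<close>, \<open>x\<close> stand for \<open>B\<^bsub>n\<^esub>\<close>, \<open>B\<^bsub>n+1\<^esub>\<close>, \<open>K\<^bsub>n\<^esub>K\<^bsub>n+1\<^esub>\<^sup>-\<^sup>1\<close>, \<open>B\<^bsub>n-1\<^esub>\<close>; the elements
  \<open>b\<close>, \<open>c\<close>, \<open>k\<close> generate a copy of \<open>U\<^sub>q(sl\<^sub>2)\<close>, and \<open>x\<close>, \<open>w\<close>, \<open>z\<close>, \<open>v\<close> span the orbit of \<open>x\<close>.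
  All rewriting moves \<open>b\<close>, \<open>c\<close>, \<open>k\<close> to the right.\<close>

locale kolb_linear = q_scalars q qi h e for q qi h e :: "'a::ring_1" +
  fixes b c k ki x :: 'a
  assumes k_ki: "k * ki = 1" and ki_k: "ki * k = 1"
    and kb: "k * b = qi * (qi * (b * k))" and kc: "k * c = q * (q * (c * k))"
    and kx: "k * x = x * k"
    and bc: "b * c - c * b = h * (k - ki)"
    and serre_b: "b * b * x - (q + qi) * (b * x * b) + x * b * b = 0"
    and serre_c: "c * c * x - (q + qi) * (c * x * c) + x * c * c = 0"
begin

definition "w = b * x - q * (x * b)"
definition "z = c * x - q * (x * c)"
definition "v = b * z - q * (z * b)"

lemmas central_rules =
  q_comm[of b] q_comm[of c] q_comm[of k] q_comm[of ki] q_comm[of x] q_comm[of w] q_comm[of z] q_comm[of v]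
  qi_comm[of b] qi_comm[of c] qi_comm[of k] qi_comm[of ki] qi_comm[of x] qi_comm[of w] qi_comm[of z] qi_comm[of v]
  h_comm[of b] h_comm[of c] h_comm[of k] h_comm[of ki] h_comm[of x] h_comm[of w] h_comm[of z] h_comm[of v]
lemmas rw0 = scalar_rw central_rules central_rules[THEN mult_assoc_ext]

lemma ki_conj:
  assumes "k * u = s * (u * k)" "s * s' = 1" "\<And>t. t * s' = s' * t"
  shows "ki * u = s' * (u * ki)"
proof -
  have "s' * (u * ki) = ki * (k * (s' * (u * ki)))"
    by (simp add: mult.assoc[symmetric] ki_k)
  also have "\<dots> = ki * (s' * (k * u) * ki)"
    by (metis assms(3) mult.assoc)
  also have "\<dots> = ki * ((s * s') * u * (k * ki))"
    by (metis assms(1,3) mult.assoc)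
  finally show ?thesis by (simp add: k_ki assms(2))
qed

lemma kib: "ki * b = q * (q * (b * ki))"
proof -
  have "ki * b = q * q * (b * ki)"
  proof (rule ki_conj[where s = "qi * qi"])
    show "t * (q * q) = q * q * t" for t by (metis mult.assoc q_comm)
  qed (simp_all add: kb mult.assoc rw0)
  then show ?thesis by (simp add: mult.assoc)
qed

lemma kic: "ki * c = qi * (qi * (c * ki))"
proof -
  have "ki * c = qi * qi * (c * ki)"
  proof (rule ki_conj[where s = "q * q"])
    show "t * (qi * qi) = qi * qi * t" for t by (metis mult.assoc qi_comm)
  qed (simp_all add: kc mult.assoc rw0)
  then show ?thesis by (simp add: mult.assoc)
qed

lemma kix: "ki * x = x * ki"
  using ki_conj[of x 1 1] by (simp add: kx)

lemma cb: "c * b = b * c - h * k + h * ki"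
  using bc by (simp add: algebra_simps)

lemma bx: "b * x = q * (x * b) + w" by (simp add: w_def)
lemma cx: "c * x = q * (x * c) + z" by (simp add: z_def)
lemma bz: "b * z = q * (z * b) + v" by (simp add: v_def)

lemma bw: "b * w = qi * (w * b)"
proof -
  have "b * w - qi * (w * b) = b * b * x - (q + qi) * (b * x * b) + x * b * b"
    by (simp add: w_def algebra_simps rw0)
  then show ?thesis using serre_b by simp
qed

lemma cz: "c * z = qi * (z * c)"
proof -
  have "c * z - qi * (z * c) = c * c * x - (q + qi) * (c * x * c) + x * c * c"
    by (simp add: z_def algebra_simps rw0)
  then show ?thesis using serre_c by simp
qed

lemmas torus_rules = k_ki ki_k kb kc kx kib kic kix
lemmas torus_rw = rw0 torus_rules torus_rules[THEN mult_assoc_ext]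

lemma kw: "k * w = qi * (qi * (w * k))" by (simp add: w_def algebra_simps torus_rw)
lemma kz: "k * z = q * (q * (z * k))" by (simp add: z_def algebra_simps torus_rw)
lemma kiw: "ki * w = q * (q * (w * ki))" by (simp add: w_def algebra_simps torus_rw)
lemma kiz: "ki * z = qi * (qi * (z * ki))" by (simp add: z_def algebra_simps torus_rw)
lemmas torus_rules' = kw kz kiw kiz
lemmas torus_rw' = torus_rw torus_rules' torus_rules'[THEN mult_assoc_ext]
lemma kv: "k * v = v * k" by (simp add: v_def algebra_simps torus_rw')
lemma kiv: "ki * v = v * ki" by (simp add: v_def algebra_simps torus_rw')

lemmas linear_rules = kv kiv bx cx bz bw cz cb
lemmas linear_rw = torus_rw' linear_rules linear_rules[THEN mult_assoc_ext]

text \<open>Expanding \<open>w\<close> brings \<open>c\<close> next to \<open>b\<close>. The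
  commutator then leaves the torus terms, with coefficient (q^2 - 1) h = q.\<close>

lemma cw: "c * w = q * (w * c) + v + q * (x * k) - q * (x * ki)"
proof -
  have "c * w = c * (b * x) - q * (c * (x * b))"
    by (simp add: w_def algebra_simps rw0)
  also have "c * (b * x) = (b * c - h * k + h * ki) * x"
    by (simp add: cb mult.assoc[symmetric])
  finally show ?thesis
    by (simp add: algebra_simps linear_rw)
qed

lemmas linear_rules2 = cw cw[THEN mult_assoc_ext]

text \<open>The product \<open>b * c * w\<close> is reduced once through the commutator of
  \<open>b\<close> and \<open>c\<close> and once through \<open>cw\<close>; every product that
  occurs except \<open>b * v\<close> already has a rule.\<close>

lemma bv: "b * v = qi * (v * b) - (q * q - qi * qi) * (x * b * k) - (q + qi) * (w * k)"
proof -
  have "b * (c * w) = (c * b + h * k - h * ki) * w"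
    by (simp add: cb mult.assoc)
  moreover have "b * (c * w) = b * (q * (w * c) + v + q * (x * k) - q * (x * ki))"
    by (simp only: cw)
  ultimately have "b * v = c * (b * w) + h * (k * w) - h * (ki * w) - b * (q * (w * c) + q * (x * k) - q * (x * ki))"
    by (simp add: algebra_simps)
  also have "\<dots> = qi * (v * b) - (q * q - qi * qi) * (x * b * k) - (q + qi) * (w * k)"
    by (simp add: algebra_simps linear_rw linear_rules2)
  finally show ?thesis .
qed

lemma cv: "c * v = qi * (v * c) - q * (z * k) - qi * (z * ki)"
proof -
  have "c * v = (c * b) * z - q * (c * (z * b))"
    by (simp add: v_def algebra_simps rw0)
  also have "\<dots> = qi * (v * c) - q * (z * k) - qi * (z * ki)"
    by (simp add: algebra_simps linear_rw linear_rules2)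
  finally show ?thesis .
qed

lemmas linear_rules3 = bv cv
lemmas lin_rw = linear_rw linear_rules2 linear_rules3 linear_rules3[THEN mult_assoc_ext]

end

section \<open>Products of two elements of the orbit of B_(n-1)\<close>

locale kolb_three = kolb_linear +
  assumes serre_xb: "x * x * b - (q + qi) * (x * b * x) + b * x * x = - (qi * b)"
    and serre_xc: "x * x * c - (q + qi) * (x * c * x) + c * x * x = - (qi * c)"
begin

lemma wx: "w * x = qi * (x * w) - qi * b"
proof -
  have "w * x - qi * (x * w) = x * x * b - (q + qi) * (x * b * x) + b * x * x"
    by (simp add: w_def algebra_simps rw0)
  then have "w * x = - (qi * b) + qi * (x * w)" by (simp only: serre_xb diff_eq_eq)
  then show ?thesis by simp
qed

lemma zx: "z * x = qi * (x * z) - qi * c"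
proof -
  have "z * x - qi * (x * z) = x * x * c - (q + qi) * (x * c * x) + c * x * x"
    by (simp add: z_def algebra_simps rw0)
  then have "z * x = - (qi * c) + qi * (x * z)" by (simp only: serre_xc diff_eq_eq)
  then show ?thesis by simp
qed

lemmas quad1 = wx zx wx[THEN mult_assoc_ext] zx[THEN mult_assoc_ext]

lemma b_zx: "(q * (z * b) + v) * x - b * (qi * (x * z) - qi * c) = 0"
  by (simp add: bz[symmetric] zx[symmetric] mult.assoc)

lemma c_wx: "(q * (w * c) + v + q * (x * k) - q * (x * ki)) * x - c * (qi * (x * w) - qi * b) = 0"
  by (simp add: cw[symmetric] wx[symmetric] mult.assoc)

text \<open>The overlaps \<open>b * z * x\<close> and \<open>c * w * x\<close> both contain the
  unknown product \<open>v * x\<close> with coefficient 1. It cancels in their difference, and what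
  remains is (q + 1/q) times the desired relation.\<close>

lemma zw: "z * w = w * z - h * k + h * ki"
proof -
  let ?u = "z * w - (w * z - h * k + h * ki)"
  have "q * ?u + qi * ?u
      = ((q * (z * b) + v) * x - b * (qi * (x * z) - qi * c))
        - ((q * (w * c) + v + q * (x * k) - q * (x * ki)) * x - c * (qi * (x * w) - qi * b))"
    by (simp add: algebra_simps lin_rw quad1)
  also have "\<dots> = 0" by (simp only: b_zx c_wx diff_self)
  finally have "?u = 0" by (rule two_cancel)
  then show ?thesis by simp
qed

lemmas quad2 = quad1 zw zw[THEN mult_assoc_ext]

text \<open>With \<open>zw\<close> available, the overlap \<open>b * z * x\<close> contains
  \<open>v * x\<close> as its only unknown.\<close>

lemma vx: "v * x = x * v - (q - qi) * (w * z) + (q - qi) * (b * c)"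
proof -
  have "v * x - (x * v - (q - qi) * (w * z) + (q - qi) * (b * c))
      = (q * (z * b) + v) * x - b * (qi * (x * z) - qi * c)"
    by (simp add: algebra_simps lin_rw quad2)
  then show ?thesis by (simp add: b_zx)
qed

text \<open>This rule and \<open>vz\<close> come from multiplying \<open>zw\<close> on the left by
  \<open>b\<close> and by \<open>c\<close>.\<close>

lemma vw: "v * w = qi * (w * v) - qi * (b * k) - q * (b * ki)"
proof -
  have "v * w - (qi * (w * v) - qi * (b * k) - q * (b * ki))
      = (q * (z * b) + v) * w - b * (w * z - h * k + h * ki)"
    by (simp add: algebra_simps lin_rw quad2)
  also have "\<dots> = 0" by (simp add: bz[symmetric] zw[symmetric] mult.assoc)
  finally show ?thesis by simp
qed

lemma vz: "v * z = qi * (z * v) + (qi - q * q * q) * (x * z * k) - (q + qi) * (c * k)"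
proof -
  have "v * z - (qi * (z * v) + (qi - q * q * q) * (x * z * k) - (q + qi) * (c * k))
      = c * (w * z - h * k + h * ki) - qi * (z * c) * w"
    by (simp add: algebra_simps lin_rw quad2)
  also have "\<dots> = 0" by (simp add: cz[symmetric] zw[symmetric] mult.assoc)
  finally show ?thesis by simp
qed

lemmas quad3 = quad2 vx vw vz vx[THEN mult_assoc_ext] vw[THEN mult_assoc_ext] vz[THEN mult_assoc_ext]

lemmas three_rw = lin_rw quad3

text \<open>Images of \<open>x\<close>, \<open>b\<close>, \<open>c\<close> under tau_n^-; here
  \<open>v\<close> is the iterated commutator [b, [c, x]_q]_q.\<close>

definition "x1 = qi * v + x * k"
definition "b1 = qi * (k * c)"
definition "c1 = qi * (ki * b)"

lemma x1_altdef: "x1 = qi * (b * (c * x - q * (x * c)) - q * ((c * x - q * (x * c)) * b)) + x * k"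
  by (simp add: x1_def v_def z_def)

text \<open>\<open>k\<close> and \<open>ki\<close> trade places because T_nT_(n+1) inverts
  K_nK_(n+1)^{-1}. The rule set now covers all products of two orbit elements that occur, so each
  relation is decided by normal forms.\<close>

lemma kolb_three_image: "kolb_three q qi h e b1 c1 ki k x1"
proof
  show "b1 * c1 - c1 * b1 = h * (ki - k)"
    by (simp add: b1_def c1_def algebra_simps three_rw)
  show "b1 * b1 * x1 - (q + qi) * (b1 * x1 * b1) + x1 * b1 * b1 = 0"
    by (simp add: b1_def x1_def algebra_simps three_rw)
  show "c1 * c1 * x1 - (q + qi) * (c1 * x1 * c1) + x1 * c1 * c1 = 0"
    by (simp add: c1_def x1_def algebra_simps three_rw)
  show "x1 * x1 * b1 - (q + qi) * (x1 * b1 * x1) + b1 * x1 * x1 = - (qi * b1)"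
    by (simp add: b1_def x1_def algebra_simps three_rw)
  show "x1 * x1 * c1 - (q + qi) * (x1 * c1 * x1) + c1 * x1 * x1 = - (qi * c1)"
    by (simp add: c1_def x1_def algebra_simps three_rw)
qed (simp_all add: k_ki ki_k b1_def c1_def x1_def algebra_simps three_rw)

text \<open>The formula for tau_n(B_(n-1)) is evaluated at the images under tau_n^-, with
  \<open>ki\<close> as the image of \<open>k\<close>: tau_n^- after tau_n fixes B_(n-1).\<close>

lemma inverse_after_image:
  "qi * ((x1 * b1 - q * (b1 * x1)) * c1 - q * (c1 * (x1 * b1 - q * (b1 * x1)))) + x1 * ki = x"
  by (simp add: b1_def c1_def x1_def algebra_simps three_rw)

definition "x2 = qi * ((x * b - q * (b * x)) * c - q * (c * (x * b - q * (b * x)))) + x * k"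

text \<open>\<open>w\<close> and \<open>z\<close> are the images of \<open>b\<close> and
  \<open>c\<close> under tau_(n-1), so the left-hand side is tau_(n-1) applied to \<open>x2\<close>,
  the image of \<open>x\<close> under tau_n.\<close>

lemma braid_x:
  "qi * ((x * w - q * (w * x)) * z - q * (z * (x * w - q * (w * x)))) + x * k = x1"
  by (simp add: x1_def algebra_simps three_rw)

text \<open>The left-hand side is tau_(n-1)tau_n(w): tau_n turns \<open>w\<close> = [b, x]_q into
  [q ki c, x2]_q, and then tau_(n-1) sends \<open>c\<close> to \<open>z\<close> and, by
  \<open>braid_x\<close>, \<open>x2\<close> to \<open>x1\<close>.\<close>

lemma braid_b: "q * (ki * z) * x1 - q * (x1 * (q * (ki * z))) = c"
  by (simp add: x1_def algebra_simps three_rw)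

lemma braid_c: "q * (k * w) * x1 - q * (x1 * (q * (k * w))) = b"
  by (simp add: x1_def algebra_simps three_rw)

end

section \<open>Adjoining the neighbour B_(n-2)\<close>

locale kolb_four = kolb_three q qi h e b c k ki x for q qi h e b c k ki x :: "'a::ring_1" +
  fixes y :: 'a
  assumes ky: "k * y = y * k" and b_y: "b * y = y * b" and c_y: "c * y = y * c"
    and serre_xy: "x * x * y - (q + qi) * (x * y * x) + y * x * x = - (qi * y)"
    and serre_yx: "y * y * x - (q + qi) * (y * x * y) + x * y * y = - (qi * x)"
begin

definition "p = x * y - q * (y * x)"

lemma kiy: "ki * y = y * ki"
  using ki_conj[of y 1 1] by (simp add: ky)

lemmas y_rules0 = q_comm[of y] qi_comm[of y] h_comm[of y] q_comm[of p] qi_comm[of p] h_comm[of p]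
  ky kiy b_y c_y
lemmas y_rw0 = y_rules0 y_rules0[THEN mult_assoc_ext]

lemma kp: "k * p = p * k"
  by (simp add: p_def algebra_simps torus_rw y_rw0)

lemma serre_bp: "b * b * p - (q + qi) * (b * p * b) + p * b * b = 0"
proof -
  have "b * b * p - (q + qi) * (b * p * b) + p * b * b
     = (b * b * x - (q + qi) * (b * x * b) + x * b * b) * y
       - q * (y * (b * b * x - (q + qi) * (b * x * b) + x * b * b))"
    by (simp add: p_def algebra_simps rw0 y_rw0)
  then show ?thesis by (simp only: serre_b mult_zero_left mult_zero_right diff_self)
qed

lemma serre_cp: "c * c * p - (q + qi) * (c * p * c) + p * c * c = 0"
proof -
  have "c * c * p - (q + qi) * (c * p * c) + p * c * c
     = (c * c * x - (q + qi) * (c * x * c) + x * c * c) * y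
       - q * (y * (c * c * x - (q + qi) * (c * x * c) + x * c * c))"
    by (simp add: p_def algebra_simps rw0 y_rw0)
  then show ?thesis by (simp only: serre_c mult_zero_left mult_zero_right diff_self)
qed

text \<open>Since \<open>y\<close> commutes with \<open>b\<close>, \<open>c\<close> and
  \<open>k\<close>, the commutator p = [x, y]_q inherits the linear relations of \<open>x\<close>.
  All rules for the orbit \<open>p\<close>, \<open>P.w\<close>, \<open>P.z\<close>,
  \<open>P.v\<close> come with this instance.\<close>

sublocale P: kolb_linear q qi h e b c k ki p
  by standard (fact k_ki ki_k kb kc kp bc serre_bp serre_cp)+

lemma xy: "x * y = q * (y * x) + p" by (simp add: p_def)
lemma wy: "w * y = q * (y * w) + P.w" unfolding w_def P.w_def by (simp add: p_def algebra_simps rw0 y_rw0)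
lemma zy: "z * y = q * (y * z) + P.z" unfolding z_def P.z_def by (simp add: p_def algebra_simps rw0 y_rw0)

lemmas y_rules1 = xy wy zy
lemmas y_rw1 = y_rules1 y_rules1[THEN mult_assoc_ext]

lemma vy: "v * y = q * (y * v) + P.v"
  by (simp add: v_def P.v_def algebra_simps rw0 y_rw0 y_rw1)

lemma py: "p * y = qi * (y * p) - qi * x"
proof -
  have "p * y - qi * (y * p) = y * y * x - (q + qi) * (y * x * y) + x * y * y"
    by (simp add: p_def algebra_simps rw0 y_rw0)
  then have "p * y = - (qi * x) + qi * (y * p)" by (simp only: serre_yx diff_eq_eq)
  then show ?thesis by simp
qed

lemma xp: "x * p = qi * (p * x) - qi * y"
proof -
  have "x * p - qi * (p * x) = x * x * y - (q + qi) * (x * y * x) + y * x * x"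
    by (simp add: p_def algebra_simps rw0 y_rw0)
  then have "x * p = - (qi * y) + qi * (p * x)" by (simp only: serre_xy diff_eq_eq)
  then show ?thesis by simp
qed

lemmas y_rules2 = vy py xp
lemmas y_rw2 = y_rw0 y_rw1 y_rules2 y_rules2[THEN mult_assoc_ext]

lemma Pwy: "P.w * y = qi * (y * P.w) - qi * w"
  by (simp add: P.w_def w_def algebra_simps rw0 y_rw0 py py[THEN mult_assoc_ext])
lemma Pzy: "P.z * y = qi * (y * P.z) - qi * z"
  by (simp add: P.z_def z_def algebra_simps rw0 y_rw0 py py[THEN mult_assoc_ext])
lemma Pvy: "P.v * y = qi * (y * P.v) - qi * v"
  by (simp add: P.v_def v_def algebra_simps rw0 P.rw0 y_rw0 Pzy Pzy[THEN mult_assoc_ext])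

lemmas y_rules3 = Pwy Pzy Pvy
lemmas y_rw3 = y_rw2 y_rules3 y_rules3[THEN mult_assoc_ext] three_rw P.lin_rw

text \<open>The overlaps \<open>b * x * p\<close> and \<open>w * x * y\<close> share the unknown
  product \<open>w * p\<close>. Their difference is (q + 1/q) times the commutator of
  \<open>P.w\<close> and \<open>x\<close>; once that vanishes, the first overlap determines
  \<open>w * p\<close>.\<close>

lemma x_Pw: "x * P.w = P.w * x" and w_p: "w * p = p * w + (qi - q) * (P.w * x) + (q - qi) * (y * b)"
proof -
  let ?b_xp = "(q * (x * b) + w) * p - b * (qi * (p * x) - qi * y)"
  let ?wx_y = "w * (q * (y * x) + p) - (qi * (x * w) - qi * b) * y"
  have zero: "?b_xp = 0" "?wx_y = 0"
    by (simp_all add: bx[symmetric] xp[symmetric] xy[symmetric] wx[symmetric] mult.assoc)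
  have "q * (P.w * x - x * P.w) + qi * (P.w * x - x * P.w) = ?wx_y - ?b_xp"
    by (simp add: algebra_simps y_rw3)
  also have "\<dots> = 0" by (simp only: zero diff_self)
  finally have "P.w * x - x * P.w = 0" by (rule two_cancel)
  then show *: "x * P.w = P.w * x" by simp
  have "w * p - (p * w + (qi - q) * (P.w * x) + (q - qi) * (y * b)) = ?b_xp"
    by (simp add: algebra_simps y_rw3 * mult_assoc_ext[OF *])
  then show "w * p = p * w + (qi - q) * (P.w * x) + (q - qi) * (y * b)"
    by (simp only: zero right_minus_eq)
qed

lemma x_Pz: "x * P.z = P.z * x" and z_p: "z * p = p * z + (qi - q) * (P.z * x) + (q - qi) * (y * c)"
proof -
  let ?c_xp = "(q * (x * c) + z) * p - c * (qi * (p * x) - qi * y)"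
  let ?zx_y = "z * (q * (y * x) + p) - (qi * (x * z) - qi * c) * y"
  have zero: "?c_xp = 0" "?zx_y = 0"
    by (simp_all add: cx[symmetric] xp[symmetric] xy[symmetric] zx[symmetric] mult.assoc)
  have "q * (P.z * x - x * P.z) + qi * (P.z * x - x * P.z) = ?zx_y - ?c_xp"
    by (simp add: algebra_simps y_rw3)
  also have "\<dots> = 0" by (simp only: zero diff_self)
  finally have "P.z * x - x * P.z = 0" by (rule two_cancel)
  then show *: "x * P.z = P.z * x" by simp
  have "z * p - (p * z + (qi - q) * (P.z * x) + (q - qi) * (y * c)) = ?c_xp"
    by (simp add: algebra_simps y_rw3 * mult_assoc_ext[OF *])
  then show "z * p = p * z + (qi - q) * (P.z * x) + (q - qi) * (y * c)"
    by (simp only: zero right_minus_eq)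
qed

lemmas mixed1 = x_Pw x_Pz w_p z_p
lemmas mixed_rw1 = y_rw3 mixed1 mixed1[THEN mult_assoc_ext]

text \<open>\<open>x * P.v\<close> is kept as a normal monomial: together with \<open>p\<close>, \<open>P.w\<close>, \<open>P.z\<close>, \<open>P.v\<close> it accounts for
  the root vector of degree \<open>y + 2x + b + c\<close>.\<close>

lemma w_Pz: "w * P.z = P.v * x + q * (P.z * w) - q * (x * P.v)"
proof -
  have "w * P.z - (P.v * x + q * (P.z * w) - q * (x * P.v)) = (q * (x * b) + w) * P.z - b * (P.z * x)"
    by (simp add: algebra_simps mixed_rw1)
  also have "\<dots> = 0"
    by (simp add: bx[symmetric] x_Pz[symmetric] mult.assoc)
  finally show ?thesis by simp
qed

lemma z_Pw: "z * P.w = P.v * x + q * (P.w * z) + q * (y * k) - q * (y * ki) - q * (x * P.v)"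
proof -
  have "z * P.w - (P.v * x + q * (P.w * z) + q * (y * k) - q * (y * ki) - q * (x * P.v))
      = (q * (x * c) + z) * P.w - c * (P.w * x)"
    by (simp add: algebra_simps mixed_rw1)
  also have "\<dots> = 0"
    by (simp add: cx[symmetric] x_Pw[symmetric] mult.assoc)
  finally show ?thesis by simp
qed

lemmas mixed2 = w_Pz z_Pw
lemmas mixed_rw2 = mixed_rw1 mixed2 mixed2[THEN mult_assoc_ext]

text \<open>From the overlap \<open>c * w * p\<close>. The last summand is -q times the right-hand
  side of \<open>w_Pz\<close>, that is, \<open>w * P.z\<close> already in normal form.\<close>

lemma v_p: "v * p = q * (p * v) - (q - qi) * (P.v * x) + (1 - q * q) * (P.w * z) + P.z * w
    - (qi - q - q + q * q * q) * (y * b * c) - q * (P.v * x + q * (P.z * w) - q * (x * P.v))"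
  (is "_ = ?r")
proof -
  have "v * p - ?r = (q * (w * c) + v + q * (x * k) - q * (x * ki)) * p
      - c * (p * w + (qi - q) * (P.w * x) + (q - qi) * (y * b))"
    by (simp add: algebra_simps mixed_rw2)
  also have "\<dots> = 0"
    by (simp add: cw[symmetric] w_p[symmetric] mult.assoc)
  finally show ?thesis by simp
qed

lemmas mixed_rw3 = mixed_rw2 v_p v_p[THEN mult_assoc_ext]

text \<open>The overlap \<open>b * w * P.z\<close> yields this rule multiplied by q + 1/q.\<close>

lemma w_Pv: "w * P.v = P.v * w - (q - qi) * (p * w * k) + (q * q - 1) * (P.w * x * k) - (q * q - 1) * (y * b * k)"
  (is "_ = ?r")
proof -
  have "q * (w * P.v - ?r) + qi * (w * P.v - ?r)
      = qi * (w * b) * P.z - b * (P.v * x + q * (P.z * w) - q * (x * P.v))"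
    by (simp add: algebra_simps mixed_rw3)
  also have "\<dots> = 0"
    by (simp add: bw[symmetric] w_Pz[symmetric] mult.assoc)
  finally have "w * P.v - ?r = 0" by (rule two_cancel)
  then show ?thesis by simp
qed

lemmas mixed_rw4 = mixed_rw3 w_Pv w_Pv[THEN mult_assoc_ext]

lemma y_x1: "x1 * y - q * (y * x1) = qi * P.v + p * k"
  by (simp add: x1_def algebra_simps mixed_rw3)

text \<open>Rewriting alone does not suffice, as there is no rule for \<open>v * P.v\<close>. In
  terms of [x1, y]_q, called \<open>?p\<close>, the relation is a q-commutation of \<open>x1\<close>
  with \<open>?p\<close>, and q^2 times it is exactly the overlap \<open>c * w * P.v\<close>. The
  two factors q compensate the coefficient 1/q of \<open>v\<close> in \<open>x1\<close> and of
  \<open>P.v\<close> in \<open>?p\<close>.\<close>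

lemma serre_x1y: "x1 * x1 * y - (q + qi) * (x1 * y * x1) + y * x1 * x1 = - (qi * y)"
proof -
  let ?p = "qi * P.v + p * k"
  have "q * (q * (x1 * ?p - qi * (?p * x1) + qi * y))
      = (q * (w * c) + v + q * (x * k) - q * (x * ki)) * P.v
        - c * (P.v * w - (q - qi) * (p * w * k) + (q * q - 1) * (P.w * x * k) - (q * q - 1) * (y * b * k))"
    by (simp add: x1_def algebra_simps mixed_rw4)
  also have "\<dots> = 0"
    by (simp only: cw[symmetric] w_Pv[symmetric] mult.assoc[of c w] diff_self)
  finally have "q * (x1 * ?p - qi * (?p * x1) + qi * y) = 0" by (rule scale_cancel)
  then have *: "x1 * ?p - qi * (?p * x1) + qi * y = 0" by (rule scale_cancel)
  have "x1 * x1 * y - (q + qi) * (x1 * y * x1) + y * x1 * x1 = x1 * ?p - qi * (?p * x1)"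
    unfolding y_x1[symmetric]
    by (simp add: algebra_simps q_comm[of x1] qi_comm[of x1] rw0 mult_assoc_ext[OF q_comm[of x1]]
        mult_assoc_ext[OF qi_comm[of x1]])
  then show ?thesis using * by (simp add: eq_neg_iff_add_eq_0)
qed

lemma serre_yx1: "y * y * x1 - (q + qi) * (y * x1 * y) + x1 * y * y = - (qi * x1)"
  by (simp add: x1_def algebra_simps mixed_rw3)

lemma kolb_four_image: "kolb_four q qi h e b1 c1 ki k x1 y"
proof -
  interpret I: kolb_three q qi h e b1 c1 ki k x1 by (rule kolb_three_image)
  show ?thesis
  proof
    show "b1 * y = y * b1" "c1 * y = y * c1"
      by (simp_all add: b1_def c1_def algebra_simps rw0 y_rw0)
  qed (fact kiy serre_x1y serre_yx1)+
qed

text \<open>The two sides of the braid relation at B_(n-2), with tau_(n-1)(x2) = x1 and tau_n(x1) =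
  x already inserted.\<close>

lemma braid_y:
  "(y * x - q * (x * y)) * x1 - q * (x1 * (y * x - q * (x * y)))
    = (y * x2 - q * (x2 * y)) * x - q * (x * (y * x2 - q * (x2 * y)))"
  by (simp add: x1_def x2_def algebra_simps mixed_rw4)

text \<open>Since tau_(n-2)(x) = [x, y]_q, the left-hand side is tau_(n-2)(x2). The factor
  \<open>y\<close> can be pulled out because it commutes with \<open>b\<close>, \<open>c\<close> and
  \<open>k\<close>.\<close>

lemma x2_y:
  "qi * (((x * y - q * (y * x)) * b - q * (b * (x * y - q * (y * x)))) * c
      - q * (c * ((x * y - q * (y * x)) * b - q * (b * (x * y - q * (y * x)))))) + (x * y - q * (y * x)) * k
    = x2 * y - q * (y * x2)"
  by (simp add: x2_def algebra_simps rw0 y_rw0)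

end

section \<open>The opposite ring and the passage from tau_n^- to tau_n\<close>

typedef 'a opposite = "UNIV :: 'a set" morphisms of_opp to_opp ..

setup_lifting type_definition_opposite

instantiation opposite :: (ring_1) ring_1
begin

lift_definition zero_opposite :: "'a opposite" is 0 .
lift_definition one_opposite :: "'a opposite" is 1 .
lift_definition plus_opposite :: "'a opposite \<Rightarrow> 'a opposite \<Rightarrow> 'a opposite" is "(+)" .
lift_definition minus_opposite :: "'a opposite \<Rightarrow> 'a opposite \<Rightarrow> 'a opposite" is "(-)" .
lift_definition uminus_opposite :: "'a opposite \<Rightarrow> 'a opposite" is uminus .
lift_definition times_opposite :: "'a opposite \<Rightarrow> 'a opposite \<Rightarrow> 'a opposite" is "\<lambda>u v. v * u" .

instance
  by standard (transfer; simp add: algebra_simps)+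

end

lemma to_opp_simps:
  "to_opp u + to_opp v = to_opp (u + v)" "to_opp u - to_opp v = to_opp (u - v)"
  "to_opp u * to_opp v = to_opp (v * u)" "- to_opp u = to_opp (- u)"
  "(1 :: 'a::ring_1 opposite) = to_opp 1" "(0 :: 'a::ring_1 opposite) = to_opp 0"
  by (simp_all add: plus_opposite_def minus_opposite_def times_opposite_def uminus_opposite_def
      one_opposite_def zero_opposite_def to_opp_inverse)

lemma of_opp_simps:
  "of_opp (u + v) = of_opp u + of_opp v" "of_opp (u - v) = of_opp u - of_opp v"
  "of_opp (u * v) = of_opp v * of_opp u" "of_opp (- u) = - of_opp u"
  "of_opp (1 :: 'a::ring_1 opposite) = 1" "of_opp (0 :: 'a::ring_1 opposite) = 0"
  by (transfer; simp)+

text \<open>Reversing products changes the sign of the commutator of \<open>b\<close> and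
  \<open>c\<close> and inverts their q-commutation with \<open>k\<close>; exchanging
  \<open>b\<close> and \<open>c\<close> repairs both. The Serre expressions are palindromic.
  Surjectivity makes the images of the scalars central. The lemma is applied to
  \<open>to_opp\<close> and then to \<open>of_opp\<close>.\<close>

lemma kolb_four_anti_hom:
  fixes f :: "'a::ring_1 \<Rightarrow> 'b::ring_1"
  assumes "kolb_four q qi h e b c k ki x y" and surj: "surj f"
    and f_add: "\<And>u v. f (u + v) = f u + f v" and f_mult: "\<And>u v. f (u * v) = f v * f u"
    and f_one: "f 1 = 1"
  shows "kolb_four (f q) (f qi) (f h) (f e) (f c) (f b) (f k) (f ki) (f x) (f y)"
proof -
  interpret kolb_four q qi h e b c k ki x y by fact
  have f_zero: "f 0 = 0" using f_add[of 0 0] by simp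
  have f_minus: "f (- u) = - f u" for u
    using f_add[of u "- u"] by (simp add: f_zero eq_neg_iff_add_eq_0 add.commute)
  have f_diff: "f (u - v) = f u - f v" for u v
    using f_add[of u "- v"] by (simp add: f_minus)
  note f_simps = f_zero f_minus f_diff f_add f_mult f_one
  have central: "u * f s = f s * u" if "\<And>v. v * s = s * v" for u s
    using that surj f_mult by (metis surjD)
  note cq = central[OF q_comm] and cqi = central[OF qi_comm] and ch = central[OF h_comm]
  note rw = mult.assoc distrib_left distrib_right
    cq[of "f b"] cq[of "f c"] cq[of "f x"] cq[of "f y"] cq[of "f k"] cq[of "f ki"]
    cqi[of "f b"] cqi[of "f c"] cqi[of "f x"] cqi[of "f y"] cqi[of "f k"] cqi[of "f ki"]
    ch[of "f b"] ch[of "f c"] ch[of "f x"] ch[of "f y"] ch[of "f k"] ch[of "f ki"]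
  note rw = rw rw[THEN mult_assoc_ext]
  show ?thesis
  proof
    show "f q * f h = 1 + f qi * f h"
      using arg_cong[OF qh, of f] by (simp add: f_simps ch)
    show "f q * f qi = 1"
      using arg_cong[OF qi_q, of f] by (simp add: f_simps)
    have "(q + qi) * e = e * (q + qi)"
      by (simp add: distrib_left distrib_right q_comm qi_comm)
    then show "f e * (f q + f qi) = 1"
      using arg_cong[OF two_e, of f] by (simp add: f_simps[symmetric])
    show "f k * f ki = 1" "f ki * f k = 1"
      using arg_cong[OF k_ki, of f] arg_cong[OF ki_k, of f] by (simp_all add: f_simps)
    have "c * k = qi * (qi * (k * c))" "b * k = q * (q * (k * b))"
      by (simp_all add: kb kc mult_assoc_ext[OF qi_q] mult_assoc_ext[OF q_qi])
    from this[THEN arg_cong[where f = f]]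
    show "f k * f c = f qi * (f qi * (f c * f k))" "f k * f b = f q * (f q * (f b * f k))"
      by (simp_all add: f_simps rw)
    show "f k * f x = f x * f k" "f k * f y = f y * f k" "f c * f y = f y * f c" "f b * f y = f y * f b"
      using kx ky c_y b_y by (simp_all add: f_mult[symmetric])
    show "f c * f b - f b * f c = f h * (f k - f ki)"
      using arg_cong[OF bc, of f] by (simp add: f_simps ch)
    show "f c * f c * f x - (f q + f qi) * (f c * f x * f c) + f x * f c * f c = 0"
      using arg_cong[OF serre_c, of f] by (simp add: f_simps rw) (simp add: algebra_simps)
    show "f b * f b * f x - (f q + f qi) * (f b * f x * f b) + f x * f b * f b = 0"
      using arg_cong[OF serre_b, of f] by (simp add: f_simps rw) (simp add: algebra_simps)
    show "f x * f x * f c - (f q + f qi) * (f x * f c * f x) + f c * f x * f x = - (f qi * f c)"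
      using arg_cong[OF serre_xc, of f] by (simp add: f_simps rw) (simp add: algebra_simps)
    show "f x * f x * f b - (f q + f qi) * (f x * f b * f x) + f b * f x * f x = - (f qi * f b)"
      using arg_cong[OF serre_xb, of f] by (simp add: f_simps rw) (simp add: algebra_simps)
    show "f x * f x * f y - (f q + f qi) * (f x * f y * f x) + f y * f x * f x = - (f qi * f y)"
      using arg_cong[OF serre_xy, of f] by (simp add: f_simps rw) (simp add: algebra_simps)
    show "f y * f y * f x - (f q + f qi) * (f y * f x * f y) + f x * f y * f y = - (f qi * f x)"
      using arg_cong[OF serre_yx, of f] by (simp add: f_simps rw) (simp add: algebra_simps)
  qed (fact cq cqi ch)+
qed

context kolb_four
begin

definition "b2 = q * (ki * c)"
definition "c2 = q * (k * b)"

interpretation opp: kolb_four "to_opp q" "to_opp qi" "to_opp h" "to_opp e" "to_opp c" "to_opp b"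
    "to_opp k" "to_opp ki" "to_opp x" "to_opp y"
proof (rule kolb_four_anti_hom[where f = to_opp])
  show "kolb_four q qi h e b c k ki x y" by unfold_locales
  show "surj (to_opp :: 'a \<Rightarrow> 'a opposite)" by (metis of_opp_inverse surjI)
qed (simp_all add: to_opp_simps)

text \<open>Reading the formulas for tau_n^- backwards with \<open>b\<close> and \<open>c\<close>
  exchanged gives those for tau_n; \<open>k\<close> commutes with \<open>x\<close>, so the side on
  which the torus factor stands is irrelevant.\<close>

lemma of_opp_image: "of_opp opp.x1 = x2" "of_opp opp.b1 = c2" "of_opp opp.c1 = b2"
proof -
  show "of_opp opp.x1 = x2"
    by (simp add: opp.x1_altdef x2_def of_opp_simps to_opp_inverse kx[symmetric])
      (simp add: algebra_simps rw0)
qed (simp_all add: opp.b1_def opp.c1_def b2_def c2_def of_opp_simps to_opp_inverse algebra_simps torus_rw)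

lemma kolb_four_image2: "kolb_four q qi h e b2 c2 ki k x2 y"
proof -
  have "kolb_four (of_opp (to_opp q)) (of_opp (to_opp qi)) (of_opp (to_opp h)) (of_opp (to_opp e))
     (of_opp opp.c1) (of_opp opp.b1) (of_opp (to_opp ki)) (of_opp (to_opp k)) (of_opp opp.x1)
     (of_opp (to_opp y))"
  proof (rule kolb_four_anti_hom[OF opp.kolb_four_image, where f = of_opp])
    show "surj (of_opp :: 'a opposite \<Rightarrow> 'a)" by (metis to_opp_inverse surjI UNIV_I)
  qed (simp_all add: of_opp_simps)
  then show ?thesis by (simp add: of_opp_image to_opp_inverse)
qed

lemma image_after_inverse:
  "qi * (b2 * (c2 * x2 - q * (x2 * c2)) - q * ((c2 * x2 - q * (x2 * c2)) * b2)) + x2 * ki = x"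
proof -
  have "of_opp (to_opp qi * ((opp.x1 * opp.b1 - to_opp q * (opp.b1 * opp.x1)) * opp.c1
      - to_opp q * (opp.c1 * (opp.x1 * opp.b1 - to_opp q * (opp.b1 * opp.x1)))) + opp.x1 * to_opp ki) = x"
    by (simp add: opp.inverse_after_image to_opp_inverse)
  moreover have "ki * x2 = x2 * ki" by (simp add: x2_def algebra_simps torus_rw)
  moreover note qi_comm[of q] q_comm[of x2] q_comm[of b2] q_comm[of c2] qi_comm[of x2] qi_comm[of b2] qi_comm[of c2]
  moreover note this[THEN mult_assoc_ext]
  ultimately show ?thesis
    by (simp add: of_opp_simps of_opp_image to_opp_inverse algebra_simps)
qed

end

section \<open>q-Serre identities for elements F - K^{-1} E\<close>

context q_scalars
begin

text \<open>The case of a first index below n. \<open>E3\<close> is meant as E with index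
  \<open>flip n j\<close>, which covers the end nodes as well; the expression is linear in its
  second argument, so \<open>F2\<close> and \<open>E3\<close> never meet. The lower-order term stems
  from the commutator of \<open>E1\<close> and \<open>F1\<close>.\<close>

lemma q_serre_with_correction:
  assumes K: "K1 * K1i = 1" "K1i * K1 = 1"
    and K1iE1: "K1i * E1 = qi * (qi * (E1 * K1i))" and K1iF1: "K1i * F1 = q * (q * (F1 * K1i))"
    and K1F1: "K1 * F1 = qi * (qi * (F1 * K1))"
    and K1F2: "K1 * F2 = q * (F2 * K1)"
    and K1iF2: "K1i * F2 = qi * (F2 * K1i)" and K1iE3: "K1i * E3 = q * (E3 * K1i)"
    and K2iF1: "K2i * F1 = qi * (F1 * K2i)" and K2iE1: "K2i * E1 = q * (E1 * K2i)"
    and K2iK1: "K2i * K1 = K1 * K2i" and K2iK1i: "K2i * K1i = K1i * K2i"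
    and K1E3: "K1 * E3 = qi * (E3 * K1)"
    and E1F1: "E1 * F1 = F1 * E1 + h * (K1 - K1i)" and E1F2: "E1 * F2 = F2 * E1"
    and E3F1: "E3 * F1 = F1 * E3"
    and serre_F: "F1 * (F1 * F2) = q * (F1 * (F2 * F1)) + qi * (F1 * (F2 * F1)) - F2 * (F1 * F1)"
    and serre_E: "E1 * (E1 * E3) = q * (E1 * (E3 * E1)) + qi * (E1 * (E3 * E1)) - E3 * (E1 * E1)"
  shows "(F1 - K1i * E1) * (F1 - K1i * E1) * (F2 - K2i * E3)
     - (q + qi) * ((F1 - K1i * E1) * (F2 - K2i * E3) * (F1 - K1i * E1))
     + (F2 - K2i * E3) * (F1 - K1i * E1) * (F1 - K1i * E1) = - (qi * (F2 - K2i * E3))"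
proof -
  have E1K1i: "E1 * K1i = q * (q * (K1i * E1))" and E3K1i: "E3 * K1i = qi * (K1i * E3)"
    and E1K2i: "E1 * K2i = qi * (K2i * E1)" and E3K1: "E3 * K1 = q * (K1 * E3)"
    by (simp_all add: K1iE1 K1iE3 K2iE1 K1E3 q_qi qi_q mult_assoc_ext[OF q_qi] mult_assoc_ext[OF qi_q])
  note c = q_comm[of F1] q_comm[of F2] q_comm[of E1] q_comm[of E3] q_comm[of K1] q_comm[of K1i] q_comm[of K2i]
    qi_comm[of F1] qi_comm[of F2] qi_comm[of E1] qi_comm[of E3] qi_comm[of K1] qi_comm[of K1i] qi_comm[of K2i]
    h_comm[of F1] h_comm[of F2] h_comm[of E1] h_comm[of E3] h_comm[of K1] h_comm[of K1i] h_comm[of K2i]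
  note r = c K K1iF1 K1F1 K1F2 K1iF2 K2iF1 E1K1i E3K1i E1K2i E3K1 E1F1 E1F2 E3F1 K2iK1 K2iK1i
  show ?thesis
    by (simp add: algebra_simps scalar_rw r r[THEN mult_assoc_ext] serre_F serre_E
        serre_E[folded mult.assoc, THEN mult_assoc_ext, unfolded mult.assoc])
qed

text \<open>The case of an end node as first index. Here \<open>E1\<close> belongs to the other end
  node, so it commutes with \<open>F1\<close> and \<open>K1i\<close>, and no correction
  arises.\<close>

lemma q_serre_twisted:
  assumes K1iE1: "K1i * E1 = E1 * K1i" and K1iF1: "K1i * F1 = q * (q * (F1 * K1i))"
    and K1iF2: "K1i * F2 = qi * (F2 * K1i)" and K1iE3: "K1i * E3 = q * (E3 * K1i)"
    and K2iF1: "K2i * F1 = qi * (F1 * K2i)" and K2iE1: "K2i * E1 = q * (E1 * K2i)"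
    and K2iK1i: "K2i * K1i = K1i * K2i"
    and E1F1: "E1 * F1 = F1 * E1" and E1F2: "E1 * F2 = F2 * E1"
    and E3F1: "E3 * F1 = F1 * E3"
    and serre_F: "F1 * (F1 * F2) = q * (F1 * (F2 * F1)) + qi * (F1 * (F2 * F1)) - F2 * (F1 * F1)"
    and serre_E: "E1 * (E1 * E3) = q * (E1 * (E3 * E1)) + qi * (E1 * (E3 * E1)) - E3 * (E1 * E1)"
  shows "(F1 - K1i * E1) * (F1 - K1i * E1) * (F2 - K2i * E3)
     - (q + qi) * ((F1 - K1i * E1) * (F2 - K2i * E3) * (F1 - K1i * E1))
     + (F2 - K2i * E3) * (F1 - K1i * E1) * (F1 - K1i * E1) = 0"
proof -
  have E1K1i: "E1 * K1i = K1i * E1" and E3K1i: "E3 * K1i = qi * (K1i * E3)"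
    and E1K2i: "E1 * K2i = qi * (K2i * E1)"
    by (simp_all add: K1iE1 K1iE3 K2iE1 q_qi qi_q mult_assoc_ext[OF q_qi] mult_assoc_ext[OF qi_q])
  note c = q_comm[of F1] q_comm[of F2] q_comm[of E1] q_comm[of E3] q_comm[of K1i] q_comm[of K2i]
    qi_comm[of F1] qi_comm[of F2] qi_comm[of E1] qi_comm[of E3] qi_comm[of K1i] qi_comm[of K2i]
  note r = c K1iF1 K1iF2 K2iF1 E1K1i E3K1i E1K2i E1F1 E1F2 E3F1 K2iK1i
  show ?thesis
    by (simp add: algebra_simps scalar_rw r r[THEN mult_assoc_ext] serre_F serre_E
        serre_E[folded mult.assoc, THEN mult_assoc_ext, unfolded mult.assoc])
qed

text \<open>Abstract because it serves twice: for E_m against a Serre element in the F_i, and, with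
  E and F and also K and K^{-1} exchanged, for F_m against one in the E_i. This is the case of the
  repeated index.\<close>

lemma serre_commute_first:
  assumes EF: "E * F1 - F1 * E = h * (K - Ki)" and EF2: "E * F2 = F2 * E"
    and K1: "K * F1 = qi * (qi * (F1 * K))" and Ki1: "Ki * F1 = q * (q * (F1 * Ki))"
    and K2: "K * F2 = q * (F2 * K)" and Ki2: "Ki * F2 = qi * (F2 * Ki)"
  shows "E * (F1 * F1 * F2 - (q + qi) * (F1 * F2 * F1) + F2 * F1 * F1)
    = (F1 * F1 * F2 - (q + qi) * (F1 * F2 * F1) + F2 * F1 * F1) * E"
proof -
  have EF1: "E * F1 = F1 * E + h * (K - Ki)" using EF by (simp add: algebra_simps)
  note c = q_comm[of F1] q_comm[of F2] q_comm[of E] q_comm[of K] q_comm[of Ki]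
    qi_comm[of F1] qi_comm[of F2] qi_comm[of E] qi_comm[of K] qi_comm[of Ki]
    h_comm[of F1] h_comm[of F2] h_comm[of E] h_comm[of K] h_comm[of Ki]
  note r = c EF1 EF2 K1 Ki1 K2 Ki2
  show ?thesis
    by (simp add: algebra_simps scalar_rw r r[THEN mult_assoc_ext])
qed

lemma serre_commute_second:
  assumes EF: "E * F2 - F2 * E = h * (K - Ki)" and EF1: "E * F1 = F1 * E"
    and K1: "K * F1 = q * (F1 * K)" and Ki1: "Ki * F1 = qi * (F1 * Ki)"
  shows "E * (F1 * F1 * F2 - (q + qi) * (F1 * F2 * F1) + F2 * F1 * F1)
    = (F1 * F1 * F2 - (q + qi) * (F1 * F2 * F1) + F2 * F1 * F1) * E"
proof -
  have EF2: "E * F2 = F2 * E + h * (K - Ki)" using EF by (simp add: algebra_simps)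
  note c = q_comm[of F1] q_comm[of F2] q_comm[of E] q_comm[of K] q_comm[of Ki]
    qi_comm[of F1] qi_comm[of F2] qi_comm[of E] qi_comm[of K] qi_comm[of Ki]
    h_comm[of F1] h_comm[of F2] h_comm[of E] h_comm[of K] h_comm[of Ki]
  note r = c EF1 EF2 K1 Ki1
  show ?thesis
    by (simp add: algebra_simps scalar_rw r r[THEN mult_assoc_ext])
qed

end

section \<open>A Verma module realised on the free algebra\<close>

text \<open>q^2 \<noteq> 1 makes q - 1/q invertible; q^4 \<noteq> 1 excludes q^2 = -1 and makes q +
  1/q invertible.\<close>

lemma (in central_scalars) q_scalars:
  assumes "q \<noteq> 0" "q ^ 2 \<noteq> 1" "q ^ 4 \<noteq> 1"
  shows "q_scalars (sc q) (sc (inverse q)) (sc (inverse (q - inverse q))) (sc (inverse (q + inverse q)))"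
proof -
  have 1: "q - inverse q \<noteq> 0"
  proof
    assume "q - inverse q = 0"
    then have "q * (q - inverse q) = 0" by simp
    then show False using assms by (simp add: right_diff_distrib power2_eq_square)
  qed
  have 2: "q + inverse q \<noteq> 0"
  proof
    assume "q + inverse q = 0"
    then have "q * (q + inverse q) = 0" by simp
    then have "q ^ 2 = - 1" using assms by (simp add: distrib_left power2_eq_square eq_neg_iff_add_eq_0)
    then have "q ^ 4 = 1" using power_mult[of q 2 2] by simp
    then show False using assms by simp
  qed
  have "q * inverse (q - inverse q) - inverse q * inverse (q - inverse q) = 1"
    using 1 by (metis left_diff_distrib right_inverse)
  then have 3: "q * inverse (q - inverse q) = 1 + inverse q * inverse (q - inverse q)"
    by (simp add: diff_eq_eq)
  have 4: "inverse (q + inverse q) * (q + inverse q) = 1"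
    using 2 by simp
  show ?thesis
  proof
    show "sc q * sc (inverse (q - inverse q)) = 1 + sc (inverse q) * sc (inverse (q - inverse q))"
      using arg_cong[OF 3, of sc] by (simp only: sc_add sc_mult sc_one)
    show "sc (inverse (q + inverse q)) * (sc q + sc (inverse q)) = 1"
      using arg_cong[OF 4, of sc] by (simp only: sc_add sc_mult sc_one)
    show "sc q * sc (inverse q) = 1"
      using assms(1) by (simp add: sc_mult[symmetric])
  qed (rule sc_central[symmetric])+
qed

text \<open>Operators form a type in class \<open>ring_1\<close>, so that \<open>ev\<close> and the
  identities of \<open>q_scalars\<close> apply to them directly.\<close>

typedef (overloaded) 'k lin_op =
  "{f :: (nat word \<Rightarrow>\<^sub>0 'k::field) \<Rightarrow> (nat word \<Rightarrow>\<^sub>0 'k).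
     (\<forall>p r. f (p + r) = f p + f r) \<and> (\<forall>c p. f (scalar c * p) = scalar c * f p)}"
  morphisms app Lin
  by (rule exI[of _ "\<lambda>p. p"]) simp

setup_lifting type_definition_lin_op

lemma app_add: "app f (p + r) = app f p + app f r" and app_scale: "app f (scalar c * p) = scalar c * app f p"
  using app[of f] by auto

lemma app_zero [simp]: "app f 0 = 0"
  using app_add[of f 0 0] by simp

lemma app_uminus: "app f (- p) = - app f p"
  using app_add[of f p "- p"] by (simp add: eq_neg_iff_add_eq_0 add.commute)

lemma app_diff: "app f (p - r) = app f p - app f r"
  using app_add[of f p "- r"] by (simp add: app_uminus)

lemma lin_op_eqI: "(\<And>p. app f p = app g p) \<Longrightarrow> f = g"
  by (metis app_inject ext)

instantiation lin_op :: (field) ring_1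
begin

lift_definition zero_lin_op :: "'a lin_op" is "\<lambda>p. 0" by simp
lift_definition one_lin_op :: "'a lin_op" is "\<lambda>p. p" by simp
lift_definition plus_lin_op :: "'a lin_op \<Rightarrow> 'a lin_op \<Rightarrow> 'a lin_op" is "\<lambda>f g p. f p + g p"
  by (simp add: algebra_simps)
lift_definition minus_lin_op :: "'a lin_op \<Rightarrow> 'a lin_op \<Rightarrow> 'a lin_op" is "\<lambda>f g p. f p - g p"
  by (simp add: algebra_simps)
lift_definition uminus_lin_op :: "'a lin_op \<Rightarrow> 'a lin_op" is "\<lambda>f p. - f p"
  by simp
lift_definition times_lin_op :: "'a lin_op \<Rightarrow> 'a lin_op \<Rightarrow> 'a lin_op" is "\<lambda>f g p. f (g p)"
  by simp

lemmas app_ring = zero_lin_op.rep_eq one_lin_op.rep_eq plus_lin_op.rep_eq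
    minus_lin_op.rep_eq uminus_lin_op.rep_eq times_lin_op.rep_eq

instance
proof
  fix f g k :: "'a lin_op"
  show "f + g + k = f + (g + k)" "f + g = g + f" "0 + f = f" "- f + f = 0" "f - g = f + - g"
    "f * g * k = f * (g * k)" "1 * f = f" "f * 1 = f" "(f + g) * k = f * k + g * k"
    by (rule lin_op_eqI, simp add: app_ring add.assoc add.commute)+
  show "f * (g + k) = f * g + f * k"
    by (rule lin_op_eqI, simp add: app_ring app_add)
  show "(0 :: 'a lin_op) \<noteq> 1"
  proof
    assume "(0 :: 'a lin_op) = 1"
    then have "app (0 :: 'a lin_op) 1 = app 1 1" by simp
    then show False by (simp add: app_ring)
  qed
qed

end

lift_definition op_scalar :: "'k::field \<Rightarrow> 'k lin_op" is "\<lambda>c p. scalar c * p"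
  by (auto simp: distrib_left intro: scalar.sc_left_commute)

definition lmul :: "(nat word \<Rightarrow>\<^sub>0 'k::field) \<Rightarrow> 'k lin_op" where
  "lmul p = Lin (\<lambda>r. p * r)"

lemma app_lmul: "app (lmul p) r = p * r"
  by (simp add: lmul_def Lin_inverse distrib_left scalar.sc_left_commute)

lemmas app_simps = zero_lin_op.rep_eq one_lin_op.rep_eq plus_lin_op.rep_eq minus_lin_op.rep_eq
  uminus_lin_op.rep_eq times_lin_op.rep_eq op_scalar.rep_eq app_lmul

interpretation op_scalar: central_scalars "op_scalar :: 'k::field \<Rightarrow> 'k lin_op"
  by standard (rule lin_op_eqI; simp add: app_simps scalar.sc_add scalar.sc_mult distrib_right
      mult.assoc app_scale)+

lemma lmul_simps:
  "lmul (p + r) = lmul p + lmul r" "lmul (p - r) = lmul p - lmul r" "lmul (p * r) = lmul p * lmul r"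
  "lmul (scalar c) = op_scalar c" "lmul 1 = 1" "lmul 0 = 0"
  by (rule lin_op_eqI; simp add: app_simps algebra_simps)+

abbreviation monomial :: "'a list \<Rightarrow> 'a word \<Rightarrow>\<^sub>0 'k::field" where
  "monomial l \<equiv> Poly_Mapping.single (Word l) 1"

lemma monomial_Nil: "monomial [] = (1 :: 'a word \<Rightarrow>\<^sub>0 'k::field)"
  by (simp add: zero_word_def[symmetric])

lemma monomial_Cons: "monomial (a # l) = letter a * monomial l"
  by (simp add: letter_def mult_single plus_word_def)

lemma monomial_append: "monomial (l @ l') = monomial l * monomial l'"
  by (simp add: mult_single plus_word_def)

lemma lin_op_eq_monomialI:
  assumes "\<And>l. app f (monomial l) = app g (monomial l)"
  shows "f = g"
proof (rule lin_op_eqI)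
  show "app f p = app g p" for p
    by (induction p rule: poly_mapping_linear_induct) (simp_all add: assms app_add app_scale)
qed

definition lin_ext :: "(nat list \<Rightarrow> (nat word \<Rightarrow>\<^sub>0 'k::field)) \<Rightarrow> 'k lin_op" where
  "lin_ext g = Lin (\<lambda>p. \<Sum>w\<in>Poly_Mapping.keys p. scalar (Poly_Mapping.lookup p w) * g (letters w))"

lemma app_lin_ext_sum:
  fixes g :: "nat list \<Rightarrow> (nat word \<Rightarrow>\<^sub>0 'k::field)"
  shows
  "app (lin_ext g) p = (\<Sum>w\<in>Poly_Mapping.keys p. scalar (Poly_Mapping.lookup p w) * g (letters w))"
  unfolding lin_ext_def
proof (subst Lin_inverse, safe)
  fix p r :: "nat word \<Rightarrow>\<^sub>0 'k" and c :: 'k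
  let ?f = "\<lambda>p. \<Sum>w\<in>Poly_Mapping.keys p. scalar (Poly_Mapping.lookup p w) * g (letters w)"
  have sup: "?f p = (\<Sum>w\<in>S. scalar (Poly_Mapping.lookup p w) * g (letters w))"
    if "finite S" "Poly_Mapping.keys p \<subseteq> S" for p S
    using that by (intro sum.mono_neutral_left) (auto simp: in_keys_iff)
  let ?S = "Poly_Mapping.keys p \<union> Poly_Mapping.keys r"
  have "Poly_Mapping.keys (p + r) \<subseteq> ?S" by (rule Poly_Mapping.keys_add)
  then have "?f (p + r) = (\<Sum>w\<in>?S. scalar (Poly_Mapping.lookup (p + r) w) * g (letters w))"
    by (intro sup) auto
  also have "\<dots> = ?f p + ?f r"
    by (simp add: lookup_add scalar.sc_add distrib_right sum.distrib sup[of ?S p] sup[of ?S r])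
  finally show "?f (p + r) = ?f p + ?f r" .
  have "Poly_Mapping.keys (scalar c * p) \<subseteq> Poly_Mapping.keys p"
    by (auto simp: in_keys_iff lookup_scalar_mult)
  then have "?f (scalar c * p) = (\<Sum>w\<in>Poly_Mapping.keys p. scalar (Poly_Mapping.lookup (scalar c * p) w) * g (letters w))"
    by (intro sup) auto
  then show "?f (scalar c * p) = scalar c * ?f p"
    by (simp add: lookup_scalar_mult scalar.sc_mult sum_distrib_left mult.assoc)
qed

lemma app_lin_ext [simp]: "app (lin_ext g) (monomial l) = g l"
  by (simp add: app_lin_ext_sum)

text \<open>A module over the algebra in which the F_i satisfy no Serre relations. A word stands for
  the product of its F_i applied to the highest weight vector \<open>monomial []\<close>, on which
  K_i acts by \<open>\<chi> i\<close>.\<close>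

locale verma =
  fixes q :: "'k::field" and a :: "nat \<Rightarrow> nat \<Rightarrow> int" and \<chi> :: "nat \<Rightarrow> 'k"
  assumes q: "q \<noteq> 0" "q ^ 2 \<noteq> 1" "q ^ 4 \<noteq> 1"
    and a_sym: "a i j = a j i" and a_diag: "a i i = 2"
    and \<chi>_nonzero: "\<chi> i \<noteq> 0"
begin

sublocale q_scalars "op_scalar q" "op_scalar (inverse q)" "op_scalar (inverse (q - inverse q))"
    "op_scalar (inverse (q + inverse q))"
  by (rule op_scalar.q_scalars[OF q])

definition weight :: "nat \<Rightarrow> nat list \<Rightarrow> 'k" where
  "weight i l = \<chi> i * q powi (- (\<Sum>j\<leftarrow>l. a i j))"

lemma weight_nonzero [simp]: "weight i l \<noteq> 0"
  using q \<chi>_nonzero by (simp add: weight_def power_int_eq_0_iff)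

lemma weight_Cons: "weight i (j # l) = q powi (- a i j) * weight i l"
  using q by (simp add: weight_def power_int_diff power_int_minus field_simps)

text \<open>The value of E_i on a word, obtained by moving E_i to the right: passing a letter i
  leaves h (K_i - K_i^{-1}) acting on the remaining word, and the highest weight vector is
  killed.\<close>

fun skew :: "nat \<Rightarrow> nat list \<Rightarrow> (nat word \<Rightarrow>\<^sub>0 'k)" where
  "skew i [] = 0"
| "skew i (j # l) = letter j * skew i l
    + (if i = j then scalar (inverse (q - inverse q) * (weight i l - inverse (weight i l))) * monomial l else 0)"

definition "F i = lmul (letter i)"
definition "K i = lin_ext (\<lambda>l. scalar (weight i l) * monomial l)"
definition "Ki i = lin_ext (\<lambda>l. scalar (inverse (weight i l)) * monomial l)"
definition "E i = lin_ext (skew i)"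

lemma app_F_monomial: "app (F i) (monomial l) = monomial (i # l)"
  by (simp add: F_def app_simps monomial_Cons)

lemma app_monomial [simp]:
  "app (K i) (monomial l) = scalar (weight i l) * monomial l"
  "app (Ki i) (monomial l) = scalar (inverse (weight i l)) * monomial l"
  "app (E i) (monomial l) = skew i l"
  by (simp_all add: K_def Ki_def E_def)

lemma scalar_scalar: "scalar c * (scalar d * p) = scalar (c * d) * p" for p :: "'a word \<Rightarrow>\<^sub>0 'k"
  by (simp add: scalar.sc_mult mult.assoc)

lemma K_Ki: "K i * Ki i = 1" and Ki_K: "Ki i * K i = 1"
  by (rule lin_op_eq_monomialI; simp add: app_simps app_scale scalar_scalar)+

lemma K_K: "K i * K j = K j * K i"
  by (rule lin_op_eq_monomialI; simp add: app_simps app_scale scalar_scalar mult.commute)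

lemma K_F: "K i * F j = op_scalar (q powi (- a i j)) * (F j * K i)"
  by (rule lin_op_eq_monomialI)
    (simp add: app_simps app_scale scalar_scalar app_F_monomial weight_Cons)

lemma Ki_F: "Ki i * F j = op_scalar (q powi (a i j)) * (F j * Ki i)"
  using q by (intro lin_op_eq_monomialI)
    (simp add: app_simps app_scale scalar_scalar app_F_monomial weight_Cons power_int_minus)

lemma E_F: "E i * F j - F j * E i
    = (if i = j then op_scalar (inverse (q - inverse q)) * (K i - Ki i) else 0)"
  by (rule lin_op_eq_monomialI)
    (auto simp: app_simps F_def monomial_Cons[symmetric] scalar.sc_diff scalar.sc_mult algebra_simps)

lemma E_F_other: "i \<noteq> j \<Longrightarrow> E i * F j = F j * E i"
  using E_F[of i j] by simp

text \<open>Words in the F_m applied to the highest weight vector span the module, so an operator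
  that moves past every F_m up to a scalar is determined by its value there. Relations among the E_i
  and K_i thereby reduce to commutators with the F_m.\<close>

lemma commuting_with_F_zero:
  assumes D: "\<And>m. D * F m = op_scalar (c m) * (F m * D)" and vac: "app D (monomial []) = 0"
  shows "D = 0"
proof (rule lin_op_eq_monomialI)
  show "app D (monomial l) = app 0 (monomial l)" for l
  proof (induction l)
    case (Cons m l)
    have "app D (monomial (m # l)) = app (D * F m) (monomial l)"
      by (simp add: app_simps app_F_monomial)
    also have "\<dots> = 0" using Cons by (simp add: D app_simps)
    finally show ?case by (simp add: app_simps)
  qed (simp add: vac app_simps)
qed

lemma K_E: "K i * E j = op_scalar (q powi (a i j)) * (E j * K i)"
proof -
  let ?D = "K i * E j - op_scalar (q powi (a i j)) * (E j * K i)"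
  let ?s = "op_scalar (q powi (a i j))" and ?c = "\<lambda>m. op_scalar (q powi (- a i m))"
  let ?h = "op_scalar (inverse (q - inverse q))"
  have "?D = 0"
  proof (rule commuting_with_F_zero[where c = "\<lambda>m. q powi (- a i m)"])
    fix m
    let ?d = "if j = m then ?h * (K j - Ki j) else 0"
    have EF: "E j * F m = F m * E j + ?d" using E_F[of j m] by (simp add: algebra_simps)
    have KKi: "K i * Ki k = Ki k * K i" for k
      by (rule lin_op_eq_monomialI; simp add: app_simps app_scale scalar_scalar mult.commute)
    have dK: "K i * ?d = ?d * K i"
      by (auto simp: right_diff_distrib left_diff_distrib mult.assoc op_scalar.sc_left_commute K_K KKi)
    have d: "?s * (?c m * (?d * K i)) = ?d * K i"
      using q by (auto simp: op_scalar.sc_mult[symmetric] mult.assoc[symmetric] power_int_add[symmetric])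
    have KF: "K i * (F m * t) = ?c m * (F m * (K i * t))" for t
      by (metis K_F mult.assoc)
    have EKF: "E j * (K i * F m) = ?c m * ((F m * E j + ?d) * K i)"
    proof -
      have "E j * (K i * F m) = ?c m * (E j * F m * K i)"
        by (simp add: K_F op_scalar.sc_left_commute[of "E j"] mult.assoc)
      then show ?thesis by (simp only: EF)
    qed
    have "?D * F m = K i * (F m * E j) + K i * ?d - ?s * (E j * (K i * F m))"
      by (simp only: left_diff_distrib mult.assoc EF distrib_left)
    also have "\<dots> = ?c m * (F m * (K i * E j)) - ?s * (?c m * (F m * (E j * K i)))"
      by (simp only: EKF KF distrib_left distrib_right mult.assoc[of "F m"] d dK) simp
    also have "\<dots> = ?c m * (F m * ?D)"
      by (simp add: right_diff_distrib op_scalar.sc_left_commute[of "F m"] op_scalar.sc_left_commute[of "?c m" "q powi a i j"])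
    finally show "?D * F m = ?c m * (F m * ?D)" .
  qed (simp add: app_simps app_scale)
  then show ?thesis by simp
qed

lemma Ki_E: "Ki i * E j = op_scalar (q powi (- a i j)) * (E j * Ki i)"
proof -
  have "Ki i * E j = Ki i * (op_scalar (q powi (- a i j)) * (op_scalar (q powi (a i j)) * (E j * K i))) * Ki i"
    using q by (simp add: mult.assoc K_Ki power_int_minus op_scalar.sc_mult[symmetric] flip: mult.assoc[of "op_scalar c" "op_scalar d" for c d])
  also have "\<dots> = op_scalar (q powi (- a i j)) * (Ki i * (K i * E j) * Ki i)"
    by (simp add: K_E op_scalar.sc_left_commute[of "Ki i"] mult.assoc)
  also have "\<dots> = op_scalar (q powi (- a i j)) * (E j * Ki i)"
    by (simp add: mult.assoc[symmetric] Ki_K)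
  finally show ?thesis .
qed

text \<open>A single expression for both kinds of Serre relation, used for letters and for the
  operators E and F alike; on the diagonal it is 0.\<close>

definition qserre :: "'r::ring_1 \<Rightarrow> 'r \<Rightarrow> (nat \<Rightarrow> 'r) \<Rightarrow> nat \<Rightarrow> nat \<Rightarrow> 'r" where
  "qserre s t Z i j = (if a i j = 0 then Z i * Z j - Z j * Z i
     else if a i j = - 1 then Z i * Z i * Z j - (s + t) * (Z i * Z j * Z i) + Z j * Z i * Z i else 0)"

text \<open>These relations hold exactly and not only modulo an ideal: the Serre element in the E_i
  commutes with every F_m and kills the highest weight vector.\<close>

lemma serre_E: "qserre (op_scalar q) (op_scalar (inverse q)) E i j = 0"
proof (rule commuting_with_F_zero[where c = "\<lambda>_. 1"])
  fix m
  let ?S = "qserre (op_scalar q) (op_scalar (inverse q)) E i j"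
  have EF: "F m * E k - E k * F m = (if k = m then op_scalar (inverse (q - inverse q)) * (Ki k - K k) else 0)" for k
    using E_F[of k m] by (simp add: algebra_simps split: if_splits)
  have "F m * ?S = ?S * F m"
  proof -
    consider "a i j = 0" | "a i j = -1" "m = i" | "a i j = -1" "m = j" | "a i j = -1" "m \<noteq> i" "m \<noteq> j"
      | "a i j \<noteq> 0" "a i j \<noteq> - 1" by blast
    then show ?thesis
    proof cases
      case 1
      have ij: "i \<noteq> j" using 1 a_diag by auto
      have c: "F m * E k = E k * F m + (if k = m then op_scalar (inverse (q - inverse q)) * (Ki k - K k) else 0)" for k
        using EF[of k] by (simp add: diff_eq_eq add.commute)
      have c': "F m * (E k * t) = E k * (F m * t) + (if k = m then op_scalar (inverse (q - inverse q)) * (Ki k - K k) else 0) * t" for k t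
        by (metis c distrib_right mult.assoc)
      have KE: "Ki i * E j = E j * Ki i" "K i * E j = E j * K i" "Ki j * E i = E i * Ki j" "K j * E i = E i * K j"
        using 1 a_sym[of i j] by (simp_all add: Ki_E K_E)
      show ?thesis
        using 1 ij KE by (auto simp: qserre_def right_diff_distrib left_diff_distrib mult.assoc c c' distrib_left distrib_right
            op_scalar.sc_left_commute[of "E i"] op_scalar.sc_left_commute[of "E j"])
    next
      case 2
      note EF' = EF[unfolded 2(2)]
      have "i \<noteq> j" using 2 a_diag by auto
      have [simp]: "op_scalar (inverse (q ^ 2)) = op_scalar (inverse q) * op_scalar (inverse q)"
        "op_scalar (q ^ 2) = op_scalar q * op_scalar q"
        by (simp_all add: op_scalar.sc_mult[symmetric] power2_eq_square)
      \<comment> \<open>E and F are exchanged here, so \<open>Ki i\<close> and \<open>K i\<close>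
        take each other's place.\<close>
      show ?thesis
        unfolding qserre_def using 2 \<open>i \<noteq> j\<close>
        by (simp, intro serre_commute_first[where K = "Ki i" and Ki = "K i"])
          (simp_all add: EF' E_F_other Ki_E K_E a_diag power_int_minus mult.assoc)
    next
      case 3
      note EF' = EF[unfolded 3(2)]
      have "i \<noteq> j" using 3 a_diag by auto
      show ?thesis
        unfolding qserre_def using 3 \<open>i \<noteq> j\<close> a_sym[of i j]
        by (simp, intro serre_commute_second[where K = "Ki j" and Ki = "K j"])
          (simp_all add: EF' E_F_other Ki_E K_E power_int_minus mult.assoc)
    next
      case 4
      then have c: "F m * E i = E i * F m" "F m * E j = E j * F m" by (simp_all add: E_F_other)
      note c' = c c[THEN mult_assoc_ext] q_comm[of "E i"] q_comm[of "E j"] q_comm[of "F m"]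
        qi_comm[of "E i"] qi_comm[of "E j"] qi_comm[of "F m"]
      show ?thesis using 4
        by (simp add: qserre_def algebra_simps c' c'[THEN mult_assoc_ext])
    qed (simp add: qserre_def)
  qed
  then show "?S * F m = op_scalar 1 * (F m * ?S)" by simp
qed (auto simp: qserre_def app_simps)

definition serre_poly :: "nat \<Rightarrow> nat \<Rightarrow> nat word \<Rightarrow>\<^sub>0 'k" where
  "serre_poly = qserre (scalar q) (scalar (inverse q)) letter"

text \<open>Two-sided multiples are taken by monomials only, so that the projection to words of a
  given length can be computed term by term.\<close>

inductive_set serre_ideal :: "nat set \<Rightarrow> (nat word \<Rightarrow>\<^sub>0 'k) set" for I where
  zero: "0 \<in> serre_ideal I"
| add: "p \<in> serre_ideal I \<Longrightarrow> r \<in> serre_ideal I \<Longrightarrow> p + r \<in> serre_ideal I"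
| gen: "i \<in> I \<Longrightarrow> j \<in> I \<Longrightarrow> scalar c * (monomial u * serre_poly i j * monomial v) \<in> serre_ideal I"

lemma serre_ideal_scale: "p \<in> serre_ideal I \<Longrightarrow> scalar c * p \<in> serre_ideal I"
  by (induction rule: serre_ideal.induct)
    (auto simp: distrib_left scalar_scalar intro: serre_ideal.intros)

lemma serre_ideal_uminus: "p \<in> serre_ideal I \<Longrightarrow> - p \<in> serre_ideal I"
  using serre_ideal_scale[of p I "- 1"] by (simp add: scalar.sc_minus)

lemma serre_ideal_diff: "p \<in> serre_ideal I \<Longrightarrow> r \<in> serre_ideal I \<Longrightarrow> p - r \<in> serre_ideal I"
  using serre_ideal.add[of p I "- r"] serre_ideal_uminus by simp

lemma serre_ideal_letter: "p \<in> serre_ideal I \<Longrightarrow> letter m * p \<in> serre_ideal I"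
proof (induction rule: serre_ideal.induct)
  case (gen i j c u v)
  have "letter m * (scalar c * (monomial u * serre_poly i j * monomial v))
      = scalar c * (monomial (m # u) * serre_poly i j * monomial v)"
    by (simp add: monomial_Cons mult.assoc scalar.sc_left_commute[of "letter m"])
  then show ?case using gen serre_ideal.gen by metis
qed (auto simp: distrib_left intro: serre_ideal.intros)

lemma serre_ideal_right: "i \<in> I \<Longrightarrow> j \<in> I \<Longrightarrow> monomial u * serre_poly i j * r \<in> serre_ideal I"
proof (induction r rule: poly_mapping_linear_induct)
  case (word l)
  then show ?case using serre_ideal.gen[of i I j 1 u l] by simp
next
  case (scale c p)
  then show ?case using serre_ideal_scale by (simp add: scalar.sc_left_commute[of "_ * _"])
qed (auto simp: distrib_left intro: serre_ideal.intros)

lemma lmul_serre: "lmul (serre_poly i j) = qserre (op_scalar q) (op_scalar (inverse q)) F i j"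
  by (simp add: serre_poly_def qserre_def lmul_simps F_def)

text \<open>The Serre elements in the F_i give singular vectors; this makes the ideal they generate
  stable under the E_m.\<close>

lemma E_serre_F: "E m * lmul (serre_poly i j) = lmul (serre_poly i j) * E m"
proof -
  have two: "op_scalar (inverse (q ^ 2)) = op_scalar (inverse q) * op_scalar (inverse q)"
    "op_scalar (q ^ 2) = op_scalar q * op_scalar q"
    by (simp_all add: op_scalar.sc_mult[symmetric] power2_eq_square)
  have ij: "i \<noteq> j" if "a i j \<noteq> 2" using that a_diag by auto
  consider "a i j = 0" | "a i j = -1" "m = i" | "a i j = -1" "m = j" | "a i j = -1" "m \<noteq> i" "m \<noteq> j"
    | "a i j \<noteq> 0" "a i j \<noteq> - 1" by blast
  then show ?thesis
  proof cases
    case 1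
    have c: "E m * F k = F k * E m + (if m = k then op_scalar (inverse (q - inverse q)) * (K k - Ki k) else 0)" for k
      using E_F[of m k] by (auto simp: diff_eq_eq add.commute)
    have c': "E m * (F k * t) = F k * (E m * t) + (if m = k then op_scalar (inverse (q - inverse q)) * (K k - Ki k) else 0) * t" for k t
      by (metis c distrib_right mult.assoc)
    have KE: "Ki i * F j = F j * Ki i" "K i * F j = F j * K i" "Ki j * F i = F i * Ki j" "K j * F i = F i * K j"
      using 1 a_sym[of i j] by (simp_all add: Ki_F K_F)
    show ?thesis unfolding lmul_serre
      using 1 ij KE by (auto simp: qserre_def right_diff_distrib left_diff_distrib mult.assoc c c' distrib_left distrib_right
          op_scalar.sc_left_commute[of "F i"] op_scalar.sc_left_commute[of "F j"])
  next
    case 2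
    show ?thesis
      unfolding lmul_serre qserre_def using 2 ij
      by (simp, intro serre_commute_first[where K = "K i" and Ki = "Ki i"])
        (simp_all add: E_F E_F_other Ki_F K_F a_diag power_int_minus mult.assoc two)
  next
    case 3
    show ?thesis
      unfolding lmul_serre qserre_def using 3 ij a_sym[of i j]
      by (simp, intro serre_commute_second[where K = "K j" and Ki = "Ki j"])
        (simp_all add: E_F E_F_other Ki_F K_F power_int_minus mult.assoc)
  next
    case 4
    then have c: "E m * F i = F i * E m" "E m * F j = F j * E m" by (simp_all add: E_F_other)
    note c' = c c[THEN mult_assoc_ext] q_comm[of "F i"] q_comm[of "F j"] q_comm[of "E m"]
      qi_comm[of "F i"] qi_comm[of "F j"] qi_comm[of "E m"]
    show ?thesis using 4
      by (simp add: lmul_serre qserre_def algebra_simps c' c'[THEN mult_assoc_ext])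
  qed (simp add: qserre_def lmul_serre)
qed

lemma diagonal_scales_monomial:
  assumes "\<And>m. D * F m = op_scalar (c m) * (F m * D)"
  shows "D * lmul (monomial l) = op_scalar (\<Prod>m\<leftarrow>l. c m) * (lmul (monomial l) * D)"
proof (induction l)
  case (Cons m l)
  have "D * lmul (monomial (m # l)) = D * F m * lmul (monomial l)"
    by (simp add: monomial_Cons lmul_simps F_def mult.assoc)
  also have "\<dots> = op_scalar (c m) * (F m * (D * lmul (monomial l)))"
    by (simp add: assms mult.assoc)
  also have "\<dots> = op_scalar (\<Prod>m\<leftarrow>(m # l). c m) * (lmul (monomial (m # l)) * D)"
    by (simp add: Cons monomial_Cons lmul_simps F_def op_scalar.sc_left_commute[of "lmul (letter m)"]
        op_scalar.sc_mult mult.assoc)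
  finally show ?case .
qed (simp add: monomial_Nil lmul_simps)

text \<open>All words of a Serre element are rearrangements of each other, so a diagonal operator
  multiplies them by one common scalar.\<close>

lemma diagonal_scales_serre:
  assumes D: "\<And>m. D * F m = op_scalar (c m) * (F m * D)"
  shows "\<exists>d. D * lmul (serre_poly i j) = op_scalar d * (lmul (serre_poly i j) * D)"
proof -
  note m = diagonal_scales_monomial[of D c, OF D]
  consider "a i j = 0" | "a i j = -1" | "a i j \<noteq> 0" "a i j \<noteq> -1" by blast
  then show ?thesis
  proof cases
    case 1
    then have "serre_poly i j = monomial [i, j] - monomial [j, i]"
      by (simp add: serre_poly_def qserre_def monomial_Cons monomial_Nil)
    then have "D * lmul (serre_poly i j) = op_scalar (c i * c j) * (lmul (serre_poly i j) * D)"
      by (simp add: lmul_simps right_diff_distrib left_diff_distrib m mult.commute)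
    then show ?thesis by blast
  next
    case 2
    then have "serre_poly i j = monomial [i, i, j] - scalar (q + inverse q) * monomial [i, j, i] + monomial [j, i, i]"
      by (simp add: serre_poly_def qserre_def monomial_Cons monomial_Nil mult.assoc scalar.sc_add)
    then have "D * lmul (serre_poly i j) = op_scalar (c i * c i * c j) * (lmul (serre_poly i j) * D)"
      by (simp only: lmul_simps right_diff_distrib left_diff_distrib distrib_left distrib_right
          op_scalar.sc_left_commute[of D] m mult.assoc
          op_scalar.sc_left_commute[of "op_scalar (q + inverse q)"])
        (simp add: mult.commute mult.left_commute)
    then show ?thesis by blast
  qed (simp add: serre_poly_def qserre_def lmul_simps)
qed

lemma diagonal_preserves_serre_ideal:
  assumes D: "\<And>m. D * F m = op_scalar (c m) * (F m * D)" and "p \<in> serre_ideal I"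
  shows "app D p \<in> serre_ideal I"
  using assms(2)
proof (induction rule: serre_ideal.induct)
  case (gen i j d u v)
  obtain d' where d': "D * lmul (serre_poly i j) = op_scalar d' * (lmul (serre_poly i j) * D)"
    using diagonal_scales_serre[of D c, OF D] by blast
  let ?c = "op_scalar (\<Prod>m\<leftarrow>u. c m)"
  have "D * (lmul (monomial u) * lmul (serre_poly i j))
      = ?c * (lmul (monomial u) * (D * lmul (serre_poly i j)))"
    by (simp add: mult.assoc[symmetric] diagonal_scales_monomial[of D c, OF D])
  also have "\<dots> = ?c * (op_scalar d' * (lmul (monomial u) * (lmul (serre_poly i j) * D)))"
    by (simp add: d' op_scalar.sc_left_commute[of "lmul _"])
  finally have "app (D * (lmul (monomial u) * lmul (serre_poly i j))) (monomial v)
    = app (?c * (op_scalar d' * (lmul (monomial u) * (lmul (serre_poly i j) * D)))) (monomial v)"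
    by simp
  then have "app D (monomial u * serre_poly i j * monomial v)
      = scalar (\<Prod>m\<leftarrow>u. c m) * (scalar d' * (monomial u * serre_poly i j * app D (monomial v)))"
    by (simp add: app_simps mult.assoc)
  then show ?case
    using gen by (simp add: app_scale serre_ideal_scale serre_ideal_right)
qed (auto simp: app_add intro: serre_ideal.intros)

lemma K_preserves_serre_ideal: "p \<in> serre_ideal I \<Longrightarrow> app (K i) p \<in> serre_ideal I"
  by (rule diagonal_preserves_serre_ideal[OF K_F])

lemma Ki_preserves_serre_ideal: "p \<in> serre_ideal I \<Longrightarrow> app (Ki i) p \<in> serre_ideal I"
  by (rule diagonal_preserves_serre_ideal[OF Ki_F])

lemma F_preserves_serre_ideal: "p \<in> serre_ideal I \<Longrightarrow> app (F i) p \<in> serre_ideal I"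
  by (simp add: F_def app_simps serre_ideal_letter)

text \<open>E_m is moved through the letters of \<open>u\<close> until it meets the Serre element,
  with which it commutes. The torus operators split off on the way preserve the ideal.\<close>

lemma E_preserves_serre_ideal:
  assumes "p \<in> serre_ideal I"
  shows "app (E m) p \<in> serre_ideal I"
  using assms
proof (induction rule: serre_ideal.induct)
  case (gen i j c u v)
  have "app (E m) (monomial u * serre_poly i j * monomial v) \<in> serre_ideal I"
  proof (induction u)
    case Nil
    have "app (E m * lmul (serre_poly i j)) (monomial v) = serre_poly i j * app (E m) (monomial v)"
      by (simp add: E_serre_F app_simps)
    then show ?case
      using gen serre_ideal_right[of i I j "[]"] by (simp add: app_simps monomial_Nil)
  next
    case (Cons k u)
    let ?t = "monomial u * serre_poly i j * monomial v"
    have t: "?t \<in> serre_ideal I" using gen by (intro serre_ideal_right)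
    have "E m * F k = F k * E m + (if m = k then op_scalar (inverse (q - inverse q)) * (K m - Ki m) else 0)"
      using E_F[of m k] by (simp add: diff_eq_eq add.commute)
    then have "app (E m * F k) ?t
      = app (F k * E m + (if m = k then op_scalar (inverse (q - inverse q)) * (K m - Ki m) else 0)) ?t"
      by (simp only:)
    then have "app (E m) (letter k * ?t) = letter k * app (E m) ?t
        + (if m = k then scalar (inverse (q - inverse q)) * (app (K m) ?t - app (Ki m) ?t) else 0)"
      by (simp add: app_simps F_def split: if_splits)
    also have "\<dots> \<in> serre_ideal I"
      using Cons t by (auto intro!: serre_ideal.add serre_ideal_letter serre_ideal_scale serre_ideal_diff
          K_preserves_serre_ideal Ki_preserves_serre_ideal)
    finally show ?case by (simp add: monomial_Cons mult.assoc)
  qed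
  then show ?case by (simp add: app_scale serre_ideal_scale)
qed (auto simp: app_add intro: serre_ideal.intros)

fun rep :: "uq_gen \<Rightarrow> 'k lin_op" where
  "rep (GE i) = E i" | "rep (GF i) = F i" | "rep (GK i) = K i" | "rep (GKi i) = Ki i"

lemma rep_preserves_serre_ideal:
  assumes "p \<in> serre_ideal I"
  shows "app (op_scalar.ev rep f) p \<in> serre_ideal I"
proof (induction f rule: poly_mapping_linear_induct)
  case (word l)
  have "app (op_scalar.eval_word rep (Word l)) p \<in> serre_ideal I"
  proof (induction l)
    case (Cons g l)
    then show ?case
      by (cases g) (simp_all add: op_scalar.eval_word_Cons app_simps E_preserves_serre_ideal
          F_preserves_serre_ideal K_preserves_serre_ideal Ki_preserves_serre_ideal)
  qed (simp add: app_simps assms)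
  then show ?case by (simp add: op_scalar.ev_single)
qed (auto simp: op_scalar.ev_mult op_scalar.ev_add app_simps intro: serre_ideal_scale serre_ideal.add)

end

section \<open>The quotient algebra inside a ring type\<close>

text \<open>The type \<open>'a residues\<close> is the product of all quotients of the ring \<open>'a\<close> by its two-sided ideals.
  A quotient that depends on term parameters embeds into it, so that type-class automation
  becomes available.\<close>

definition two_sided_ideal :: "'a::ring_1 set \<Rightarrow> bool" where
  "two_sided_ideal I \<longleftrightarrow> 0 \<in> I \<and> (\<forall>u\<in>I. \<forall>v\<in>I. u + v \<in> I) \<and> (\<forall>u\<in>I. \<forall>v. v * u \<in> I \<and> u * v \<in> I)"

lemma two_sided_idealD:
  assumes "two_sided_ideal I"
  shows "0 \<in> I" "u \<in> I \<Longrightarrow> v \<in> I \<Longrightarrow> u + v \<in> I" "u \<in> I \<Longrightarrow> v * u \<in> I" "u \<in> I \<Longrightarrow> u * v \<in> I"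
    "u \<in> I \<Longrightarrow> - u \<in> I" "u \<in> I \<Longrightarrow> v \<in> I \<Longrightarrow> u - v \<in> I"
proof -
  note I = assms[unfolded two_sided_ideal_def]
  show "0 \<in> I" "u \<in> I \<Longrightarrow> v \<in> I \<Longrightarrow> u + v \<in> I" "u \<in> I \<Longrightarrow> v * u \<in> I" "u \<in> I \<Longrightarrow> u * v \<in> I"
    using I by auto
  show neg: "u \<in> I \<Longrightarrow> - u \<in> I" for u
    using I mult_minus1[of u] by metis
  show "u \<in> I \<Longrightarrow> v \<in> I \<Longrightarrow> u - v \<in> I"
    using I neg[of v] by (metis diff_conv_add_uminus)
qed

definition family_cong :: "('a::ring_1 set \<Rightarrow> 'a) \<Rightarrow> ('a set \<Rightarrow> 'a) \<Rightarrow> bool" where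
  "family_cong f g \<longleftrightarrow> (\<forall>I. two_sided_ideal I \<longrightarrow> f I - g I \<in> I)"

quotient_type (overloaded) 'a residues = "'a::ring_1 set \<Rightarrow> 'a" / family_cong
proof (rule equivpI)
  show "reflp family_cong"
    by (auto simp: reflp_def family_cong_def two_sided_idealD)
  show "symp family_cong"
    unfolding symp_def family_cong_def by (metis minus_diff_eq two_sided_idealD(5))
  show "transp family_cong"
    unfolding transp_def family_cong_def
    by (metis (no_types, opaque_lifting) diff_add_cancel add_diff_eq two_sided_idealD(2))
qed

lemma family_cong_refl: "f = g \<Longrightarrow> family_cong f g"
  by (simp add: family_cong_def two_sided_idealD)

instantiation residues :: (ring_1) ring_1
begin

lift_definition zero_residues :: "'a residues" is "\<lambda>I. 0" .
lift_definition one_residues :: "'a residues" is "\<lambda>I. 1" .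
lift_definition plus_residues :: "'a residues \<Rightarrow> 'a residues \<Rightarrow> 'a residues" is "\<lambda>f g I. f I + g I"
  unfolding family_cong_def by (metis add_diff_add two_sided_idealD(2))
lift_definition uminus_residues :: "'a residues \<Rightarrow> 'a residues" is "\<lambda>f I. - f I"
  unfolding family_cong_def by (metis minus_diff_minus two_sided_idealD(5))
lift_definition minus_residues :: "'a residues \<Rightarrow> 'a residues \<Rightarrow> 'a residues" is "\<lambda>f g I. f I - g I"
proof -
  fix f f' g g' :: "'a set \<Rightarrow> 'a"
  assume "family_cong f f'" "family_cong g g'"
  moreover have "f I - g I - (f' I - g' I) = (f I - f' I) - (g I - g' I)" for I by simp
  ultimately show "family_cong (\<lambda>I. f I - g I) (\<lambda>I. f' I - g' I)"
    unfolding family_cong_def by (metis two_sided_idealD(6))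
qed
lift_definition times_residues :: "'a residues \<Rightarrow> 'a residues \<Rightarrow> 'a residues" is "\<lambda>f g I. f I * g I"
proof -
  fix f f' g g' :: "'a set \<Rightarrow> 'a"
  assume "family_cong f f'" "family_cong g g'"
  moreover have "f I * g I - f' I * g' I = f I * (g I - g' I) + (f I - f' I) * g' I" for I
    by (simp add: algebra_simps)
  ultimately show "family_cong (\<lambda>I. f I * g I) (\<lambda>I. f' I * g' I)"
    unfolding family_cong_def by (metis two_sided_idealD(2,3,4))
qed

instance
proof
  have "\<not> family_cong (\<lambda>I::'a set. 0) (\<lambda>I. 1)"
  proof
    have "two_sided_ideal {0::'a}" by (simp add: two_sided_ideal_def)
    moreover assume "family_cong (\<lambda>I::'a set. 0) (\<lambda>I. 1)"
    ultimately have "0 - 1 \<in> {0::'a}" unfolding family_cong_def by blast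
    then show False by simp
  qed
  then show "(0 :: 'a residues) \<noteq> 1" by transfer
qed (transfer; rule family_cong_refl; simp add: algebra_simps)+

end

text \<open>One coordinate carries the element of interest, all others the default \<open>d\<close>.
  For a ring homomorphism the default must itself depend multiplicatively on the element.\<close>

lift_definition residue_at :: "'a::ring_1 set \<Rightarrow> 'a \<Rightarrow> 'a \<Rightarrow> 'a residues" is
  "\<lambda>I p d J. if J = I then p else d" .

lemma residue_at_simps:
  "residue_at I (p + p') (d + d') = residue_at I p d + residue_at I p' d'"
  "residue_at I (p - p') (d - d') = residue_at I p d - residue_at I p' d'"
  "residue_at I (p * p') (d * d') = residue_at I p d * residue_at I p' d'"
  by (transfer, rule family_cong_refl, auto)+

lemma residue_at_eq_zero_iff:
  assumes "two_sided_ideal I"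
  shows "residue_at I p 0 = 0 \<longleftrightarrow> p \<in> I"
proof (transfer fixing: I p)
  show "family_cong (\<lambda>J. if J = I then p else 0) (\<lambda>I. 0) \<longleftrightarrow> p \<in> I"
    using assms by (auto simp: family_cong_def two_sided_idealD)
qed

lift_definition residue_const :: "'a::ring_1 \<Rightarrow> 'a residues" is "\<lambda>p I. p" .

lemma residue_at_same: "residue_at I p p = residue_const p"
  by transfer (rule family_cong_refl, auto)

definition residue_scalar :: "'k::field \<Rightarrow> ('a word \<Rightarrow>\<^sub>0 'k) residues" where
  "residue_scalar c = residue_const (scalar c)"

lemma residue_const_simps:
  "residue_const (p + r) = residue_const p + residue_const r"
  "residue_const (p * r) = residue_const p * residue_const r" "residue_const 1 = 1"
  by (transfer, rule family_cong_refl, auto)+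

interpretation residue_scalar: central_scalars "residue_scalar :: 'k::field \<Rightarrow> ('a word \<Rightarrow>\<^sub>0 'k) residues"
proof
  fix c :: 'k and u :: "('a word \<Rightarrow>\<^sub>0 'k) residues"
  show "residue_scalar c * u = u * residue_scalar c"
    unfolding residue_scalar_def
    by (transfer fixing: c) (rule family_cong_refl, rule ext, rule scalar.sc_central)
qed (simp_all add: residue_scalar_def scalar.sc_add scalar.sc_mult residue_const_simps)

lemmas field_ev = central_scalars.ev_simps[OF central_scalars_id] central_scalars.ev_scalar[OF central_scalars_id]
  central_scalars.ev_letter[OF central_scalars_id] central_scalars.ev_one[OF central_scalars_id]
  central_scalars.ev_zero[OF central_scalars_id]

text \<open>The closure conditions on \<open>Q\<close> range over the whole type rather than the
  carrier, which suits predicates defined through evaluation maps.\<close>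

lemma genideal_free_algebra_induct [consumes 2, case_names gen zero add uminus left right]:
  assumes "p \<in> Idl\<^bsub>free_algebra G\<^esub> R" "R \<subseteq> carrier (free_algebra G)"
    and "\<And>r. r \<in> R \<Longrightarrow> Q r" "Q 0" "\<And>p r. Q p \<Longrightarrow> Q r \<Longrightarrow> Q (p + r)" "\<And>p. Q p \<Longrightarrow> Q (- p)"
    and "\<And>p r. Q p \<Longrightarrow> Q (r * p)" "\<And>p r. Q p \<Longrightarrow> Q (p * r)"
  shows "Q p"
proof -
  let ?A = "free_algebra G" and ?S = "{p \<in> carrier (free_algebra G). Q p}"
  interpret A: ring ?A by (rule ring_free_algebra)
  have neg: "\<ominus>\<^bsub>?A\<^esub> u = - u" if "u \<in> carrier ?A" for u
    using that by (intro A.minus_equality) (auto simp: free_algebra_simps free_algebra_uminus_closed)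
  have "ideal ?S ?A"
  proof (rule idealI)
    show "subgroup ?S (add_monoid ?A)"
    proof (rule A.add.subgroupI)
      fix u assume u: "u \<in> ?S"
      then show "\<ominus>\<^bsub>?A\<^esub> u \<in> ?S"
        using assms(6) by (auto simp: neg free_algebra_uminus_closed)
    next
      show "?S \<noteq> {}" using assms(4) zero_closed_free_algebra by auto
    qed (use assms(5) in \<open>auto simp: free_algebra_simps free_algebra_add_closed\<close>)
  qed (use assms(7,8) in \<open>auto simp: free_algebra_simps free_algebra_mult_closed ring_free_algebra\<close>)
  moreover have "R \<subseteq> ?S" using assms(2,3) by auto
  ultimately have "Idl\<^bsub>?A\<^esub> R \<subseteq> ?S" by (rule A.genideal_minimal)
  then show ?thesis using assms(1) by auto
qed

lemma genideal_free_algebra: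
  assumes "R \<subseteq> carrier (free_algebra G)"
  defines "I \<equiv> Idl\<^bsub>free_algebra G\<^esub> R"
  shows "I \<subseteq> carrier (free_algebra G)" "0 \<in> I" "p \<in> I \<Longrightarrow> r \<in> I \<Longrightarrow> p + r \<in> I"
    "p \<in> I \<Longrightarrow> r \<in> carrier (free_algebra G) \<Longrightarrow> r * p \<in> I"
    "p \<in> I \<Longrightarrow> r \<in> carrier (free_algebra G) \<Longrightarrow> p * r \<in> I" "R \<subseteq> I"
proof -
  interpret A: ring "free_algebra G" by (rule ring_free_algebra)
  interpret I: ideal I "free_algebra G" unfolding I_def by (rule A.genideal_ideal[OF assms(1)])
  show "I \<subseteq> carrier (free_algebra G)" by (rule I.a_subset)
  show "0 \<in> I" using I.zero_closed by (simp add: free_algebra_simps)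
  show "p \<in> I \<Longrightarrow> r \<in> I \<Longrightarrow> p + r \<in> I" using I.a_closed by (simp add: free_algebra_simps)
  show "p \<in> I \<Longrightarrow> r \<in> carrier (free_algebra G) \<Longrightarrow> r * p \<in> I"
    using I.I_l_closed by (simp add: free_algebra_simps)
  show "p \<in> I \<Longrightarrow> r \<in> carrier (free_algebra G) \<Longrightarrow> p * r \<in> I"
    using I.I_r_closed by (simp add: free_algebra_simps)
  show "R \<subseteq> I" unfolding I_def by (rule A.genideal_self[OF assms(1)])
qed

section \<open>The embedding of U_q(g) into the ring type\<close>

locale uq_params =
  fixes n :: nat and q :: "'k::field"
begin

text \<open>Letters with an index out of range go to 0. Thus the ideal of relations pulls back to a
  two-sided ideal of the free algebra on the whole type \<open>uq_gen\<close>, as needed for a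
  coordinate of \<open>residues\<close>.\<close>

definition gen_projection :: "(uq_gen word \<Rightarrow>\<^sub>0 'k) \<Rightarrow> (uq_gen word \<Rightarrow>\<^sub>0 'k)" where
  "gen_projection = scalar.ev (\<lambda>g. if g \<in> Uq_gens n then letter g else 0)"

text \<open>The counit of U_q(g). It kills every relation and so provides the default at the other
  coordinates.\<close>

definition augmentation :: "(uq_gen word \<Rightarrow>\<^sub>0 'k) \<Rightarrow> 'k" where
  "augmentation = central_scalars.ev (\<lambda>c. c) (case_uq_gen (\<lambda>_. 0) (\<lambda>_. 0) (\<lambda>_. 1) (\<lambda>_. 1))"

definition Uq_ideal :: "(uq_gen word \<Rightarrow>\<^sub>0 'k) set" where
  "Uq_ideal = Idl\<^bsub>free_algebra (Uq_gens n)\<^esub> (Uq_rels n q)"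

definition emb :: "(uq_gen word \<Rightarrow>\<^sub>0 'k) \<Rightarrow> (uq_gen word \<Rightarrow>\<^sub>0 'k) residues" where
  "emb p = residue_at {p. gen_projection p \<in> Uq_ideal} p (scalar (augmentation (gen_projection p)))"

lemmas Uq_ideal_props = genideal_free_algebra[OF Uq_rels_closed[of n q], folded Uq_ideal_def]

lemma gen_projection_closed: "gen_projection p \<in> carrier (free_algebra (Uq_gens n))"
proof (induction p rule: poly_mapping_linear_induct)
  case (word l)
  have "scalar.eval_word (\<lambda>g. if g \<in> Uq_gens n then letter g else 0) (Word l)
      \<in> carrier (free_algebra (Uq_gens n) :: (uq_gen word \<Rightarrow>\<^sub>0 'k) ring)"
    by (induction l) (simp_all add: scalar.eval_word_Cons free_algebra_mult_closed letter_closed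
        one_closed_free_algebra zero_closed_free_algebra)
  then show ?case by (simp only: gen_projection_def scalar.ev_single scalar.sc_one mult_1_left)
qed (simp_all add: gen_projection_def scalar.ev_simps free_algebra_mult_closed free_algebra_add_closed scalar_closed)

lemma gen_projection_id:
  assumes "p \<in> carrier (free_algebra (Uq_gens n))"
  shows "gen_projection p = p"
proof -
  have w: "scalar.eval_word (\<lambda>g. if g \<in> Uq_gens n then letter g else 0) (Word l) = (monomial l :: uq_gen word \<Rightarrow>\<^sub>0 'k)"
    if "set l \<subseteq> Uq_gens n" for l
    using that by (induction l) (auto simp: scalar.eval_word_Cons monomial_Cons monomial_Nil)
  have "scalar c * monomial (letters w) = Poly_Mapping.single w c" for c :: 'k and w :: "uq_gen word"
    by (simp add: scalar_def mult_single)
  moreover have "scalar.eval_word (\<lambda>g. if g \<in> Uq_gens n then letter g else 0) v = (monomial (letters v) :: uq_gen word \<Rightarrow>\<^sub>0 'k)"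
    if "v \<in> Poly_Mapping.keys p" for v
    using w[of "letters v"] that assms by (simp add: free_algebra_def)
  ultimately have "gen_projection p = (\<Sum>v\<in>Poly_Mapping.keys p. Poly_Mapping.single v (Poly_Mapping.lookup p v))"
    unfolding gen_projection_def scalar.ev_def by (intro sum.cong) auto
  then show ?thesis by (simp add: poly_mapping_sum_singles)
qed

lemma two_sided_ideal_pullback: "two_sided_ideal {p. gen_projection p \<in> Uq_ideal}"
  unfolding two_sided_ideal_def
  using Uq_ideal_props gen_projection_closed
  by (auto simp: gen_projection_def scalar.ev_simps)

lemma emb_simps:
  "emb (p + r) = emb p + emb r" "emb (p - r) = emb p - emb r" "emb (p * r) = emb p * emb r"
  "emb (scalar c) = residue_scalar c" "emb 1 = 1" "emb 0 = 0"
proof -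
  show "emb (p + r) = emb p + emb r" "emb (p - r) = emb p - emb r" "emb (p * r) = emb p * emb r"
    by (simp_all add: emb_def gen_projection_def augmentation_def scalar.ev_simps
        field_ev scalar.sc_add scalar.sc_diff scalar.sc_mult residue_at_simps)
  show s: "emb (scalar c) = residue_scalar c" for c
    by (simp add: emb_def gen_projection_def augmentation_def field_ev residue_at_same residue_scalar_def)
  show "emb 1 = 1" "emb 0 = 0"
    using s[of 1] s[of 0] by simp_all
qed

lemma emb_eq_zero:
  assumes "p \<in> Uq_ideal"
  shows "emb p = 0"
proof -
  have "augmentation p = 0"
    using assms Uq_rels_closed unfolding Uq_ideal_def
  proof (induction rule: genideal_free_algebra_induct)
    case (gen r)
    then show ?case
      unfolding Uq_rels_def Let_def augmentation_def
      by (elim UnE) (auto simp: field_ev split: if_splits)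
  qed (auto simp: augmentation_def field_ev)
  moreover have "gen_projection p = p"
    using assms Uq_ideal_props(1) by (auto intro: gen_projection_id)
  ultimately show ?thesis
    using assms by (simp add: emb_def residue_at_eq_zero_iff two_sided_ideal_pullback)
qed

text \<open>At the coordinate of the pulled-back ideal \<open>emb p\<close> is represented by
  \<open>p\<close> itself. With \<open>emb_eq_zero\<close> this shows that \<open>emb\<close>
  induces an embedding of the quotient.\<close>

lemma emb_eq_zeroD:
  assumes "emb p = 0" "p \<in> carrier (free_algebra (Uq_gens n))"
  shows "p \<in> Uq_ideal"
proof -
  let ?I = "{p. gen_projection p \<in> Uq_ideal}"
  have "residue_at ?I p (scalar (augmentation (gen_projection p))) = 0"
    using assms(1) by (simp add: emb_def)
  then have "p \<in> ?I"
  proof (transfer fixing: n q p)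
    assume "family_cong (\<lambda>J. if J = ?I then p else scalar (augmentation (gen_projection p))) (\<lambda>I. 0)"
    from this[unfolded family_cong_def, rule_format, OF two_sided_ideal_pullback]
    show "p \<in> ?I" by simp
  qed
  then show ?thesis using assms(2) by (simp add: gen_projection_id)
qed

lemma emb_rel: "r \<in> Uq_rels n q \<Longrightarrow> emb r = 0"
  using Uq_ideal_props(6) emb_eq_zero by blast

definition "rE i = emb (letter (GE i))"
definition "rF i = emb (letter (GF i))"
definition "rK i = emb (letter (GK i))"
definition "rKi i = emb (letter (GKi i))"

lemma Uq_relations:
  assumes "i \<in> {1..n+1}" "j \<in> {1..n+1}"
  shows "rK i * rKi i = 1" "rKi i * rK i = 1" "rK i * rK j = rK j * rK i"
    "rK i * rE j * rKi i = residue_scalar (q powi cartan_D n i j) * rE j"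
    "rK i * rF j * rKi i = residue_scalar (q powi (- cartan_D n i j)) * rF j"
    "rE i * rF j - rF j * rE i
      = (if i = j then residue_scalar (inverse (q - inverse q)) * (rK i - rKi i) else 0)"
    "cartan_D n i j = 0 \<Longrightarrow> rE i * rE j = rE j * rE i"
    "cartan_D n i j = 0 \<Longrightarrow> rF i * rF j = rF j * rF i"
    "cartan_D n i j = -1 \<Longrightarrow> rE i * rE i * rE j
       - residue_scalar (q + inverse q) * rE i * rE j * rE i + rE j * rE i * rE i = 0"
    "cartan_D n i j = -1 \<Longrightarrow> rF i * rF i * rF j
       - residue_scalar (q + inverse q) * rF i * rF j * rF i + rF j * rF i * rF i = 0"
proof -
  note defs = rE_def rF_def rK_def rKi_def emb_simps[symmetric]
  have eq: "emb l = emb r" if "l - r \<in> Uq_rels n q" for l r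
    using emb_rel[OF that] by (simp add: emb_simps)
  have "letter (GK i) * letter (GKi i) - 1 \<in> Uq_rels n q" "letter (GKi i) * letter (GK i) - 1 \<in> Uq_rels n q"
    "letter (GK i) * letter (GK j) - letter (GK j) * letter (GK i) \<in> Uq_rels n q"
    "letter (GK i) * letter (GE j) * letter (GKi i) - scalar (q powi cartan_D n i j) * letter (GE j) \<in> Uq_rels n q"
    "letter (GK i) * letter (GF j) * letter (GKi i) - scalar (q powi (- cartan_D n i j)) * letter (GF j) \<in> Uq_rels n q"
    using assms unfolding Uq_rels_def Let_def by blast+
  then show "rK i * rKi i = 1" "rKi i * rK i = 1" "rK i * rK j = rK j * rK i"
    "rK i * rE j * rKi i = residue_scalar (q powi cartan_D n i j) * rE j"
    "rK i * rF j * rKi i = residue_scalar (q powi (- cartan_D n i j)) * rF j"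
    unfolding defs by (blast intro: eq)+
  have "letter (GE i) * letter (GF j) - letter (GF j) * letter (GE i)
       - (if i = j then scalar (inverse (q - inverse q)) * (letter (GK i) - letter (GKi i)) else 0)
       \<in> Uq_rels n q"
    using assms unfolding Uq_rels_def Let_def by blast
  from emb_rel[OF this] show "rE i * rF j - rF j * rE i
      = (if i = j then residue_scalar (inverse (q - inverse q)) * (rK i - rKi i) else 0)"
    by (simp add: rE_def rF_def rK_def rKi_def emb_simps split: if_splits)
  have com: "Z i * Z j - Z j * Z i \<in> Uq_rels n q"
    if "Z \<in> {\<lambda>i. letter (GE i), \<lambda>i. letter (GF i)}" "cartan_D n i j = 0" for Z
    unfolding Uq_rels_def Let_def
    by (rule UnI1, rule UnI2, rule CollectI, rule exI[of _ Z], rule exI[of _ i], rule exI[of _ j])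
      (use assms that in auto)
  show "cartan_D n i j = 0 \<Longrightarrow> rE i * rE j = rE j * rE i"
    unfolding defs using com[of "\<lambda>i. letter (GE i)"] by (intro eq) auto
  show "cartan_D n i j = 0 \<Longrightarrow> rF i * rF j = rF j * rF i"
    unfolding defs using com[of "\<lambda>i. letter (GF i)"] by (intro eq) auto
  have ser: "Z i * Z i * Z j - scalar (q + inverse q) * Z i * Z j * Z i + Z j * Z i * Z i \<in> Uq_rels n q"
    if "Z \<in> {\<lambda>i. letter (GE i), \<lambda>i. letter (GF i)}" "cartan_D n i j = -1" for Z
    unfolding Uq_rels_def Let_def
    by (rule UnI2, rule CollectI, rule exI[of _ Z], rule exI[of _ i], rule exI[of _ j])
      (use assms that in auto)
  show "cartan_D n i j = -1 \<Longrightarrow> rE i * rE i * rE j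
       - residue_scalar (q + inverse q) * rE i * rE j * rE i + rE j * rE i * rE i = 0"
    using emb_rel[OF ser[of "\<lambda>i. letter (GE i)"]] by (simp add: emb_simps rE_def)
  show "cartan_D n i j = -1 \<Longrightarrow> rF i * rF i * rF j
       - residue_scalar (q + inverse q) * rF i * rF j * rF i + rF j * rF i * rF i = 0"
    using emb_rel[OF ser[of "\<lambda>i. letter (GF i)"]] by (simp add: emb_simps rF_def)
qed

end

section \<open>The relations of the coideal subalgebra\<close>

text \<open>The diagram automorphism of \<open>D\<^bsub>n+1\<^esub>\<close>: \<open>B\<^sub>i = F\<^sub>i - K\<^sub>i\<^sup>-\<^sup>1 E\<^bsub>flip n i\<^esub>\<close> for all \<open>i\<close>.\<close>

definition flip :: "nat \<Rightarrow> nat \<Rightarrow> nat" where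
  "flip n i = (if i = n then n + 1 else if i = n + 1 then n else i)"

lemma flip_flip [simp]: "flip n (flip n i) = i"
  by (simp add: flip_def)

lemma flip_mem: "n \<ge> 1 \<Longrightarrow> flip n i \<in> {1..n+1} \<longleftrightarrow> i \<in> {1..n+1}"
  by (auto simp: flip_def)

lemma cartan_D_sym: "cartan_D n i j = cartan_D n j i"
  by (auto simp: cartan_D_def)

lemma cartan_D_diag [simp]: "cartan_D n i i = 2"
  by (simp add: cartan_D_def)

lemma cartan_D_flip:
  assumes "i < n"
  shows "cartan_D n i (flip n j) = cartan_D n i j" "cartan_D n (flip n j) i = cartan_D n j i"
proof -
  consider "j = n" | "j = n + 1" | "flip n j = j" by (metis flip_def)
  then show *: "cartan_D n i (flip n j) = cartan_D n i j"
    using assms by cases (auto simp: cartan_D_def flip_def)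
  then show "cartan_D n (flip n j) i = cartan_D n j i"
    by (simp add: cartan_D_sym)
qed

lemma flip_less: "i < n \<Longrightarrow> flip n i = i"
  by (simp add: flip_def)

lemma cartan_D_zero_flip:
  assumes "i \<le> n + 1" "j \<le> n + 1" "cartan_D n i j = 0" "{i, j} \<noteq> {n, n+1}"
  shows "cartan_D n (flip n i) (flip n j) = 0" "cartan_D n i (flip n j) = 0" "cartan_D n j (flip n i) = 0"
proof -
  have "i \<noteq> j" using assms(3) by auto
  have "i < n \<or> j < n"
  proof (rule ccontr)
    assume "\<not> (i < n \<or> j < n)"
    then have "i = n \<and> j = n + 1 \<or> i = n + 1 \<and> j = n" using assms(1,2) \<open>i \<noteq> j\<close> by linarith
    then show False using assms(4) by blast
  qed
  then show "cartan_D n (flip n i) (flip n j) = 0" "cartan_D n i (flip n j) = 0" "cartan_D n j (flip n i) = 0"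
    using assms(3) by (auto simp: cartan_D_flip flip_less cartan_D_sym[of n j i])
qed

lemma cartan_D_end:
  assumes "n \<ge> 3"
  shows "cartan_D n n j = -1 \<longleftrightarrow> j = n - 1" "cartan_D n (n+1) j = -1 \<longleftrightarrow> j = n - 1"
    "cartan_D n n (n+1) = 0" "cartan_D n (n+1) n = 0"
  using assms by (auto simp: cartan_D_def)

text \<open>For j in the index range this is a_(n+1,j) - a_(n,j), the exponent of q in moving
  K_nK_(n+1)^{-1} past F_j.\<close>

definition B_weight :: "nat \<Rightarrow> nat \<Rightarrow> int" where
  "B_weight n j = (if j = n then -2 else if j = n + 1 then 2 else 0)"

text \<open>The defining relations of the coideal subalgebra in an arbitrary ring. Instances are the
  generators themselves, their images under tau_n^- and tau_n, and the target of a homomorphism to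
  be constructed. The value 0 outside the index range lets words over all of \<open>nat\<close> be
  evaluated.\<close>

locale kolb_tuple = central_scalars sc for sc :: "'k::field \<Rightarrow> 'r::ring_1" +
  fixes n :: nat and q :: 'k and B :: "nat \<Rightarrow> 'r" and k ki :: 'r
  assumes k_ki: "k * ki = 1" and ki_k: "ki * k = 1"
    and B_outside: "j \<notin> {1..n+1} \<Longrightarrow> B j = 0"
    and k_B: "k * B j = sc (q powi B_weight n j) * (B j * k)"
    and B_commute: "i \<in> {1..n+1} \<Longrightarrow> j \<in> {1..n+1} \<Longrightarrow> cartan_D n i j = 0 \<Longrightarrow> {i, j} \<noteq> {n, n+1}
        \<Longrightarrow> B i * B j = B j * B i"
    and B_n_commutator: "B n * B (n+1) - B (n+1) * B n = sc (inverse (q - inverse q)) * (k - ki)"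
    and B_serre: "i \<in> {1..n+1} \<Longrightarrow> j \<in> {1..n+1} \<Longrightarrow> cartan_D n i j = -1 \<Longrightarrow>
        B i * B i * B j - (sc q + sc (inverse q)) * (B i * B j * B i) + B j * B i * B i
        = (if i \<le> n - 1 then - (sc (inverse q) * B j) else 0)"

locale uq_generic = uq_params n q for n and q :: "'k::field" +
  assumes n_ge: "n \<ge> 3" and q_nonzero: "q \<noteq> 0" and q_generic: "m > 0 \<Longrightarrow> q ^ m \<noteq> 1"
begin

abbreviation "rs \<equiv> residue_scalar :: 'k \<Rightarrow> (uq_gen word \<Rightarrow>\<^sub>0 'k) residues"

sublocale q_scalars "rs q" "rs (inverse q)" "rs (inverse (q - inverse q))" "rs (inverse (q + inverse q))"
  using q_nonzero q_generic by (intro residue_scalar.q_scalars) auto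

lemma flip_closed: "j \<in> {1..n+1} \<Longrightarrow> flip n j \<in> {1..n+1}"
  using n_ge flip_mem[of n j] by linarith

lemma rs_rs: "rs c * (rs d * u) = rs (c * d) * u"
  by (simp add: residue_scalar.sc_mult mult.assoc)

lemma K_rules:
  assumes "i \<in> {1..n+1}" "j \<in> {1..n+1}"
  shows "rK i * rF j = rs (q powi (- cartan_D n i j)) * (rF j * rK i)"
    "rKi i * rF j = rs (q powi (cartan_D n i j)) * (rF j * rKi i)"
    "rK i * rE j = rs (q powi (cartan_D n i j)) * (rE j * rK i)"
    "rKi i * rE j = rs (q powi (- cartan_D n i j)) * (rE j * rKi i)"
    "rKi i * rKi j = rKi j * rKi i" "rKi i * rK j = rK j * rKi i"
proof -
  note r = Uq_relations[OF assms]
  have conj: "rK i * u = rs s * (u * rK i)" "rKi i * u = rs (inverse s) * (u * rKi i)"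
    if u: "rK i * u * rKi i = rs s * u" and s: "s \<noteq> 0" for u s
  proof -
    have "rK i * u = rK i * u * rKi i * rK i" by (simp add: mult.assoc r(2))
    also have "\<dots> = rs s * u * rK i" by (simp only: u)
    finally show "rK i * u = rs s * (u * rK i)" by (simp only: mult.assoc)
    have "rKi i * (rK i * u * rKi i) = u * rKi i" by (simp add: mult.assoc[symmetric] r(2))
    then have "u * rKi i = rKi i * (rs s * u)" by (simp only: u)
    then have "u * rKi i = rs s * (rKi i * u)" by (simp only: residue_scalar.sc_left_commute[of "rKi i"])
    then show "rKi i * u = rs (inverse s) * (u * rKi i)" using s by (simp add: rs_rs)
  qed
  show "rK i * rF j = rs (q powi (- cartan_D n i j)) * (rF j * rK i)"
    "rKi i * rF j = rs (q powi (cartan_D n i j)) * (rF j * rKi i)"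
    using conj[OF r(5)] q_nonzero by (simp_all add: power_int_minus)
  show "rK i * rE j = rs (q powi (cartan_D n i j)) * (rE j * rK i)"
    "rKi i * rE j = rs (q powi (- cartan_D n i j)) * (rE j * rKi i)"
    using conj[OF r(4)] q_nonzero by (simp_all add: power_int_minus)
  have "rK i * rK j * rKi i = rs 1 * rK j"
    using r(1) by (simp add: r(3) mult.assoc)
  from conj(2)[OF this] show *: "rKi i * rK j = rK j * rKi i" by simp
  have jj: "rK j * rKi j = 1" "rKi j * rK j = 1" using Uq_relations[OF assms(2) assms(2)] by auto
  have "rKi i * rKi j = rKi j * (rK j * rKi i) * rKi j" by (simp add: mult.assoc[symmetric] jj)
  also have "\<dots> = rKi j * rKi i" by (simp add: *[symmetric]) (simp add: mult.assoc jj)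
  finally show "rKi i * rKi j = rKi j * rKi i" .
qed

lemma E_F_commute: "i \<in> {1..n+1} \<Longrightarrow> j \<in> {1..n+1} \<Longrightarrow> i \<noteq> j \<Longrightarrow> rE i * rF j = rF j * rE i"
  using Uq_relations(6)[of i j] by simp

lemma serre_rules:
  assumes "i \<in> {1..n+1}" "j \<in> {1..n+1}" "cartan_D n i j = -1"
  shows "rE i * (rE i * rE j) = rs q * (rE i * (rE j * rE i)) + rs (inverse q) * (rE i * (rE j * rE i)) - rE j * (rE i * rE i)"
    "rF i * (rF i * rF j) = rs q * (rF i * (rF j * rF i)) + rs (inverse q) * (rF i * (rF j * rF i)) - rF j * (rF i * rF i)"
proof -
  have *: "u * (u * v) = rs q * (u * (v * u)) + rs (inverse q) * (u * (v * u)) - v * (u * u)"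
    if "u * u * v - rs (q + inverse q) * u * v * u + v * u * u = 0" for u v
  proof -
    have "u * (u * v) - (rs q * (u * (v * u)) + rs (inverse q) * (u * (v * u)) - v * (u * u))
      = u * u * v - rs (q + inverse q) * u * v * u + v * u * u"
      by (simp add: residue_scalar.sc_add algebra_simps)
    then show ?thesis using that by (simp only: right_minus_eq)
  qed
  show "rE i * (rE i * rE j) = rs q * (rE i * (rE j * rE i)) + rs (inverse q) * (rE i * (rE j * rE i)) - rE j * (rE i * rE i)"
    "rF i * (rF i * rF j) = rs q * (rF i * (rF j * rF i)) + rs (inverse q) * (rF i * (rF j * rF i)) - rF j * (rF i * rF i)"
    using *[OF Uq_relations(9)[OF assms]] *[OF Uq_relations(10)[OF assms]] .
qed

definition rB :: "nat \<Rightarrow> (uq_gen word \<Rightarrow>\<^sub>0 'k) residues" where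
  "rB i = (if i \<in> {1..n+1} then rF i - rKi i * rE (flip n i) else 0)"

definition "kap = rK n * rKi (n+1)"
definition "kapi = rKi n * rK (n+1)"

lemma rs_powers:
  "rs (q powi 2) = rs q * rs q" "rs (q powi -2) = rs (inverse q) * rs (inverse q)"
  "rs (q powi 1) = rs q" "rs (q powi -1) = rs (inverse q)" "rs (q powi 0) = 1"
  by (simp_all add: residue_scalar.sc_mult[symmetric] power_int_minus power2_eq_square)

lemma E_F_same: "i \<in> {1..n+1} \<Longrightarrow> rE i * rF i = rF i * rE i + rs (inverse (q - inverse q)) * (rK i - rKi i)"
  using Uq_relations(6)[of i i] by (simp add: diff_eq_eq add.commute)

lemma rB_zero: "i \<notin> {1..n+1} \<Longrightarrow> rB i = 0"
  by (simp only: rB_def if_False)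

lemma rB_eq: "i \<in> {1..n+1} \<Longrightarrow> rB i = rF i - rKi i * rE (flip n i)"
  by (simp add: rB_def)

lemma serre_first:
  assumes "i \<in> {1..n-1}" and j: "j \<in> {1..n+1}" and a: "cartan_D n i j = -1"
  shows "rB i * rB i * rB j - (rs q + rs (inverse q)) * (rB i * rB j * rB i) + rB j * rB i * rB i
      = - (rs (inverse q) * rB j)"
proof -
  let ?f = "flip n j"
  have i: "i \<in> {1..n+1}" "flip n i = i" and lt: "i < n" using assms n_ge by (auto simp: flip_def)
  have f: "?f \<in> {1..n+1}" using j by (rule flip_closed)
  have a': "cartan_D n j i = -1" "cartan_D n i ?f = -1" "cartan_D n ?f i = -1"
    using a lt by (simp_all add: cartan_D_flip cartan_D_sym[of n j i])
  have ne: "i \<noteq> j" "?f \<noteq> i" using a a' by auto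
  note simp = a a' cartan_D_diag minus_minus rs_powers mult.assoc
  show ?thesis
    unfolding rB_eq[OF i(1)] rB_eq[OF j] i(2)
    by (rule q_serre_with_correction[where ?K1.0 = "rK i"])
      (fact Uq_relations(1,2)[OF i(1) i(1)] K_rules[OF i(1) i(1), unfolded simp]
        K_rules[OF i(1) j, unfolded simp] K_rules[OF j i(1), unfolded simp]
        K_rules[OF i(1) f, unfolded simp] E_F_same[OF i(1)] E_F_commute[OF i(1) j ne(1)]
        E_F_commute[OF f i(1) ne(2)] serre_rules[OF i(1) j a] serre_rules[OF i(1) f a'(2)])+
qed

lemma serre_second:
  assumes "i \<in> {n, n+1}"
  shows "rB i * rB i * rB (n-1) - (rs q + rs (inverse q)) * (rB i * rB (n-1) * rB i) + rB (n-1) * rB i * rB i = 0"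
proof -
  let ?j = "n - 1" and ?f = "flip n i"
  have i: "i \<in> {1..n+1}" and f: "?f \<in> {1..n+1}" and j: "?j \<in> {1..n+1}" "flip n ?j = ?j"
    using assms n_ge by (auto simp: flip_def)
  have a: "cartan_D n i ?j = -1" "cartan_D n ?j i = -1" "cartan_D n ?f ?j = -1"
    "cartan_D n ?j ?f = -1" "cartan_D n i ?f = 0"
    using assms n_ge by (auto simp: cartan_D_def flip_def)
  have ne: "?f \<noteq> ?j" "?f \<noteq> i" "?j \<noteq> i" using assms n_ge by (auto simp: flip_def)
  note simp = a cartan_D_diag minus_minus minus_zero rs_powers mult.assoc mult_1_left
  show ?thesis
    unfolding rB_eq[OF i] rB_eq[OF j(1)] j(2)
    by (rule q_serre_twisted)
      (fact K_rules[OF i i, unfolded simp] K_rules[OF i j(1), unfolded simp] K_rules[OF j(1) i, unfolded simp]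
        K_rules[OF i f, unfolded simp] K_rules[OF j(1) f, unfolded simp]
        E_F_commute[OF f i ne(2)] E_F_commute[OF f j(1) ne(1)] E_F_commute[OF j(1) i ne(3)]
        serre_rules[OF i j(1) a(1)] serre_rules[OF f j(1) a(3)])+
qed

lemma rB_commute:
  assumes ij: "i \<in> {1..n+1}" "j \<in> {1..n+1}" "cartan_D n i j = 0" "{i, j} \<noteq> {n, n+1}"
  shows "rB i * rB j = rB j * rB i"
proof -
  have f: "flip n i \<in> {1..n+1}" "flip n j \<in> {1..n+1}" by (fact flip_closed[OF ij(1)] flip_closed[OF ij(2)])+
  have a: "cartan_D n j i = 0" "cartan_D n (flip n i) (flip n j) = 0"
    "cartan_D n i (flip n j) = 0" "cartan_D n j (flip n i) = 0"
    using cartan_D_zero_flip[of i n j] ij by (auto simp: cartan_D_sym[of n j i])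
  have ne: "flip n i \<noteq> j" "flip n j \<noteq> i" using a by auto
  have F: "rF j * rF i = rF i * rF j" and E: "rE (flip n j) * rE (flip n i) = rE (flip n i) * rE (flip n j)"
    using Uq_relations(8)[of i j] Uq_relations(7)[of "flip n i" "flip n j"] ij f a by auto
  have K: "rKi j * rF i = rF i * rKi j" "rKi i * rF j = rF j * rKi i"
    "rKi i * rE (flip n j) = rE (flip n j) * rKi i" "rKi j * rE (flip n i) = rE (flip n i) * rKi j"
    "rKi j * rKi i = rKi i * rKi j"
    using K_rules[of i j] K_rules[of j i] K_rules[of i "flip n j"] K_rules[of j "flip n i"] ij f a
    by (simp_all add: rs_powers)
  have EF: "rE (flip n i) * rF j = rF j * rE (flip n i)" "rE (flip n j) * rF i = rF i * rE (flip n j)"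
    using E_F_commute f ij ne by auto
  note r = F E K(1,2,5) K(3,4)[symmetric] EF
  show ?thesis
    using ij by (simp add: rB_def algebra_simps r r[THEN mult_assoc_ext])
qed

text \<open>Both summands F_j and K_j^{-1} E_(flip j) have the same weight under alpha_n -
  alpha_(n+1): \<open>flip\<close> negates this difference, and E and F have opposite
  weights.\<close>

lemma kap_B: "kap * rB j = rs (q powi B_weight n j) * (rB j * kap)"
proof (cases "j \<in> {1..n+1}")
  case True
  have f: "flip n j \<in> {1..n+1}" using True by (rule flip_closed)
  have idx: "n \<in> {1..n+1}" "n + 1 \<in> {1..n+1}" using n_ge by auto
  let ?a = "cartan_D n n j" and ?b = "cartan_D n (n+1) j"
  have w: "?b - ?a = B_weight n j" "cartan_D n n (flip n j) - cartan_D n (n+1) (flip n j) = B_weight n j"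
    using True n_ge by (auto simp: cartan_D_def flip_def B_weight_def)
  have "kap * rF j = rs (q powi (?b - ?a)) * (rF j * kap)"
    using True idx q_nonzero
    by (simp add: kap_def K_rules mult.assoc residue_scalar.sc_left_commute[of "rK n"] rs_rs power_int_diff
        mult_assoc_ext[OF K_rules(1)[OF idx(1) True]] power_int_minus field_simps)
  moreover have "kap * rE (flip n j)
      = rs (q powi (cartan_D n n (flip n j) - cartan_D n (n+1) (flip n j))) * (rE (flip n j) * kap)"
    using f idx q_nonzero
    by (simp add: kap_def K_rules mult.assoc residue_scalar.sc_left_commute[of "rK n"] rs_rs power_int_diff
        mult_assoc_ext[OF K_rules(3)[OF idx(1) f]] power_int_minus field_simps)
  moreover have "kap * rKi j = rKi j * kap"
  proof -
    have "kap * rKi j = rK n * (rKi j * rKi (n+1))"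
      by (simp add: kap_def mult.assoc K_rules(5)[OF idx(2) True, simplified])
    also have "\<dots> = rKi j * kap"
      by (simp add: kap_def mult.assoc[symmetric] K_rules(6)[OF True idx(1), simplified])
    finally show ?thesis .
  qed
  ultimately have "kap * rF j = rs (q powi B_weight n j) * (rF j * kap)"
    and "kap * (rKi j * rE (flip n j)) = rs (q powi B_weight n j) * (rKi j * (rE (flip n j) * kap))"
    by (simp_all only: w mult.assoc[symmetric], simp_all only: mult.assoc residue_scalar.sc_left_commute[of "rKi j"])
  then show ?thesis
    using True by (simp add: rB_def algebra_simps)
qed (simp add: rB_zero)

text \<open>Only the pairs F_n, E_n and F_(n+1), E_(n+1) contribute. Both leave a multiple of
  K_n^{-1}K_(n+1)^{-1}, and these cancel.\<close>

lemma rB_n_commutator: "rB n * rB (n+1) - rB (n+1) * rB n = rs (inverse (q - inverse q)) * (kap - kapi)"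
proof -
  have idx: "n \<in> {1..n+1}" "n + 1 \<in> {1..n+1}" using n_ge by auto
  have a: "cartan_D n n (n+1) = 0" "cartan_D n (n+1) n = 0" using n_ge by (simp_all add: cartan_D_def)
  let ?h = "rs (inverse (q - inverse q))"
  have F: "rF (n+1) * rF n = rF n * rF (n+1)" and E: "rE (n+1) * rE n = rE n * rE (n+1)"
    using Uq_relations[OF idx] a by auto
  have K: "rKi (n+1) * rF n = rF n * rKi (n+1)" "rKi n * rF (n+1) = rF (n+1) * rKi n"
    "rKi n * rKi (n+1) = rKi (n+1) * rKi n" "rKi (n+1) * rK n = rK n * rKi (n+1)"
    "rE n * rKi (n+1) = rKi (n+1) * rE n" "rE (n+1) * rKi n = rKi n * rE (n+1)"
    using K_rules[OF idx] K_rules[OF idx(2,1)] a by (simp_all add: rs_powers)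
  have EF: "rE n * rF n = rF n * rE n + ?h * (rK n - rKi n)"
    "rE (n+1) * rF (n+1) = rF (n+1) * rE (n+1) + ?h * (rK (n+1) - rKi (n+1))"
    using Uq_relations(6)[OF idx(1) idx(1)] Uq_relations(6)[OF idx(2) idx(2)] by (simp_all add: algebra_simps)
  have EK: "rE i * rKi i = rs q * (rs q * (rKi i * rE i))" if i: "i \<in> {1..n+1}" for i
    by (simp only: K_rules(4)[OF i i, unfolded cartan_D_diag rs_powers mult.assoc]
        mult_assoc_ext[OF q_qi] mult_1_left)
  note r = F E K EF EK[OF idx(1)] EK[OF idx(2)] q_comm[of "rKi n"] q_comm[of "rKi (n+1)"] h_comm[of "rKi n"] h_comm[of "rKi (n+1)"] h_comm[of "rF n"]  h_comm[of "rF (n+1)"]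
  show ?thesis
    unfolding rB_eq[OF idx(1)] rB_eq[OF idx(2)] kap_def kapi_def
    by (simp add: flip_def algebra_simps r[simplified] r[THEN mult_assoc_ext, simplified])
qed

lemma kap_kapi: "kap * kapi = 1" "kapi * kap = 1"
proof -
  have idx: "n \<in> {1..n+1}" "n + 1 \<in> {1..n+1}" using n_ge by auto
  note K = Uq_relations(1,2)[OF idx] Uq_relations(1,2)[OF idx(2,1)]
  have "kap * kapi = rK n * (rKi (n+1) * rKi n) * rK (n+1)" by (simp add: kap_def kapi_def mult.assoc)
  also have "\<dots> = 1" by (simp only: K_rules(5)[OF idx(2,1)] mult.assoc K mult_1_right)
  finally show "kap * kapi = 1" .
  have "kapi * kap = rKi n * (rK (n+1) * rK n) * rKi (n+1)" by (simp add: kap_def kapi_def mult.assoc)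
  also have "\<dots> = 1" by (simp only: Uq_relations(3)[OF idx(2,1)] mult.assoc K mult_1_right)
  finally show "kapi * kap = 1" .
qed

sublocale U: kolb_tuple rs n q rB kap kapi
proof
  fix i j assume ij: "i \<in> {1..n+1}" "j \<in> {1..n+1}" "cartan_D n i j = -1"
  show "rB i * rB i * rB j - (rs q + rs (inverse q)) * (rB i * rB j * rB i) + rB j * rB i * rB i
      = (if i \<le> n - 1 then - (rs (inverse q) * rB j) else 0)"
  proof (cases "i \<le> n - 1")
    case True
    then show ?thesis using serre_first[of i j] ij by auto
  next
    case False
    then have i: "i = n \<or> i = n + 1" using ij(1) unfolding atLeastAtMost_iff by linarith
    then have "j = n - 1" "i \<in> {n, n+1}"
      using cartan_D_end(1,2)[OF n_ge, of j] ij(3) by auto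
    then show ?thesis using serre_second[of i] False by auto
  qed
qed (assumption | rule kap_kapi rB_zero kap_B rB_commute rB_n_commutator)+

end

section \<open>The coideal subalgebra is presented by its relations\<close>

context kolb_tuple
begin

definition kp :: "int \<Rightarrow> 'r" where
  "kp m = (if m \<ge> 0 then k ^ nat m else ki ^ nat (- m))"

lemma k_kp: "k * kp m = kp (m + 1)"
proof (cases "m \<ge> 0")
  case True
  then have "nat (m + 1) = Suc (nat m)" by simp
  then show ?thesis using True by (simp add: kp_def)
next
  case False
  then have "nat (- m) = Suc (nat (- (m + 1)))" by simp
  then have "k * kp m = ki ^ nat (- (m + 1))"
    using False by (simp add: kp_def mult.assoc[symmetric] k_ki)
  then show ?thesis using False by (auto simp: kp_def)
qed

lemma ki_kp: "ki * kp m = kp (m - 1)"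
  using k_kp[of "m - 1"] by (metis diff_add_cancel ki_k mult.assoc mult_1_left)

lemma k_word: "k * eval_word B (Word l) = sc (q powi (\<Sum>j\<leftarrow>l. B_weight n j)) * (eval_word B (Word l) * k)"
  if "q \<noteq> 0"
proof (induction l)
  case (Cons j l)
  have "k * eval_word B (Word (j # l)) = (k * B j) * eval_word B (Word l)"
    by (simp add: eval_word_Cons mult.assoc)
  also have "\<dots> = sc (q powi B_weight n j) * (B j * (k * eval_word B (Word l)))"
    by (simp add: k_B mult.assoc)
  also have "\<dots> = sc (q powi (\<Sum>j\<leftarrow>(j # l). B_weight n j)) * (eval_word B (Word (j # l)) * k)"
    using that by (simp add: Cons sc_left_commute[of "B j"] power_int_add sc_mult mult.assoc eval_word_Cons)
  finally show ?case .
qed simp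

lemma ki_word: "ki * eval_word B (Word l) = sc (q powi - (\<Sum>j\<leftarrow>l. B_weight n j)) * (eval_word B (Word l) * ki)"
  if q: "q \<noteq> 0"
proof -
  let ?s = "q powi (\<Sum>j\<leftarrow>l. B_weight n j)" and ?w = "eval_word B (Word l)"
  have "?w * ki = ki * (k * ?w) * ki" by (simp add: mult.assoc[symmetric] ki_k)
  also have "\<dots> = sc ?s * (ki * (?w * (k * ki)))"
    by (simp only: k_word[OF q] sc_left_commute[of ki] mult.assoc)
  finally have "?w * ki = sc ?s * (ki * ?w)" by (simp add: k_ki)
  then have "sc (inverse ?s) * (?w * ki) = sc (inverse ?s * ?s) * (ki * ?w)"
    by (simp add: sc_mult mult.assoc)
  then show ?thesis using q by (simp add: power_int_minus)
qed

end

text \<open>Elimination instead of a determinant: subtracting f(m0) times the sum for s from the sum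
  for s + 1 removes the term of m0 and multiplies every other one by the nonzero scalar f(m) -
  f(m0).\<close>

lemma subspace_vandermonde:
  fixes g :: "int \<Rightarrow> 'a word \<Rightarrow>\<^sub>0 'k::field"
  assumes "finite M" "inj_on f M"
    and add: "\<And>u v. u \<in> V \<Longrightarrow> v \<in> V \<Longrightarrow> u + v \<in> V" and scale: "\<And>c u. u \<in> V \<Longrightarrow> scalar c * u \<in> V"
    and "\<And>s. (\<Sum>m\<in>M. scalar (f m ^ s) * g m) \<in> V"
  shows "\<forall>m\<in>M. g m \<in> V"
  using assms(1,2,5)
proof (induction M arbitrary: g rule: finite_induct)
  case (insert m0 M)
  have diff: "u - v \<in> V" if "u \<in> V" "v \<in> V" for u v
    using add[OF that(1) scale[OF that(2), of "- 1"]] by (simp add: scalar.sc_minus)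
  have sum: "(\<Sum>t\<in>S. u t) \<in> V" if "finite S" "\<And>t. t \<in> S \<Longrightarrow> u t \<in> V" "S \<noteq> {}" for S :: "int set" and u
    using that(1,3,2) by (induction S rule: finite_ne_induct) (auto intro: add)
  have "scalar (f m ^ s) * (scalar (f m - f m0) * g m)
      = scalar (f m ^ Suc s) * g m - scalar (f m0) * (scalar (f m ^ s) * g m)" for m s
  proof -
    have "f m ^ s * (f m - f m0) = f m ^ Suc s - f m0 * f m ^ s" by (simp add: algebra_simps)
    then have "scalar (f m ^ s * (f m - f m0)) * g m = scalar (f m ^ Suc s - f m0 * f m ^ s) * g m" by simp
    then show ?thesis by (simp only: scalar.sc_diff scalar.sc_mult left_diff_distrib mult.assoc)
  qed
  then have eq: "(\<Sum>m\<in>M. scalar (f m ^ s) * (scalar (f m - f m0) * g m))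
      = (\<Sum>m\<in>insert m0 M. scalar (f m ^ Suc s) * g m)
        - scalar (f m0) * (\<Sum>m\<in>insert m0 M. scalar (f m ^ s) * g m)" for s
    using insert(1,2)
    by (simp add: sum_subtractf sum_distrib_left[symmetric] distrib_left scalar.sc_mult mult.assoc)
  have "(\<Sum>m\<in>M. scalar (f m ^ s) * (scalar (f m - f m0) * g m)) \<in> V" for s
    unfolding eq by (intro diff scale insert.prems(2))
  then have IH: "\<forall>m\<in>M. scalar (f m - f m0) * g m \<in> V"
    using insert.IH[of "\<lambda>m. scalar (f m - f m0) * g m"] insert.prems(1) by auto
  have M: "g m \<in> V" if "m \<in> M" for m
  proof -
    have "f m - f m0 \<noteq> 0" using insert.prems(1) insert.hyps(2) that by (auto simp: inj_on_def)
    then have "scalar (inverse (f m - f m0)) * (scalar (f m - f m0) * g m) = g m"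
      by (simp only: scalar.sc_mult[symmetric] mult.assoc[symmetric] left_inverse[OF \<open>f m - f m0 \<noteq> 0\<close>]
          scalar.sc_one mult_1_left)
    then show ?thesis using scale[OF IH[rule_format, OF that], of "inverse (f m - f m0)"] by simp
  qed
  have "(\<Sum>m\<in>insert m0 M. scalar (f m ^ 0) * g m) \<in> V" by (rule insert.prems(2))
  then have tot: "g m0 + (\<Sum>m\<in>M. g m) \<in> V" using insert(1,2) by simp
  have "g m0 \<in> V"
  proof (cases "M = {}")
    case False
    then have "(\<Sum>m\<in>M. g m) \<in> V" using insert(1) M by (intro sum) auto
    from diff[OF tot this] show ?thesis by simp
  qed (use tot in simp)
  then show ?case using M by auto
qed simp

section \<open>Word length and leading terms\<close>

definition low_degree :: "nat \<Rightarrow> (nat word \<Rightarrow>\<^sub>0 'k::field) \<Rightarrow> bool" where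
  "low_degree d p \<longleftrightarrow> (\<forall>w\<in>Poly_Mapping.keys p. length (letters w) < d)"

lemma low_degree_zero [simp]: "low_degree d 0"
  by (simp add: low_degree_def)

lemma low_degree_add: "low_degree d p \<Longrightarrow> low_degree d r \<Longrightarrow> low_degree d (p + r)"
  using Poly_Mapping.keys_add[of p r] by (auto simp: low_degree_def)

lemma low_degree_diff: "low_degree d p \<Longrightarrow> low_degree d r \<Longrightarrow> low_degree d (p - r)"
  using low_degree_add[of d p "- r"] by (simp add: low_degree_def)

lemma low_degree_scale: "low_degree d p \<Longrightarrow> low_degree d (scalar c * p)"
  by (auto simp: low_degree_def in_keys_iff lookup_scalar_mult)

lemma low_degree_mono: "low_degree d p \<Longrightarrow> d \<le> d' \<Longrightarrow> low_degree d' p"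
  by (auto simp: low_degree_def)

lemma low_degree_monomial: "length l < d \<Longrightarrow> low_degree d (monomial l)"
  by (simp add: low_degree_def)

lemma app_sum: "app f (sum g S) = (\<Sum>s\<in>S. app f (g s))"
  by (induction S rule: infinite_finite_induct) (simp_all add: app_add)

lemma app_expand: "app f p = (\<Sum>w\<in>Poly_Mapping.keys p. scalar (Poly_Mapping.lookup p w) * app f (monomial (letters w)))"
proof -
  have "scalar c * monomial (letters w) = Poly_Mapping.single w c" for c :: 'a and w :: "nat word"
    by (simp add: scalar_def mult_single)
  then have *: "app f (Poly_Mapping.single w c) = scalar c * app f (monomial (letters w))" for w c
    by (metis app_scale)
  have "app f p = app f (\<Sum>w\<in>Poly_Mapping.keys p. Poly_Mapping.single w (Poly_Mapping.lookup p w))"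
    by (simp only: poly_mapping_sum_singles)
  also have "\<dots> = (\<Sum>w\<in>Poly_Mapping.keys p. scalar (Poly_Mapping.lookup p w) * app f (monomial (letters w)))"
    unfolding app_sum by (intro sum.cong refl *)
  finally show ?thesis .
qed

lemma low_degree_sum: "(\<And>s. s \<in> S \<Longrightarrow> low_degree d (u s)) \<Longrightarrow> low_degree d (sum u S)"
  by (induction S rule: infinite_finite_induct) (auto intro: low_degree_add)

lemma low_degree_app:
  assumes "\<And>l. length l < d \<Longrightarrow> low_degree d' (app f (monomial l))" "low_degree d p"
  shows "low_degree d' (app f p)"
  unfolding app_expand[of f p]
  by (intro low_degree_sum low_degree_scale assms(1)) (use assms(2) in \<open>simp only: low_degree_def\<close>)

definition proj :: "nat \<Rightarrow> 'k::field lin_op" where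
  "proj d = lin_ext (\<lambda>l. if length l = d then monomial l else 0)"

lemma proj_monomial: "app (proj d) (monomial l) = (if length l = d then monomial l else 0)"
  by (simp add: proj_def)

lemma proj_low_degree:
  assumes "low_degree d p"
  shows "app (proj d) p = 0"
proof -
  have "low_degree 0 (app (proj d) p)"
    using assms by (rule low_degree_app[rotated]) (simp add: proj_monomial)
  then show ?thesis by (auto simp: low_degree_def)
qed

context verma
begin

lemma low_degree_skew: "low_degree (length l) (skew i l)"
proof (induction l)
  case (Cons j l)
  have "low_degree (Suc (length l)) (app (F j) (skew i l))"
    using Cons by (rule low_degree_app[rotated]) (simp add: app_F_monomial low_degree_monomial)
  then show ?case
    by (auto simp: F_def app_lmul intro!: low_degree_add low_degree_scale low_degree_monomial)
qed simp

lemma low_degree_ops: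
  assumes "low_degree d p"
  shows "low_degree (Suc d) (app (F i) p)" "low_degree d (app (Ki i) p)" "low_degree d (app (E i) p)"
  by (rule low_degree_app[OF _ assms],
      auto simp: app_F_monomial intro: low_degree_monomial low_degree_scale low_degree_mono[OF low_degree_skew])+

text \<open>Word length of a Serre polynomial. The value 3 is also given where
  \<open>serre_poly\<close> is 0, so it does no harm there.\<close>

definition serre_length :: "nat \<Rightarrow> nat \<Rightarrow> nat" where
  "serre_length i j = (if a i j = 0 then 2 else 3)"

inductive_set serre_homogeneous :: "nat set \<Rightarrow> nat \<Rightarrow> (nat word \<Rightarrow>\<^sub>0 'k) set" for I d where
  zero: "0 \<in> serre_homogeneous I d"
| add: "p \<in> serre_homogeneous I d \<Longrightarrow> r \<in> serre_homogeneous I d \<Longrightarrow> p + r \<in> serre_homogeneous I d"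
| gen: "i \<in> I \<Longrightarrow> j \<in> I \<Longrightarrow> length u + serre_length i j + length v = d \<Longrightarrow>
    scalar c * (monomial u * serre_poly i j * monomial v) \<in> serre_homogeneous I d"

lemma serre_homogeneous_scale: "p \<in> serre_homogeneous I d \<Longrightarrow> scalar c * p \<in> serre_homogeneous I d"
  by (induction rule: serre_homogeneous.induct)
    (auto simp: distrib_left scalar_scalar intro: serre_homogeneous.intros)

lemma proj_serre:
  "app (proj d) (monomial u * serre_poly i j * monomial v)
    = (if length u + serre_length i j + length v = d then monomial u * serre_poly i j * monomial v else 0)"
proof -
  consider "a i j = 0" | "a i j = -1" | "a i j \<noteq> 0" "a i j \<noteq> -1" by blast
  then show ?thesis
  proof cases
    case 1
    then have "serre_poly i j = monomial [i, j] - monomial [j, i]"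
      by (simp add: serre_poly_def qserre_def monomial_Cons monomial_Nil)
    then have "monomial u * serre_poly i j * monomial v = monomial (u @ [i, j] @ v) - monomial (u @ [j, i] @ v)"
      by (simp only: monomial_append right_diff_distrib left_diff_distrib mult.assoc)
    then show ?thesis using 1 by (simp only: app_diff proj_monomial serre_length_def) simp
  next
    case 2
    then have "serre_poly i j = monomial [i, i, j] - scalar (q + inverse q) * monomial [i, j, i] + monomial [j, i, i]"
      by (simp add: serre_poly_def qserre_def monomial_Cons monomial_Nil mult.assoc scalar.sc_add)
    then have "monomial u * serre_poly i j * monomial v
      = monomial (u @ [i, i, j] @ v) - scalar (q + inverse q) * monomial (u @ [i, j, i] @ v) + monomial (u @ [j, i, i] @ v)"
      by (simp only: monomial_append right_diff_distrib left_diff_distrib distrib_left distrib_right mult.assoc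
          scalar.sc_left_commute[of "monomial u"])
    then show ?thesis using 2 by (simp only: app_add app_diff app_scale proj_monomial serre_length_def) simp
  qed (simp add: serre_poly_def qserre_def)
qed

lemma proj_serre_ideal: "p \<in> serre_ideal I \<Longrightarrow> app (proj d) p \<in> serre_homogeneous I d"
  by (induction rule: serre_ideal.induct)
    (auto simp: app_add app_scale proj_serre intro: serre_homogeneous.intros)

end

context uq_generic
begin

text \<open>The highest weight is q^s at n and trivial elsewhere, so that K_nK_(n+1)^{-1} acts on
  the highest weight vector by q^s; the parameter s feeds the Vandermonde argument.\<close>

sublocale W: verma q "cartan_D n" "\<lambda>i. if i = n then q ^ s else 1" for s :: nat
  using q_nonzero q_generic by unfold_locales (auto simp: cartan_D_sym)

abbreviation "rho s \<equiv> op_scalar.ev (W.rep s)"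

abbreviation "J \<equiv> W.serre_ideal {1..n+1}"

text \<open>Every relation except a Serre relation of the F_i vanishes as an operator, and those
  relations act as left multiplication by a Serre polynomial, hence map into \<open>J\<close>.
  Stability of \<open>J\<close> extends this to the generated ideal. The set \<open>J\<close> is the
  same for all s.\<close>

lemma rho_Uq_ideal:
  assumes "p \<in> Uq_ideal"
  shows "app (rho s p) r \<in> J"
proof -
  have *: "\<forall>r. app (rho s p) r \<in> J"
    using assms Uq_rels_closed unfolding Uq_ideal_def
  proof (induction rule: genideal_free_algebra_induct)
    case (gen p)
    have E0: "W.E s i * W.E s j - W.E s j * W.E s i = 0" if "cartan_D n i j = 0" for i j
      using W.serre_E[of s i j] that by (simp add: W.qserre_def)
    have E1: "W.E s i * W.E s i * W.E s j - op_scalar (q + inverse q) * W.E s i * W.E s j * W.E s i + W.E s j * W.E s i * W.E s i = 0"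
      if "cartan_D n i j = -1" for i j
      using W.serre_E[of s i j] that by (simp add: W.qserre_def op_scalar.sc_add mult.assoc)
    have F0: "W.F i * W.F j - W.F j * W.F i = lmul (W.serre_poly i j)" if "cartan_D n i j = 0" for i j
      using W.lmul_serre[of i j] that by (simp add: W.qserre_def)
    have F1: "W.F i * W.F i * W.F j - op_scalar (q + inverse q) * W.F i * W.F j * W.F i + W.F j * W.F i * W.F i
        = lmul (W.serre_poly i j)" if "cartan_D n i j = -1" for i j
      using W.lmul_serre[of i j] that by (simp add: W.qserre_def op_scalar.sc_add mult.assoc)
    have K: "W.K s i * W.E s j * W.Ki s i = op_scalar (q powi cartan_D n i j) * W.E s j"
      "W.K s i * W.F j * W.Ki s i = op_scalar (q powi (- cartan_D n i j)) * W.F j" for i j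
      by (simp_all only: W.K_E W.K_F mult.assoc W.K_Ki mult_1_right)
    have S: "app (lmul (W.serre_poly i j)) r \<in> J" if "i \<in> {1..n+1}" "j \<in> {1..n+1}" for i j r
      using W.serre_ideal_right[OF that, of "[]" r] by (simp add: app_lmul monomial_Nil)
    from gen have "rho s p = 0 \<or> (\<exists>i\<in>{1..n+1}. \<exists>j\<in>{1..n+1}. rho s p = lmul (W.serre_poly i j))"
      unfolding Uq_rels_def Let_def
    proof (elim UnE)
      assume "p \<in> {letter (GE i) * letter (GF j) - letter (GF j) * letter (GE i)
          - (if i = j then scalar (inverse (q - inverse q)) * (letter (GK i) - letter (GKi i)) else 0) |
          i j. i \<in> {1..n+1} \<and> j \<in> {1..n+1}}"
      then obtain i j where p: "p = letter (GE i) * letter (GF j) - letter (GF j) * letter (GE i)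
          - (if i = j then scalar (inverse (q - inverse q)) * (letter (GK i) - letter (GKi i)) else 0)"
        by blast
      have "rho s p = W.E s i * W.F j - W.F j * W.E s i
          - (if i = j then op_scalar (inverse (q - inverse q)) * (W.K s i - W.Ki s i) else 0)"
        by (simp only: p op_scalar.ev_simps op_scalar.ev_letter W.rep.simps op_scalar.ev_scalar
            op_scalar.ev_zero if_distrib[of "rho s"])
      then show ?thesis by (simp only: W.E_F diff_self simp_thms)
    next
      assume "p \<in> {Z i * Z j - Z j * Z i |Z i j. Z \<in> {\<lambda>i. letter (GE i), \<lambda>i. letter (GF i)} \<and>
          i \<in> {1..n+1} \<and> j \<in> {1..n+1} \<and> cartan_D n i j = 0}"
      then obtain Z i j where Z: "Z \<in> {\<lambda>i. letter (GE i), \<lambda>i. letter (GF i)}"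
        and p: "p = Z i * Z j - Z j * Z i" and ij: "i \<in> {1..n+1}" "j \<in> {1..n+1}" "cartan_D n i j = 0"
        by blast
      show ?thesis
      proof (cases "Z = (\<lambda>i. letter (GE i))")
        case True
        then show ?thesis using E0[OF ij(3)] by (simp add: p op_scalar.ev_simps)
      next
        case False
        then have "Z = (\<lambda>i. letter (GF i))" using Z by blast
        then have "rho s p = lmul (W.serre_poly i j)" using F0[OF ij(3)] by (simp add: p op_scalar.ev_simps)
        then show ?thesis using ij by blast
      qed
    next
      assume "p \<in> {Z i * Z i * Z j - scalar (q + inverse q) * Z i * Z j * Z i + Z j * Z i * Z i |Z i j.
          Z \<in> {\<lambda>i. letter (GE i), \<lambda>i. letter (GF i)} \<and>
          i \<in> {1..n+1} \<and> j \<in> {1..n+1} \<and> cartan_D n i j = - 1}"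
      then obtain Z i j where Z: "Z \<in> {\<lambda>i. letter (GE i), \<lambda>i. letter (GF i)}"
        and p: "p = Z i * Z i * Z j - scalar (q + inverse q) * Z i * Z j * Z i + Z j * Z i * Z i"
        and ij: "i \<in> {1..n+1}" "j \<in> {1..n+1}" "cartan_D n i j = - 1"
        by blast
      show ?thesis
      proof (cases "Z = (\<lambda>i. letter (GE i))")
        case True
        then show ?thesis using E1[OF ij(3)] by (simp add: p op_scalar.ev_simps)
      next
        case False
        then have "Z = (\<lambda>i. letter (GF i))" using Z by blast
        then have "rho s p = lmul (W.serre_poly i j)" using F1[OF ij(3)] by (simp add: p op_scalar.ev_simps)
        then show ?thesis using ij by blast
      qed
    next
      assume "p \<in> {letter (GK i) * letter (GKi i) - 1 |i. i \<in> {1..n+1}}"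
      then obtain i where "p = letter (GK i) * letter (GKi i) - 1" by blast
      then show ?thesis by (simp add: op_scalar.ev_simps W.K_Ki)
    next
      assume "p \<in> {letter (GKi i) * letter (GK i) - 1 |i. i \<in> {1..n+1}}"
      then obtain i where "p = letter (GKi i) * letter (GK i) - 1" by blast
      then show ?thesis by (simp add: op_scalar.ev_simps W.Ki_K)
    next
      assume "p \<in> {letter (GK i) * letter (GK j) - letter (GK j) * letter (GK i) |i j.
          i \<in> {1..n+1} \<and> j \<in> {1..n+1}}"
      then obtain i j where "p = letter (GK i) * letter (GK j) - letter (GK j) * letter (GK i)" by blast
      then show ?thesis using W.K_K[of s i j] by (simp add: op_scalar.ev_simps)
    next
      assume "p \<in> {letter (GK i) * letter (GE j) * letter (GKi i) - scalar (q powi cartan_D n i j) * letter (GE j) |i j.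
          i \<in> {1..n+1} \<and> j \<in> {1..n+1}}"
      then obtain i j where "p = letter (GK i) * letter (GE j) * letter (GKi i) - scalar (q powi cartan_D n i j) * letter (GE j)" by blast
      then show ?thesis using K(1)[of i j] by (simp add: op_scalar.ev_simps)
    next
      assume "p \<in> {letter (GK i) * letter (GF j) * letter (GKi i) - scalar (q powi - cartan_D n i j) * letter (GF j) |i j.
          i \<in> {1..n+1} \<and> j \<in> {1..n+1}}"
      then obtain i j where "p = letter (GK i) * letter (GF j) * letter (GKi i) - scalar (q powi - cartan_D n i j) * letter (GF j)" by blast
      then show ?thesis using K(2)[of i j] by (simp add: op_scalar.ev_simps)
    qed
    then show ?case using S by (auto simp: app_simps intro: W.serre_ideal.zero)
  qed (auto simp: op_scalar.ev_simps app_simps app_zero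
      intro: W.serre_ideal.zero W.serre_ideal.add W.serre_ideal_uminus W.rep_preserves_serre_ideal)
  then show ?thesis by blast
qed

end

lemma app_sum_op: "app (sum u S) p = (\<Sum>t\<in>S. app (u t) p)"
  by (induction S rule: infinite_finite_induct) (simp_all add: app_simps)

datatype kgen = KB nat | KK | KKi

context kolb_tuple
begin

fun kval :: "kgen \<Rightarrow> 'r" where
  "kval (KB j) = B j" | "kval KK = k" | "kval KKi = ki"

lemma kp_zero [simp]: "kp 0 = 1"
  by (simp add: kp_def)

lemma k_normal_form:
  assumes "q \<noteq> 0"
  shows "k * (sc c * (eval_word B (Word l) * kp m))
    = sc (c * q powi (\<Sum>j\<leftarrow>l. B_weight n j)) * (eval_word B (Word l) * kp (m + 1))"
proof -
  have "k * (sc c * (eval_word B (Word l) * kp m)) = sc c * ((k * eval_word B (Word l)) * kp m)"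
    by (simp only: sc_left_commute[of k] mult.assoc)
  then show ?thesis by (simp only: k_word[OF assms] sc_mult mult.assoc k_kp)
qed

lemma ki_normal_form:
  assumes "q \<noteq> 0"
  shows "ki * (sc c * (eval_word B (Word l) * kp m))
    = sc (c * q powi - (\<Sum>j\<leftarrow>l. B_weight n j)) * (eval_word B (Word l) * kp (m - 1))"
proof -
  have "ki * (sc c * (eval_word B (Word l) * kp m)) = sc c * ((ki * eval_word B (Word l)) * kp m)"
    by (simp only: sc_left_commute[of ki] mult.assoc)
  then show ?thesis by (simp only: ki_word[OF assms] sc_mult mult.assoc ki_kp)
qed

end

context uq_generic
begin

text \<open>The generators of the coideal subalgebra are lifted to the free algebra, because the
  action \<open>rho\<close> is defined on polynomials and not on residues.\<close>

definition Bpoly :: "nat \<Rightarrow> uq_gen word \<Rightarrow>\<^sub>0 'k" where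
  "Bpoly j = (if j \<in> {1..n+1} then letter (GF j) - letter (GKi j) * letter (GE (flip n j)) else 0)"
definition kpoly :: "uq_gen word \<Rightarrow>\<^sub>0 'k" where
  "kpoly = letter (GK n) * letter (GKi (n+1))"
definition kipoly :: "uq_gen word \<Rightarrow>\<^sub>0 'k" where
  "kipoly = letter (GKi n) * letter (GK (n+1))"
definition kppoly :: "int \<Rightarrow> uq_gen word \<Rightarrow>\<^sub>0 'k" where
  "kppoly m = (if m \<ge> 0 then kpoly ^ nat m else kipoly ^ nat (- m))"

abbreviation Uq_free :: "(uq_gen word \<Rightarrow>\<^sub>0 'k) set" where
  "Uq_free \<equiv> carrier (free_algebra (Uq_gens n))"

lemma emb_Bpoly: "emb (Bpoly j) = rB j"
  by (simp only: Bpoly_def rB_def rE_def rF_def rKi_def emb_simps if_distrib[of emb])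

lemma emb_kpoly: "emb kpoly = kap" "emb kipoly = kapi"
  by (simp_all add: kpoly_def kipoly_def kap_def kapi_def rK_def rKi_def emb_simps)

lemma emb_power: "emb (p ^ m) = emb p ^ m"
  by (induction m) (simp_all add: emb_simps)

lemma emb_kppoly: "emb (kppoly m) = U.kp m"
  by (simp add: kppoly_def U.kp_def emb_power emb_kpoly)

lemma emb_eval_word: "emb (scalar.eval_word Bpoly w) = residue_scalar.eval_word rB w"
proof -
  have "emb (scalar.eval_word Bpoly (Word l)) = residue_scalar.eval_word rB (Word l)" for l
    by (induction l) (simp_all add: scalar.eval_word_Cons residue_scalar.eval_word_Cons emb_simps emb_Bpoly)
  then show ?thesis by (metis word.exhaust)
qed

lemma gens_closed:
  assumes "j \<in> {1..n+1}"
  shows "letter (GE j) \<in> Uq_free" "letter (GF j) \<in> Uq_free" "letter (GK j) \<in> Uq_free" "letter (GKi j) \<in> Uq_free"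
  using assms by (auto intro!: letter_closed simp: Uq_gens_def)

lemma polys_closed: "Bpoly j \<in> Uq_free" "kpoly \<in> Uq_free" "kipoly \<in> Uq_free" "kppoly m \<in> Uq_free"
proof -
  have idx: "n \<in> {1..n+1}" "n + 1 \<in> {1..n+1}" using n_ge by auto
  show "Bpoly j \<in> Uq_free"
  proof (cases "j \<in> {1..n+1}")
    case True
    show ?thesis
      unfolding Bpoly_def if_P[OF True]
      by (intro free_algebra_diff_closed free_algebra_mult_closed gens_closed flip_closed True)
  next
    case False
    show ?thesis unfolding Bpoly_def if_not_P[OF False] by (rule zero_closed_free_algebra)
  qed
  show k: "kpoly \<in> Uq_free" "kipoly \<in> Uq_free"
    unfolding kpoly_def kipoly_def by (intro free_algebra_mult_closed gens_closed idx)+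
  have "p ^ m \<in> Uq_free" if "p \<in> Uq_free" for p :: "uq_gen word \<Rightarrow>\<^sub>0 'k" and m
    using that by (induction m) (auto intro: free_algebra_mult_closed one_closed_free_algebra)
  then show "kppoly m \<in> Uq_free" using k by (simp add: kppoly_def)
qed

lemma eval_word_closed: "scalar.eval_word Bpoly (Word l) \<in> Uq_free"
  by (induction l) (simp_all add: scalar.eval_word_Cons free_algebra_mult_closed polys_closed one_closed_free_algebra)

lemma sum_closed: "(\<And>t. t \<in> S \<Longrightarrow> u t \<in> Uq_free) \<Longrightarrow> sum u S \<in> Uq_free"
  by (induction S rule: infinite_finite_induct) (auto intro: free_algebra_add_closed zero_closed_free_algebra)

lemma emb_sum: "emb (sum u S) = (\<Sum>t\<in>S. emb (u t))"
  by (induction S rule: infinite_finite_induct) (simp_all add: emb_simps)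

lemma rho_kppoly: "app (rho s (kppoly m)) 1 = scalar ((q powi m) ^ s) * 1"
proof -
  have K: "app (W.K s n) 1 = scalar (q ^ s) * 1" "app (W.Ki s n) 1 = scalar (inverse (q ^ s)) * 1"
    "app (W.K s (n+1)) 1 = 1" "app (W.Ki s (n+1)) 1 = 1"
    using W.app_monomial(1,2)[of s _ "[]"] by (simp_all add: monomial_Nil W.weight_def)
  have k: "app (rho s kpoly) 1 = scalar (q ^ s) * 1" "app (rho s kipoly) 1 = scalar (inverse (q ^ s)) * 1"
    using K by (simp_all add: kpoly_def kipoly_def op_scalar.ev_mult app_simps)
  have "app (rho s (p ^ m)) 1 = scalar (c ^ m) * 1" if "app (rho s p) 1 = scalar c * 1" for p c m
  proof (induction m)
    case (Suc m)
    have "app (rho s (p ^ Suc m)) 1 = app (rho s p) (scalar (c ^ m) * 1)"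
      by (simp only: power_Suc op_scalar.ev_mult times_lin_op.rep_eq Suc)
    then show ?case by (simp only: app_scale that scalar.sc_mult[symmetric] mult.assoc[symmetric] power_Suc2)
  qed (simp add: app_simps)
  from this[OF k(1)] this[OF k(2)]
  have *: "app (rho s (kpoly ^ j)) 1 = scalar ((q ^ s) ^ j) * 1" "app (rho s (kipoly ^ j)) 1 = scalar (inverse (q ^ s) ^ j) * 1" for j
    by blast+
  show ?thesis
  proof (cases "m \<ge> 0")
    case True
    then have "(q powi m) ^ s = (q ^ s) ^ nat m"
      by (simp add: power_int_def power_mult[symmetric] mult.commute)
    then show ?thesis using True by (simp only: kppoly_def if_True *)
  next
    case False
    then have "(q powi m) ^ s = inverse (q ^ s) ^ nat (- m)"
      by (simp add: power_int_def power_mult[symmetric] mult.commute power_inverse)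
    then show ?thesis using False by (simp only: kppoly_def if_False *)
  qed
qed

text \<open>B_j is F_j minus a term that lowers the degree, so on the highest weight vector a word
  in the B_j has the same word in the F_j as its leading term.\<close>

lemma rho_word:
  assumes "set l \<subseteq> {1..n+1}"
  shows "low_degree (length l) (app (rho s (scalar.eval_word Bpoly (Word l))) 1 - monomial l)"
  using assms
proof (induction l)
  case Nil
  then show ?case by (simp add: app_simps monomial_Nil)
next
  case (Cons j l)
  let ?w = "app (rho s (scalar.eval_word Bpoly (Word l))) 1"
  have low: "low_degree (length l) (?w - monomial l)" using Cons by simp
  have "rho s (Bpoly j) = W.F j - W.Ki s j * W.E s (flip n j)"
    using Cons.prems by (simp add: Bpoly_def op_scalar.ev_simps)
  then have "app (rho s (scalar.eval_word Bpoly (Word (j # l)))) 1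
      = app (W.F j) ?w - app (W.Ki s j) (app (W.E s (flip n j)) ?w)"
    by (simp add: scalar.eval_word_Cons op_scalar.ev_mult app_simps)
  then have "app (rho s (scalar.eval_word Bpoly (Word (j # l)))) 1 - monomial (j # l)
      = app (W.F j) (?w - monomial l) - app (W.Ki s j) (app (W.E s (flip n j)) ?w)"
    by (simp add: app_diff W.app_F_monomial)
  moreover have "low_degree (Suc (length l)) ?w"
    using low_degree_add[OF low_degree_mono[OF low, of "Suc (length l)"] low_degree_monomial[of l "Suc (length l)"]]
    by simp
  ultimately show ?case
    using W.low_degree_ops(1)[OF low, of j] by (auto intro!: low_degree_diff W.low_degree_ops(2,3))
qed

end

section \<open>Transfer of relations to another tuple\<close>

locale uq_target = uq_generic n q + V: kolb_tuple sc n q B k ki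
  for n and q :: "'k::field" and sc :: "'k \<Rightarrow> 'r::ring_1" and B k ki
begin

text \<open>\<open>filt d x y\<close>: the elements \<open>x\<close> of the coideal subalgebra and \<open>y\<close> of the target ring are the values of one and
  the same combination of products (word of length \<open>< d\<close> in the \<open>B\<^sub>j\<close>) \<open>\<cdot>\<close> (power of \<open>K\<^sub>nK\<^bsub>n+1\<^esub>\<^sup>-\<^sup>1\<close>).\<close>

inductive filt :: "nat \<Rightarrow> (uq_gen word \<Rightarrow>\<^sub>0 'k) residues \<Rightarrow> 'r \<Rightarrow> bool" for d where
  zero: "filt d 0 0"
| add: "filt d x y \<Longrightarrow> filt d x' y' \<Longrightarrow> filt d (x + x') (y + y')"
| gen: "set l \<subseteq> {1..n+1} \<Longrightarrow> length l < d \<Longrightarrow>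
    filt d (rs c * (residue_scalar.eval_word rB (Word l) * U.kp m)) (sc c * (V.eval_word B (Word l) * V.kp m))"

lemma filt_scale: "filt d x y \<Longrightarrow> filt d (rs c * x) (sc c * y)"
proof (induction rule: filt.induct)
  case (gen l c' m)
  then show ?case
    using filt.gen[of l d "c * c'" m] by (simp only: residue_scalar.sc_mult V.sc_mult mult.assoc)
qed (auto simp: distrib_left intro: filt.intros)

lemma filt_diff: "filt d x y \<Longrightarrow> filt d x' y' \<Longrightarrow> filt d (x - x') (y - y')"
  using filt.add[OF _ filt_scale[of d x' y' "- 1"]] by (simp add: residue_scalar.sc_minus V.sc_minus)

lemma filt_sum: "(\<And>t. t \<in> S \<Longrightarrow> filt d (u t) (u' t)) \<Longrightarrow> filt d (sum u S) (sum u' S)"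
  by (induction S rule: infinite_finite_induct) (auto intro: filt.intros)

lemma filt_mono: "filt d x y \<Longrightarrow> d \<le> d' \<Longrightarrow> filt d' x y"
proof (induction rule: filt.induct)
  case (gen l c m)
  show ?case by (rule filt.gen[OF gen(1) less_le_trans[OF gen(2,3)]])
qed (auto intro: filt.zero filt.add)

lemma filt_B: "filt d x y \<Longrightarrow> filt (Suc d) (rB j * x) (B j * y)"
proof (induction rule: filt.induct)
  case (gen l c m)
  show ?case
  proof (cases "j \<in> {1..n+1}")
    case True
    then show ?thesis
      using filt.gen[of "j # l" "Suc d" c m] gen
      by (simp add: residue_scalar.eval_word_Cons V.eval_word_Cons mult.assoc residue_scalar.sc_left_commute[of "rB j"] V.sc_left_commute[of "B j"])
  next
    case False
    show ?thesis by (simp only: rB_zero[OF False] V.B_outside[OF False] mult_zero_left filt.zero)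
  qed
qed (auto simp: distrib_left intro: filt.intros)

lemma filt_k: "filt d x y \<Longrightarrow> filt d (kap * x) (k * y)"
proof (induction rule: filt.induct)
  case (gen l c m)
  show ?case
    unfolding U.k_normal_form[OF q_nonzero] V.k_normal_form[OF q_nonzero] by (rule filt.gen[OF gen])
qed (auto simp: distrib_left intro: filt.zero filt.add)

lemma filt_ki: "filt d x y \<Longrightarrow> filt d (kapi * x) (ki * y)"
proof (induction rule: filt.induct)
  case (gen l c m)
  show ?case
    unfolding U.ki_normal_form[OF q_nonzero] V.ki_normal_form[OF q_nonzero] by (rule filt.gen[OF gen])
qed (auto simp: distrib_left intro: filt.zero filt.add)

lemma filt_word: "filt d x y \<Longrightarrow> filt (length l + d) (residue_scalar.eval_word rB (Word l) * x) (V.eval_word B (Word l) * y)"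
  by (induction l) (auto simp: residue_scalar.eval_word_Cons V.eval_word_Cons mult.assoc intro: filt_B)

lemma filt_kp: "filt (Suc 0) (U.kp m) (V.kp m)"
  using filt.gen[of "[]" "Suc 0" 1 m] by simp

lemma filt_ev: "\<exists>d. filt d (residue_scalar.ev U.kval f) (V.ev V.kval f)"
proof (induction f rule: poly_mapping_linear_induct)
  case (word l)
  have "\<exists>d. filt d (residue_scalar.eval_word U.kval (Word l)) (V.eval_word V.kval (Word l))"
  proof (induction l)
    case Nil
    then show ?case using filt_kp[of 0] by auto
  next
    case (Cons g l)
    then obtain d where "filt d (residue_scalar.eval_word U.kval (Word l)) (V.eval_word V.kval (Word l))" by blast
    then show ?case
      by (cases g) (auto simp: residue_scalar.eval_word_Cons V.eval_word_Cons intro: filt_B filt_k filt_ki)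
  qed
  then show ?case by (simp add: residue_scalar.ev_single V.ev_single)
next
  case (scale c p)
  then show ?case by (auto simp: residue_scalar.ev_mult V.ev_mult intro: filt_scale)
next
  case (add p r)
  then obtain d d' where "filt d (residue_scalar.ev U.kval p) (V.ev V.kval p)"
    "filt d' (residue_scalar.ev U.kval r) (V.ev V.kval r)" by blast
  then have "filt (max d d') (residue_scalar.ev U.kval (p + r)) (V.ev V.kval (p + r))"
    unfolding residue_scalar.ev_add V.ev_add by (intro filt.add) (auto elim: filt_mono)
  then show ?case by blast
qed

text \<open>The relations have right-hand sides of lower degree, the same for both families.\<close>

lemma filt_serre:
  assumes ij: "i \<in> {1..n+1}" "j \<in> {1..n+1}" and xy: "filt (Suc e) x y"
  shows "filt (W.serre_length i j + e)
    (residue_scalar.ev rB (W.serre_poly i j) * x) (V.ev B (W.serre_poly i j) * y)"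
proof -
  \<comment> \<open>The bound gains one: \<open>x\<close> comes from words of length at most
    \<open>e\<close>, so multiplying out the Serre polynomial without its relation would only give
    \<open>W.serre_length i j + Suc e\<close>.\<close>
  let ?U = "residue_scalar.ev rB (W.serre_poly i j)" and ?V = "V.ev B (W.serre_poly i j)"
  consider "cartan_D n i j = -1" | "cartan_D n i j = 0" "i = n" "j = n + 1" | "cartan_D n i j = 0" "i = n + 1" "j = n"
    | "cartan_D n i j = 0" "{i, j} \<noteq> {n, n+1}" | "cartan_D n i j \<noteq> 0" "cartan_D n i j \<noteq> -1"
    by (metis doubleton_eq_iff)
  then show ?thesis
  proof cases
    case 1
    have "?U = (if i \<le> n - 1 then - (rs (inverse q) * rB j) else 0)"
      using U.B_serre[OF ij 1] 1 by (simp add: W.serre_poly_def W.qserre_def residue_scalar.ev_simps)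
    moreover have "?V = (if i \<le> n - 1 then - (sc (inverse q) * B j) else 0)"
      using V.B_serre[OF ij 1] 1 by (simp add: W.serre_poly_def W.qserre_def V.ev_simps)
    moreover have "filt (W.serre_length i j + e) (rB j * x) (B j * y)"
      by (rule filt_mono[OF filt_B[OF xy]]) (use 1 in \<open>simp add: W.serre_length_def\<close>)
    from filt_scale[OF this, of "- inverse q"]
    have "filt (W.serre_length i j + e) (- (rs (inverse q) * rB j) * x) (- (sc (inverse q) * B j) * y)"
      by (simp add: residue_scalar.sc_minus V.sc_minus mult.assoc)
    ultimately show ?thesis by (cases "i \<le> n - 1") (simp_all add: filt.zero)
  next
    case 2
    let ?h = "inverse (q - inverse q)"
    have "?U = rs ?h * (kap - kapi)" "?V = sc ?h * (k - ki)"
      using U.B_n_commutator V.B_n_commutator 2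
      by (simp_all add: W.serre_poly_def W.qserre_def residue_scalar.ev_simps V.ev_simps)
    then have "?U * x = rs ?h * (kap * x - kapi * x)" "?V * y = sc ?h * (k * y - ki * y)"
      by (simp_all add: mult.assoc left_diff_distrib)
    moreover have "filt (Suc e) (rs ?h * (kap * x - kapi * x)) (sc ?h * (k * y - ki * y))"
      by (intro filt_scale filt_diff filt_k filt_ki xy)
    ultimately show ?thesis using filt_mono[of "Suc e" _ _ "W.serre_length i j + e"]
      by (simp add: W.serre_length_def)
  next
    case 3
    let ?h = "- inverse (q - inverse q)"
    have "- ?U = rs (- ?h) * (kap - kapi)" "- ?V = sc (- ?h) * (k - ki)"
      using U.B_n_commutator V.B_n_commutator 3
      by (simp_all add: W.serre_poly_def W.qserre_def residue_scalar.ev_simps V.ev_simps)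
    then have "?U = rs ?h * (kap - kapi)" "?V = sc ?h * (k - ki)"
      unfolding residue_scalar.sc_minus V.sc_minus minus_minus mult_minus_left by (metis minus_minus)+
    then have "?U * x = rs ?h * (kap * x - kapi * x)" "?V * y = sc ?h * (k * y - ki * y)"
      by (simp_all add: mult.assoc left_diff_distrib)
    moreover have "filt (Suc e) (rs ?h * (kap * x - kapi * x)) (sc ?h * (k * y - ki * y))"
      by (intro filt_scale filt_diff filt_k filt_ki xy)
    ultimately show ?thesis using filt_mono[of "Suc e" _ _ "W.serre_length i j + e"]
      by (simp add: W.serre_length_def)
  next
    case 4
    have "?U = 0" "?V = 0"
      using U.B_commute[OF ij 4] V.B_commute[OF ij 4] 4
      by (simp_all add: W.serre_poly_def W.qserre_def residue_scalar.ev_simps V.ev_simps)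
    then show ?thesis by (simp add: filt.zero)
  next
    case 5
    then show ?thesis by (simp add: W.serre_poly_def W.qserre_def filt.zero)
  qed
qed

lemma filt_serre_homogeneous:
  "g \<in> W.serre_homogeneous {1..n+1} d \<Longrightarrow> filt d (residue_scalar.ev rB g * U.kp m) (V.ev B g * V.kp m)"
proof (induction rule: W.serre_homogeneous.induct)
  case (gen i j u v c)
  have "filt (length v + Suc 0) (residue_scalar.eval_word rB (Word v) * U.kp m) (V.eval_word B (Word v) * V.kp m)"
    by (rule filt_word[OF filt_kp])
  then have "filt (Suc (length v)) (residue_scalar.eval_word rB (Word v) * U.kp m) (V.eval_word B (Word v) * V.kp m)"
    by simp
  from filt_scale[OF filt_word[OF filt_serre[OF gen(1,2) this], of u], of c]
  have "filt (length u + (W.serre_length i j + length v))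
     (rs c * (residue_scalar.eval_word rB (Word u) * (residue_scalar.ev rB (W.serre_poly i j) * (residue_scalar.eval_word rB (Word v) * U.kp m))))
     (sc c * (V.eval_word B (Word u) * (V.ev B (W.serre_poly i j) * (V.eval_word B (Word v) * V.kp m))))" .
  moreover have "length u + (W.serre_length i j + length v) = d" using gen by simp
  ultimately show ?case
    by (simp add: residue_scalar.ev_mult V.ev_mult residue_scalar.ev_single V.ev_single mult.assoc)
qed (auto simp: residue_scalar.ev_add V.ev_add distrib_right intro: filt.intros)

text \<open>One coefficient function serves both rings; summands with the same power and word are
  merged by extending the two functions by 0 to the union of the index sets.\<close>

lemma filt_expand:
  assumes "filt d x y"
  shows "\<exists>T c. finite T \<and> (\<forall>(m, l)\<in>T. set l \<subseteq> {1..n+1} \<and> length l < d) \<and>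
    x = (\<Sum>(m, l)\<in>T. rs (c (m, l)) * (residue_scalar.eval_word rB (Word l) * U.kp m)) \<and>
    y = (\<Sum>(m, l)\<in>T. sc (c (m, l)) * (V.eval_word B (Word l) * V.kp m))"
  using assms
proof (induction rule: filt.induct)
  case zero
  then show ?case by (intro exI[of _ "{}"]) simp
next
  case (gen l c m)
  then show ?case by (intro exI[of _ "{(m, l)}"] exI[of _ "\<lambda>_. c"]) simp
next
  case (add x y x' y')
  from add.IH(1) obtain T c where T: "finite T" "\<forall>(m, l)\<in>T. set l \<subseteq> {1..n+1} \<and> length l < d"
    "x = (\<Sum>(m, l)\<in>T. rs (c (m, l)) * (residue_scalar.eval_word rB (Word l) * U.kp m))"
    "y = (\<Sum>(m, l)\<in>T. sc (c (m, l)) * (V.eval_word B (Word l) * V.kp m))" by blast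
  from add.IH(2) obtain T' c' where T': "finite T'" "\<forall>(m, l)\<in>T'. set l \<subseteq> {1..n+1} \<and> length l < d"
    "x' = (\<Sum>(m, l)\<in>T'. rs (c' (m, l)) * (residue_scalar.eval_word rB (Word l) * U.kp m))"
    "y' = (\<Sum>(m, l)\<in>T'. sc (c' (m, l)) * (V.eval_word B (Word l) * V.kp m))" by blast
  let ?c = "\<lambda>t. if t \<in> T then c t else 0" and ?c' = "\<lambda>t. if t \<in> T' then c' t else 0"
  let ?S = "T \<union> T'"
  have "x = (\<Sum>(m, l)\<in>?S. rs (?c (m, l)) * (residue_scalar.eval_word rB (Word l) * U.kp m))"
    "y = (\<Sum>(m, l)\<in>?S. sc (?c (m, l)) * (V.eval_word B (Word l) * V.kp m))"
    unfolding T(3,4) using T(1) T'(1) by (intro sum.mono_neutral_cong_left; force)+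
  moreover have "x' = (\<Sum>(m, l)\<in>?S. rs (?c' (m, l)) * (residue_scalar.eval_word rB (Word l) * U.kp m))"
    "y' = (\<Sum>(m, l)\<in>?S. sc (?c' (m, l)) * (V.eval_word B (Word l) * V.kp m))"
    unfolding T'(3,4) using T(1) T'(1) by (intro sum.mono_neutral_cong_left; force)+
  ultimately have
    "x + x' = (\<Sum>(m, l)\<in>?S. rs (?c (m, l) + ?c' (m, l)) * (residue_scalar.eval_word rB (Word l) * U.kp m))"
    "y + y' = (\<Sum>(m, l)\<in>?S. sc (?c (m, l) + ?c' (m, l)) * (V.eval_word B (Word l) * V.kp m))"
    by (simp_all only: residue_scalar.sc_add V.sc_add distrib_right sum.distrib split_def)
  then show ?case
    using T(1,2) T'(1,2) by (intro exI[of _ ?S] exI[of _ "\<lambda>t. ?c t + ?c' t"]) auto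
qed

lemma q_powi_inj: "inj (\<lambda>m::int. q powi m)"
proof (rule injI)
  fix m m' :: int
  have *: "q powi m \<noteq> q powi m'" if "m < m'" for m m' :: int
  proof
    assume "q powi m = q powi m'"
    then have "q powi (m' - m) = 1" using q_nonzero by (simp add: power_int_diff)
    moreover have "q powi (m' - m) = q ^ nat (m' - m)" using that by (simp add: power_int_def)
    moreover have "nat (m' - m) > 0" using that by simp
    ultimately show False using q_generic by metis
  qed
  assume "q powi m = q powi m'"
  then show "m = m'" using *[of m m'] *[of m' m] by (metis linorder_neqE)
qed

text \<open>On the highest weight vector of the Verma module of weight \<open>q\<^sup>s\<close> at \<open>n\<close>, the leading part of a relation
  \<open>\<Sum>\<^sub>m g\<^sub>m k\<^sup>m\<close> gives \<open>\<Sum>\<^sub>m q\<^sup>m\<^sup>s g\<^sub>m\<close> in the Serre ideal. A Vandermonde argument in \<open>s\<close> puts each \<open>g\<^sub>m\<close> into that ideal,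
  so that the leading part can be rewritten in lower degree.\<close>

lemma filt_drop:
  assumes "filt (Suc d) 0 y"
  shows "filt d 0 y"
proof -
  obtain T c where T: "finite T" "\<forall>(m, l)\<in>T. set l \<subseteq> {1..n+1} \<and> length l < Suc d"
    and x: "0 = (\<Sum>(m, l)\<in>T. rs (c (m, l)) * (residue_scalar.eval_word rB (Word l) * U.kp m))"
    and y: "y = (\<Sum>(m, l)\<in>T. sc (c (m, l)) * (V.eval_word B (Word l) * V.kp m))"
    using filt_expand[OF assms] by blast
  define top where "top = {t \<in> T. length (snd t) = d}"
  define g where "g m = (\<Sum>t\<in>{t\<in>top. fst t = m}. scalar (c t) * monomial (snd t) :: nat word \<Rightarrow>\<^sub>0 'k)" for m
  have top: "finite top" "top \<subseteq> T" using T by (auto simp: top_def)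
  \<comment> \<open>The relation is lifted to the free algebra, where \<open>rho\<close> can act. As
    its image under \<open>emb\<close> is 0, the lift lies in \<open>Uq_ideal\<close>.\<close>
  define P where "P = (\<Sum>(m, l)\<in>T. scalar (c (m, l)) * (scalar.eval_word Bpoly (Word l) * kppoly m))"
  have "emb P = 0"
    unfolding P_def emb_sum x split_def
    by (simp add: emb_simps emb_eval_word emb_kppoly)
  moreover have "P \<in> Uq_free"
    unfolding P_def by (intro sum_closed)
      (auto intro!: free_algebra_mult_closed scalar_closed eval_word_closed polys_closed)
  ultimately have P: "P \<in> Uq_ideal" by (rule emb_eq_zeroD)
  have word: "app (proj d) (app (rho s (scalar.eval_word Bpoly (Word l))) 1) = (if length l = d then monomial l else 0)"
    if "(m, l) \<in> T" for s m l
  proof -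
    let ?w = "app (rho s (scalar.eval_word Bpoly (Word l))) 1"
    have l: "set l \<subseteq> {1..n+1}" "length l \<le> d" using T(2) that by auto
    have low: "low_degree (length l) (?w - monomial l)" by (rule rho_word[OF l(1)])
    from proj_low_degree[OF low_degree_mono[OF low l(2)]]
    have "app (proj d) ?w = app (proj d) (monomial l)" by (simp add: app_diff)
    then show ?thesis by (simp only: proj_monomial)
  qed
  have "(\<Sum>m\<in>fst ` top. scalar ((q powi m) ^ s) * g m) \<in> W.serre_homogeneous {1..n+1} d" for s
  proof -
    have "app (rho s P) 1 \<in> J" by (rule rho_Uq_ideal[OF P])
    then have "app (proj d) (app (rho s P) 1) \<in> W.serre_homogeneous {1..n+1} d"
      by (rule W.proj_serre_ideal)
    also have "app (rho s P) 1
        = (\<Sum>(m, l)\<in>T. scalar (c (m, l)) * (scalar ((q powi m) ^ s) * app (rho s (scalar.eval_word Bpoly (Word l))) 1))"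
    proof -
      have "app (rho s (scalar a * (p * kppoly m))) 1 = scalar a * (scalar ((q powi m) ^ s) * app (rho s p) 1)" for a p m
        by (simp only: op_scalar.ev_mult op_scalar.ev_scalar times_lin_op.rep_eq op_scalar.rep_eq
            rho_kppoly app_scale)
      then show ?thesis
        by (simp only: P_def op_scalar.ev_sum split_def app_sum_op)
    qed
    also have "app (proj d) \<dots> = (\<Sum>(m, l)\<in>T. scalar (c (m, l)) * (scalar ((q powi m) ^ s) * (if length l = d then monomial l else 0)))"
      unfolding app_sum by (intro sum.cong refl) (auto simp only: split_def app_scale word fst_conv snd_conv)
    also have "\<dots> = (\<Sum>t\<in>top. scalar (c t) * (scalar ((q powi fst t) ^ s) * monomial (snd t)))"
      unfolding top_def using T(1) by (intro sum.mono_neutral_cong_right) (auto split: if_splits)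
    also have "\<dots> = (\<Sum>m\<in>fst ` top. \<Sum>t\<in>{t\<in>top. fst t = m}. scalar (c t) * (scalar ((q powi fst t) ^ s) * monomial (snd t)))"
      using top(1) by (intro sum.group[symmetric]) auto
    also have "\<dots> = (\<Sum>m\<in>fst ` top. scalar ((q powi m) ^ s) * g m)"
      unfolding g_def sum_distrib_left
      by (intro sum.cong refl) (auto intro: scalar.sc_left_commute)
    finally show ?thesis .
  qed
  then have g: "\<forall>m\<in>fst ` top. g m \<in> W.serre_homogeneous {1..n+1} d"
    using top(1) q_powi_inj
    by (intro subspace_vandermonde[where f = "\<lambda>m. q powi m"])
      (auto intro: W.serre_homogeneous.add W.serre_homogeneous_scale inj_on_subset)
  have f1: "filt d (\<Sum>m\<in>fst ` top. residue_scalar.ev rB (g m) * U.kp m) (\<Sum>m\<in>fst ` top. V.ev B (g m) * V.kp m)"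
    using g by (intro filt_sum filt_serre_homogeneous) auto
  have e1: "(\<Sum>m\<in>fst ` top. residue_scalar.ev rB (g m) * U.kp m)
      = (\<Sum>(m, l)\<in>top. rs (c (m, l)) * (residue_scalar.eval_word rB (Word l) * U.kp m))"
  proof -
    have "(\<Sum>m\<in>fst ` top. residue_scalar.ev rB (g m) * U.kp m) =
       (\<Sum>m\<in>fst ` top. \<Sum>t\<in>{t\<in>top. fst t = m}. rs (c t) * (residue_scalar.eval_word rB (Word (snd t)) * U.kp (fst t)))"
      unfolding g_def residue_scalar.ev_sum sum_distrib_right
      by (intro sum.cong refl) (auto simp: residue_scalar.ev_mult residue_scalar.ev_single mult.assoc)
    also have "\<dots> = (\<Sum>t\<in>top. rs (c t) * (residue_scalar.eval_word rB (Word (snd t)) * U.kp (fst t)))"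
      using top(1) by (intro sum.group) auto
    finally show ?thesis by (simp only: split_def prod.collapse)
  qed
  have e2: "(\<Sum>m\<in>fst ` top. V.ev B (g m) * V.kp m)
      = (\<Sum>(m, l)\<in>top. sc (c (m, l)) * (V.eval_word B (Word l) * V.kp m))"
  proof -
    have "(\<Sum>m\<in>fst ` top. V.ev B (g m) * V.kp m) =
       (\<Sum>m\<in>fst ` top. \<Sum>t\<in>{t\<in>top. fst t = m}. sc (c t) * (V.eval_word B (Word (snd t)) * V.kp (fst t)))"
      unfolding g_def V.ev_sum sum_distrib_right
      by (intro sum.cong refl) (auto simp: V.ev_mult V.ev_single mult.assoc)
    also have "\<dots> = (\<Sum>t\<in>top. sc (c t) * (V.eval_word B (Word (snd t)) * V.kp (fst t)))"
      using top(1) by (intro sum.group) auto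
    finally show ?thesis by (simp only: split_def prod.collapse)
  qed
  have f2: "filt d (\<Sum>(m, l)\<in>T - top. rs (c (m, l)) * (residue_scalar.eval_word rB (Word l) * U.kp m))
      (\<Sum>(m, l)\<in>T - top. sc (c (m, l)) * (V.eval_word B (Word l) * V.kp m))"
    unfolding split_def
  proof (intro filt_sum)
    fix t assume t: "t \<in> T - top"
    then have "set (snd t) \<subseteq> {1..n+1}" "length (snd t) < d" using T(2) by (force simp: top_def)+
    from filt.gen[OF this]
    show "filt d (rs (c (fst t, snd t)) * (residue_scalar.eval_word rB (Word (snd t)) * U.kp (fst t)))
       (sc (c (fst t, snd t)) * (V.eval_word B (Word (snd t)) * V.kp (fst t)))" .
  qed
  \<comment> \<open>The top terms equal an expression of degree below \<open>d\<close>,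
    simultaneously in both rings; the shorter words are kept. The first sum is still the given
    expression of 0.\<close>
  from filt.add[OF f2 f1[unfolded e1 e2]] show ?thesis
    unfolding sum.subset_diff[OF top(2) T(1), symmetric] x[symmetric] y[symmetric] .
qed

text \<open>A relation can be lowered by \<open>filt_drop\<close> until the degree bound is 0. No
  word has length below 0, so its value in the target is an empty sum.\<close>

theorem relation_transfer:
  assumes "residue_scalar.ev U.kval f = 0"
  shows "V.ev V.kval f = 0"
proof -
  obtain d where "filt d (residue_scalar.ev U.kval f) (V.ev V.kval f)" using filt_ev by blast
  then have "filt d 0 (V.ev V.kval f)" using assms by simp
  then have "filt 0 0 (V.ev V.kval f)"
    by (induction d) (auto dest: filt_drop)
  from filt_expand[OF this] obtain T c where T: "\<forall>(m, l)\<in>T. set l \<subseteq> {1..n+1} \<and> length l < 0"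
    and ev: "V.ev V.kval f = (\<Sum>(m, l)\<in>T. sc (c (m, l)) * (V.eval_word B (Word l) * V.kp m))"
    by blast
  from T have "T = {}" by fastforce
  then show ?thesis by (simp only: ev sum.empty)
qed

end

section \<open>The automorphisms on the image in the ring type\<close>

lemma cartan_D_values:
  assumes "n \<ge> 3"
  shows "cartan_D n n (n - 1) = -1" "cartan_D n (n - 1) n = -1" "cartan_D n (n + 1) (n - 1) = -1"
    "cartan_D n (n - 1) (n + 1) = -1" "cartan_D n (n - 1) (n - 2) = -1" "cartan_D n (n - 2) (n - 1) = -1"
    "j < n - 1 \<Longrightarrow> cartan_D n n j = 0" "j < n - 1 \<Longrightarrow> cartan_D n (n + 1) j = 0"
    "j < n - 2 \<Longrightarrow> cartan_D n (n - 1) j = 0"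
proof -
  obtain m where n: "n = m + 3" using assms by (metis le_add_diff_inverse2)
  show "cartan_D n n (n - 1) = -1" "cartan_D n (n - 1) n = -1" "cartan_D n (n + 1) (n - 1) = -1"
    "cartan_D n (n - 1) (n + 1) = -1" "cartan_D n (n - 1) (n - 2) = -1" "cartan_D n (n - 2) (n - 1) = -1"
    "j < n - 1 \<Longrightarrow> cartan_D n n j = 0" "j < n - 1 \<Longrightarrow> cartan_D n (n + 1) j = 0"
    "j < n - 2 \<Longrightarrow> cartan_D n (n - 1) j = 0"
    unfolding n cartan_D_def by simp_all
qed

lemma cartan_D_adjacent_cases:
  assumes "n \<ge> 3" "i \<in> {1..n+1}" "j \<in> {1..n+1}" "cartan_D n i j = -1"
  obtains "i < n - 1" "j < n - 1" | "i = n - 1" "j = n" | "i = n - 1" "j = n + 1" | "i = n" "j = n - 1"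
    | "i = n + 1" "j = n - 1" | "i = n - 1" "j = n - 2" | "i = n - 2" "j = n - 1"
proof -
  from assms(4) consider "j = i + 1" "j \<le> n" | "i = j + 1" "i \<le> n"
    | "i = n - 1" "j = n + 1" | "i = n + 1" "j = n - 1"
    unfolding cartan_D_def by (auto split: if_split_asm)
  then show thesis
  proof cases
    case 1
    then consider "j < n - 1" "i < n - 1" | "j = n - 1" "i = n - 2" | "j = n" "i = n - 1" by linarith
    then show ?thesis using that by cases blast+
  next
    case 2
    then consider "j < n - 1" "i < n - 1" | "i = n - 1" "j = n - 2" | "i = n" "j = n - 1" by linarith
    then show ?thesis using that by cases blast+
  qed (use that in blast)+
qed

lemma cartan_D_zero_cases:
  assumes "n \<ge> 3" "i \<in> {1..n+1}" "j \<in> {1..n+1}" "cartan_D n i j = 0" "{i, j} \<noteq> {n, n+1}"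
  obtains "i < n - 1" "j < n - 1" | "i \<in> {n, n+1}" "j < n - 1" | "i < n - 1" "j \<in> {n, n+1}"
    | "i = n - 1" "j < n - 2" | "i < n - 2" "j = n - 1"
proof -
  note v = cartan_D_values(1-6)[OF assms(1)]
  have cases: "m < n - 2 \<or> m = n - 2 \<or> m = n - 1 \<or> m = n \<or> m = n + 1" if "m \<in> {1..n+1}" for m
    using that unfolding atLeastAtMost_iff by linarith
  have lt: "n - 2 < n - 1" using assms(1) by linarith
  have ij: "i \<noteq> j" using assms(4) by auto
  consider "i < n - 2" | "i = n - 2" | "i = n - 1" | "i = n" | "i = n + 1" using cases[OF assms(2)] by blast
  then show thesis
  proof cases
    case 1
    then have "i < n - 1" by linarith
    then show ?thesis using cases[OF assms(3)] that(1,3,5) 1 lt by (metis insertCI less_trans)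
  next
    case 2
    then have "j \<noteq> n - 1" using v(6) assms(4) by auto
    then show ?thesis using cases[OF assms(3)] that(1,3) 2 lt by (metis insertCI less_trans)
  next
    case 3
    then have "j \<noteq> n" "j \<noteq> n + 1" "j \<noteq> n - 2" "j \<noteq> n - 1" using v assms(4) ij by auto
    then show ?thesis using cases[OF assms(3)] that(4) 3 by blast
  next
    case 4
    then have "j \<noteq> n - 1" "j \<noteq> n" "j \<noteq> n + 1" using v assms(4,5) ij by auto
    then show ?thesis using cases[OF assms(3)] that(2) 4 lt by (metis insertCI less_trans)
  next
    case 5
    then have "j \<noteq> n - 1" "j \<noteq> n" "j \<noteq> n + 1" using v assms(4,5) ij by auto
    then show ?thesis using cases[OF assms(3)] that(2) 5 lt by (metis insertCI less_trans)
  qed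
qed

lemma (in kolb_four) image_commute:
  assumes t: "b * t = t * b" "c * t = t * c" "k * t = t * k" "ki * t = t * ki" "x * t = t * x"
  shows "x1 * t = t * x1" "b1 * t = t * b1" "c1 * t = t * c1"
    "x2 * t = t * x2" "b2 * t = t * b2" "c2 * t = t * c2"
proof -
  note r = t q_comm[of t] qi_comm[of t]
  show "x1 * t = t * x1" "b1 * t = t * b1" "c1 * t = t * c1"
    by (simp_all add: x1_altdef b1_def c1_def algebra_simps rw0 r r[THEN mult_assoc_ext])
  show "x2 * t = t * x2" "b2 * t = t * b2" "c2 * t = t * c2"
    by (simp_all add: x2_def b2_def c2_def algebra_simps rw0 r r[THEN mult_assoc_ext])
qed

section \<open>Changing a tuple near the branch node\<close>

locale kolb_tuple_generic = kolb_tuple sc n q B k ki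
  for sc :: "'k::field \<Rightarrow> 'r::ring_1" and n q B k ki +
  assumes n_ge_3: "n \<ge> 3" and q_conditions: "q \<noteq> 0" "q ^ 2 \<noteq> 1" "q ^ 4 \<noteq> 1"
begin

lemma sc_powers: "sc (q powi -2) = sc (inverse q) * sc (inverse q)" "sc (q powi 2) = sc q * sc q"
  by (simp_all add: sc_mult[symmetric] power_int_minus power2_eq_square)

text \<open>The abstract letters become B_n, B_(n+1), B_(n-1), B_(n-2); by n \<ge> 3 the last index
  is at least 1.\<close>

sublocale S4: kolb_four "sc q" "sc (inverse q)" "sc (inverse (q - inverse q))" "sc (inverse (q + inverse q))"
    "B n" "B (n+1)" k ki "B (n - 1)" "B (n - 2)"
proof -
  have w: "B_weight n n = -2" "B_weight n (n+1) = 2" "B_weight n (n - 1) = 0" "B_weight n (n - 2) = 0"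
    using n_ge_3 by (auto simp: B_weight_def)
  have idx: "n \<in> {1..n+1}" "n + 1 \<in> {1..n+1}" "n - 1 \<in> {1..n+1}" "n - 2 \<in> {1..n+1}" using n_ge_3 by auto
  have lt: "n - 2 < n - 1" "\<not> n \<le> n - 1" "\<not> n + 1 \<le> n - 1" "n - 2 \<le> n - 1" "n - 1 \<le> n - 1" using n_ge_3 by auto
  note a = cartan_D_values[OF n_ge_3]
  show "kolb_four (sc q) (sc (inverse q)) (sc (inverse (q - inverse q))) (sc (inverse (q + inverse q)))
    (B n) (B (n+1)) k ki (B (n - 1)) (B (n - 2))"
  proof (intro kolb_four.intro kolb_three.intro kolb_linear.intro q_scalars[OF q_conditions]
      kolb_linear_axioms.intro kolb_three_axioms.intro kolb_four_axioms.intro)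
    show "k * ki = 1" "ki * k = 1" by (fact k_ki ki_k)+
    show "k * B n = sc (inverse q) * (sc (inverse q) * (B n * k))"
      "k * B (n + 1) = sc q * (sc q * (B (n + 1) * k))"
      "k * B (n - 1) = B (n - 1) * k" "k * B (n - 2) = B (n - 2) * k"
      by (simp_all only: k_B w sc_powers mult.assoc power_int_0_right sc_one mult_1_left)
    show "B n * B (n + 1) - B (n + 1) * B n = sc (inverse (q - inverse q)) * (k - ki)"
      by (fact B_n_commutator)
    show "B n * B (n - 2) = B (n - 2) * B n" "B (n + 1) * B (n - 2) = B (n - 2) * B (n + 1)"
      using B_commute[OF idx(1,4) a(7)[OF lt(1)]] B_commute[OF idx(2,4) a(8)[OF lt(1)]] n_ge_3
      by (auto simp: doubleton_eq_iff)
  qed (use B_serre[OF idx(1,3) a(1)] B_serre[OF idx(2,3) a(3)] B_serre[OF idx(3,1) a(2)]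
      B_serre[OF idx(3,2) a(4)] B_serre[OF idx(3,4) a(5)] B_serre[OF idx(4,3) a(6)] lt in \<open>simp_all only: if_True if_False\<close>)
qed

text \<open>If only B_(n-1), B_n, B_(n+1) change, the relations among these and B_(n-2), the other
  neighbour of n-1, are contained in \<open>kolb_four\<close>. Relations between indices below n-1
  are the old ones, and for j < n-2 only commutation with the new elements is left.\<close>

lemma kolb_tuple_modify:
  assumes four: "kolb_four (sc q) (sc (inverse q)) (sc (inverse (q - inverse q))) (sc (inverse (q + inverse q)))
      (B' n) (B' (n+1)) k' ki' (B' (n - 1)) (B (n - 2))"
    and old: "\<And>j. j \<noteq> n - 1 \<Longrightarrow> j \<noteq> n \<Longrightarrow> j \<noteq> n + 1 \<Longrightarrow> B' j = B j"
    and k': "\<And>j. j < n - 2 \<Longrightarrow> k' * B j = B j * k'"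
    and new: "\<And>j i. j < n - 2 \<Longrightarrow> i \<in> {n - 1, n, n + 1} \<Longrightarrow> B' i * B j = B j * B' i"
  shows "kolb_tuple sc n q B' k' ki'"
proof -
  interpret N: kolb_four "sc q" "sc (inverse q)" "sc (inverse (q - inverse q))" "sc (inverse (q + inverse q))"
    "B' n" "B' (n+1)" k' ki' "B' (n - 1)" "B (n - 2)" by (rule four)
  have B2: "B' (n - 2) = B (n - 2)" using n_ge_3 by (intro old) auto
  have lt: "B' j = B j" if "j < n - 1" for j using that n_ge_3 by (intro old) auto
  have new2: "B' i * B j = B j * B' i" if "j < n - 1" "i \<in> {n, n + 1}" for i j
  proof (cases "j = n - 2")
    case True
    then show ?thesis using N.b_y N.c_y that(2) by auto
  next
    case False
    then have "j < n - 2" using that by linarith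
    then show ?thesis using that by (intro new) auto
  qed
  show ?thesis
  proof
    fix j
    show "B' j = 0" if "j \<notin> {1..n+1}"
    proof -
      have "j \<noteq> n - 1" "j \<noteq> n" "j \<noteq> n + 1" using that n_ge_3 by auto
      then show ?thesis using old B_outside[OF that] by simp
    qed
    show "k' * B' j = sc (q powi B_weight n j) * (B' j * k')"
    proof -
      have w: "B_weight n n = -2" "B_weight n (n+1) = 2" by (simp_all add: B_weight_def)
      have w0: "B_weight n j = 0" if "j \<noteq> n" "j \<noteq> n + 1" using that by (simp add: B_weight_def)
      consider "j = n" | "j = n + 1" | "j = n - 1" "j \<noteq> n" "j \<noteq> n + 1" | "j = n - 2" "j \<noteq> n" "j \<noteq> n + 1"
        | "j < n - 2" "j \<noteq> n" "j \<noteq> n + 1" | "j > n + 1" by linarith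
      then show ?thesis
      proof cases
        case 1
        then show ?thesis by (simp only: w sc_powers N.kb mult.assoc)
      next
        case 2
        then show ?thesis by (simp only: w sc_powers N.kc mult.assoc)
      next
        case 3
        then show ?thesis using w0 N.kx by simp
      next
        case 4
        then show ?thesis using w0 N.ky B2 by simp
      next
        case 5
        then show ?thesis using w0 k' lt[of j] by simp
      next
        case 6
        then have "B' j = 0" using old[of j] B_outside[of j] n_ge_3 by simp
        then show ?thesis by simp
      qed
    qed
  next
    fix i j
    assume ij: "i \<in> {1..n+1}" "j \<in> {1..n+1}" "cartan_D n i j = 0" "{i, j} \<noteq> {n, n+1}"
    from cartan_D_zero_cases[OF n_ge_3 ij] show "B' i * B' j = B' j * B' i"
    proof cases
      case 1
      then show ?thesis using B_commute[OF ij] lt by simp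
    next
      case 2
      then show ?thesis using new2 lt by simp
    next
      case 3
      then show ?thesis using new2[of i j] lt[of i] by simp
    next
      case 4
      then show ?thesis using new[of j i] lt[of j] by simp
    next
      case 5
      then show ?thesis using new[of i j] lt[of i] by simp
    qed
  next
    fix i j
    assume ij: "i \<in> {1..n+1}" "j \<in> {1..n+1}" "cartan_D n i j = -1"
    have le: "\<not> n \<le> n - 1" "\<not> n + 1 \<le> n - 1" "n - 2 \<le> n - 1" "n - 1 \<le> n - 1" using n_ge_3 by auto
    from cartan_D_adjacent_cases[OF n_ge_3 ij]
    show "B' i * B' i * B' j - (sc q + sc (inverse q)) * (B' i * B' j * B' i) + B' j * B' i * B' i
        = (if i \<le> n - 1 then - (sc (inverse q) * B' j) else 0)"
    proof cases
      case 1
      then show ?thesis using B_serre[OF ij] lt by simp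
    qed (simp_all only: le if_True if_False N.serre_b N.serre_c N.serre_xb N.serre_xc B2 N.serre_xy N.serre_yx)
  next
    show "k' * ki' = 1" "ki' * k' = 1" by (fact N.k_ki N.ki_k)+
    show "B' n * B' (n + 1) - B' (n + 1) * B' n = sc (inverse (q - inverse q)) * (k' - ki')"
      by (fact N.bc)
  qed
qed

definition "image_minus = B(n - 1 := S4.x1, n := S4.b1, n + 1 := S4.c1)"
definition "image_plus = B(n - 1 := S4.x2, n := S4.b2, n + 1 := S4.c2)"

lemma image_minus_simps: "image_minus (n - 1) = S4.x1" "image_minus n = S4.b1" "image_minus (n + 1) = S4.c1"
    "j \<noteq> n - 1 \<Longrightarrow> j \<noteq> n \<Longrightarrow> j \<noteq> n + 1 \<Longrightarrow> image_minus j = B j"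
  and image_plus_simps: "image_plus (n - 1) = S4.x2" "image_plus n = S4.b2" "image_plus (n + 1) = S4.c2"
    "j \<noteq> n - 1 \<Longrightarrow> j \<noteq> n \<Longrightarrow> j \<noteq> n + 1 \<Longrightarrow> image_plus j = B j"
  using n_ge_3 by (auto simp: image_minus_def image_plus_def)

lemma old_commute:
  assumes "j < n - 2"
  shows "k * B j = B j * k" "ki * B j = B j * ki" "B n * B j = B j * B n" "B (n+1) * B j = B j * B (n+1)"
    "B (n - 1) * B j = B j * B (n - 1)"
proof -
  have ne: "j \<noteq> n" "j \<noteq> n + 1" using assms by linarith+
  then have w: "B_weight n j = 0" by (simp add: B_weight_def)
  show k: "k * B j = B j * k" using k_B[of j] w by simp
  show "ki * B j = B j * ki" using S4.ki_conj[of "B j" 1 1] k by simp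
  have *: "B i * B j = B j * B i" if "i \<in> {1..n+1}" "cartan_D n i j = 0" "i \<ge> n - 1" for i
  proof (cases "j \<in> {1..n+1}")
    case True
    have "{i, j} \<noteq> {n, n+1}" using ne by (simp add: doubleton_eq_iff)
    then show ?thesis using B_commute[OF that(1) True that(2)] by simp
  next
    case False
    show ?thesis by (simp only: B_outside[OF False] mult_zero_left mult_zero_right)
  qed
  have j: "j < n - 1" using assms by linarith
  show "B n * B j = B j * B n" by (rule *[OF _ cartan_D_values(7)[OF n_ge_3 j]]) (use n_ge_3 in auto)
  show "B (n+1) * B j = B j * B (n+1)" by (rule *[OF _ cartan_D_values(8)[OF n_ge_3 j]]) (use n_ge_3 in auto)
  show "B (n - 1) * B j = B j * B (n - 1)"
    by (rule *[OF _ cartan_D_values(9)[OF n_ge_3 assms]]) (use n_ge_3 in auto)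
qed

lemma kolb_tuple_image_minus: "kolb_tuple sc n q image_minus ki k"
proof (rule kolb_tuple_modify)
  show "kolb_four (sc q) (sc (inverse q)) (sc (inverse (q - inverse q))) (sc (inverse (q + inverse q)))
      (image_minus n) (image_minus (n+1)) ki k (image_minus (n - 1)) (B (n - 2))"
    unfolding image_minus_simps(1-3) by (rule S4.kolb_four_image)
  fix j assume j: "j < n - 2"
  show "ki * B j = B j * ki" by (rule old_commute[OF j])
  note S4.image_commute[OF old_commute(3,4,1,2,5)[OF j]]
  then show "image_minus i * B j = B j * image_minus i" if "i \<in> {n - 1, n, n + 1}" for i
    using that image_minus_simps by auto
qed (simp add: image_minus_simps)

lemma kolb_tuple_image_plus: "kolb_tuple sc n q image_plus ki k"
proof (rule kolb_tuple_modify)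
  show "kolb_four (sc q) (sc (inverse q)) (sc (inverse (q - inverse q))) (sc (inverse (q + inverse q)))
      (image_plus n) (image_plus (n+1)) ki k (image_plus (n - 1)) (B (n - 2))"
    unfolding image_plus_simps(1-3) by (rule S4.kolb_four_image2)
  fix j assume j: "j < n - 2"
  show "ki * B j = B j * ki" by (rule old_commute[OF j])
  note S4.image_commute[OF old_commute(3,4,1,2,5)[OF j]]
  then show "image_plus i * B j = B j * image_plus i" if "i \<in> {n - 1, n, n + 1}" for i
    using that image_plus_simps by auto
qed (simp add: image_plus_simps)

end

section \<open>Homomorphisms on the image of the coideal subalgebra\<close>

context uq_generic
begin

sublocale G: kolb_tuple_generic rs n q rB kap kapi
  using n_ge q_nonzero q_generic by unfold_locales auto

definition BB :: "(uq_gen word \<Rightarrow>\<^sub>0 'k) residues set" where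
  "BB = range (residue_scalar.ev U.kval)"

lemma BB_closed:
  "rs c \<in> BB" "rB j \<in> BB" "kap \<in> BB" "kapi \<in> BB" "u \<in> BB \<Longrightarrow> v \<in> BB \<Longrightarrow> u + v \<in> BB"
  "u \<in> BB \<Longrightarrow> v \<in> BB \<Longrightarrow> u * v \<in> BB" "u \<in> BB \<Longrightarrow> v \<in> BB \<Longrightarrow> u - v \<in> BB" "u \<in> BB \<Longrightarrow> - u \<in> BB"
proof -
  have r: "residue_scalar.ev U.kval p \<in> BB" for p by (simp add: BB_def)
  show "rs c \<in> BB" "rB j \<in> BB" "kap \<in> BB" "kapi \<in> BB"
    using r[of "scalar c"] r[of "letter (KB j)"] r[of "letter KK"] r[of "letter KKi"] by simp_all
  show "u \<in> BB \<Longrightarrow> v \<in> BB \<Longrightarrow> u + v \<in> BB" "u \<in> BB \<Longrightarrow> v \<in> BB \<Longrightarrow> u * v \<in> BB"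
    "u \<in> BB \<Longrightarrow> v \<in> BB \<Longrightarrow> u - v \<in> BB" "u \<in> BB \<Longrightarrow> - u \<in> BB"
    unfolding BB_def by (auto simp: residue_scalar.ev_simps[symmetric])
qed

definition hom_on :: "(uq_gen word \<Rightarrow>\<^sub>0 'k) residues set
    \<Rightarrow> ((uq_gen word \<Rightarrow>\<^sub>0 'k) residues \<Rightarrow> (uq_gen word \<Rightarrow>\<^sub>0 'k) residues) \<Rightarrow> bool" where
  "hom_on S h \<longleftrightarrow> (\<forall>u\<in>S. \<forall>v\<in>S. h (u + v) = h u + h v \<and> h (u * v) = h u * h v) \<and> (\<forall>c. h (rs c) = rs c)"

lemma hom_on_BB:
  assumes "hom_on BB h" "u \<in> BB" "v \<in> BB"
  shows "h (u + v) = h u + h v" "h (u * v) = h u * h v" "h (rs c) = rs c" "h (- u) = - h u" "h (u - v) = h u - h v"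
proof -
  show add: "h (u + v) = h u + h v" and "h (u * v) = h u * h v" and c: "h (rs c) = rs c" for c
    using assms by (auto simp: hom_on_def)
  have neg: "h (- u) = - h u" if "u \<in> BB" for u
  proof -
    have "h (rs (- 1) * u) = h (rs (- 1)) * h u"
      using assms(1) that BB_closed(1) unfolding hom_on_def by blast
    then have "h (rs (- 1) * u) = rs (- 1) * h u" by (simp only: c)
    then show ?thesis by (simp add: residue_scalar.sc_minus)
  qed
  then show "h (- u) = - h u" using assms by simp
  have "h (u + - v) = h u + h (- v)" using assms BB_closed(8) unfolding hom_on_def by blast
  then show "h (u - v) = h u - h v" using neg assms(3) by simp
qed

lemma hom_on_BB_eqI:
  assumes "hom_on BB h" "hom_on BB h'" "\<And>j. j \<in> {1..n+1} \<Longrightarrow> h (rB j) = h' (rB j)"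
    "h kap = h' kap" "h kapi = h' kapi" "u \<in> BB"
  shows "h u = h' u"
proof -
  have "h (residue_scalar.ev U.kval f) = h' (residue_scalar.ev U.kval f)" for f
  proof (induction f rule: poly_mapping_linear_induct)
    case (word l)
    have B: "h (rB j) = h' (rB j)" for j
      by (cases "j \<in> {1..n+1}")
        (use assms(3) rB_zero hom_on_BB(3)[OF assms(1) BB_closed(1) BB_closed(1), of 0]
          hom_on_BB(3)[OF assms(2) BB_closed(1) BB_closed(1), of 0] in auto)
    have in_BB: "residue_scalar.eval_word U.kval (Word l) \<in> BB" for l
      using rangeI[of "residue_scalar.ev U.kval" "monomial l"] by (simp add: BB_def residue_scalar.ev_single)
    have "h (residue_scalar.eval_word U.kval (Word l)) = h' (residue_scalar.eval_word U.kval (Word l))"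
    proof (induction l)
      case Nil
      then show ?case
        using hom_on_BB(3)[OF assms(1) BB_closed(1) BB_closed(1), of 1]
          hom_on_BB(3)[OF assms(2) BB_closed(1) BB_closed(1), of 1] by simp
    next
      case (Cons g l)
      then show ?case
        by (cases g) (simp_all add: residue_scalar.eval_word_Cons hom_on_BB(2)[OF assms(1)] hom_on_BB(2)[OF assms(2)]
            BB_closed in_BB B assms(4,5))
    qed
    then show ?case by (simp add: residue_scalar.ev_single)
  next
    case (scale c p)
    have p: "residue_scalar.ev U.kval p \<in> BB" by (simp add: BB_def)
    show ?case
      using scale by (simp add: residue_scalar.ev_mult hom_on_BB(2,3)[OF assms(1) BB_closed(1) p]
          hom_on_BB(2,3)[OF assms(2) BB_closed(1) p])
  next
    case (add p r)
    have pr: "residue_scalar.ev U.kval p \<in> BB" "residue_scalar.ev U.kval r \<in> BB" by (simp_all add: BB_def)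
    show ?case
      using add by (simp add: residue_scalar.ev_add hom_on_BB(1)[OF assms(1) pr] hom_on_BB(1)[OF assms(2) pr])
  qed
  then show ?thesis using assms(6) by (auto simp: BB_def)
qed

text \<open>The universal property of the presentation: a homomorphism on \<open>BB\<close> is
  determined freely by any tuple that satisfies the relations.\<close>

lemma extend_tuple:
  assumes "kolb_tuple rs n q B k ki" "\<And>j. B j \<in> BB" "k \<in> BB" "ki \<in> BB"
  obtains h where "hom_on BB h" "\<And>u. u \<in> BB \<Longrightarrow> h u \<in> BB" "\<And>j. h (rB j) = B j" "h kap = k" "h kapi = ki"
proof -
  interpret T: uq_target n q rs B k ki
    using uq_generic_axioms assms(1) by (simp add: uq_target_def)
  \<comment> \<open>An element is written as a polynomial in the generators, and this is evaluated
    at the new tuple; by \<open>relation_transfer\<close> the choice does not matter.\<close>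
  define h where "h u = residue_scalar.ev T.V.kval (SOME f. residue_scalar.ev U.kval f = u)" for u
  have h: "h (residue_scalar.ev U.kval f) = residue_scalar.ev T.V.kval f" for f
  proof -
    let ?f = "SOME f'. residue_scalar.ev U.kval f' = residue_scalar.ev U.kval f"
    have "residue_scalar.ev U.kval ?f = residue_scalar.ev U.kval f" by (rule someI) simp
    then have "residue_scalar.ev U.kval (?f - f) = 0" by (simp add: residue_scalar.ev_diff)
    then have "residue_scalar.ev T.V.kval (?f - f) = 0" by (rule T.relation_transfer)
    then show ?thesis by (simp add: residue_scalar.ev_diff h_def)
  qed
  have "hom_on BB h"
    unfolding hom_on_def BB_def
    using h[of "scalar c" for c] by (auto simp: residue_scalar.ev_simps[symmetric] h)
  moreover have "h u \<in> BB" if "u \<in> BB" for u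
  proof -
    have "residue_scalar.ev T.V.kval f \<in> BB" for f
    proof (induction f rule: poly_mapping_linear_induct)
      case (word l)
      have "residue_scalar.eval_word T.V.kval (Word l) \<in> BB"
      proof (induction l)
        case Nil
        then show ?case using BB_closed(1)[of 1] by simp
      next
        case (Cons g l)
        then show ?case by (cases g) (auto simp: residue_scalar.eval_word_Cons intro: BB_closed assms)
      qed
      then show ?case by (simp add: residue_scalar.ev_single)
    qed (auto simp: residue_scalar.ev_mult residue_scalar.ev_add intro: BB_closed)
    then show ?thesis using that by (auto simp: BB_def h)
  qed
  moreover have "h (rB j) = B j" for j using h[of "letter (KB j)"] by simp
  moreover have "h kap = k" "h kapi = ki" using h[of "letter KK"] h[of "letter KKi"] by simp_all
  ultimately show ?thesis using that by blast
qed

end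

section \<open>Transport to the quotient ring\<close>

context uq_generic
begin

abbreviation "Q \<equiv> Uq n q"

definition cl :: "(uq_gen word \<Rightarrow>\<^sub>0 'k) \<Rightarrow> (uq_gen word \<Rightarrow>\<^sub>0 'k) set" where
  "cl p = Uq_ideal +>\<^bsub>free_algebra (Uq_gens n)\<^esub> p"

text \<open>Two representatives of a class differ by an element of the ideal, where
  \<open>emb\<close> vanishes, so the choice is immaterial.\<close>

definition th :: "(uq_gen word \<Rightarrow>\<^sub>0 'k) set \<Rightarrow> (uq_gen word \<Rightarrow>\<^sub>0 'k) residues" where
  "th C = emb (SOME p. p \<in> Uq_free \<and> cl p = C)"

lemma Uq_ideal_ideal: "ideal Uq_ideal (free_algebra (Uq_gens n))"
  unfolding Uq_ideal_def by (rule ring.genideal_ideal[OF ring_free_algebra Uq_rels_closed])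

lemma cl_eq_iff:
  assumes "p \<in> Uq_free" "r \<in> Uq_free"
  shows "cl p = cl r \<longleftrightarrow> emb p = emb r"
proof -
  interpret A: ring "free_algebra (Uq_gens n) :: (uq_gen word \<Rightarrow>\<^sub>0 'k) ring" by (rule ring_free_algebra)
  have "\<ominus>\<^bsub>free_algebra (Uq_gens n)\<^esub> r = - r"
    using assms(2) by (intro A.minus_equality) (auto simp: free_algebra_simps free_algebra_uminus_closed)
  then have "p \<ominus>\<^bsub>free_algebra (Uq_gens n)\<^esub> r = p - r"
    by (simp add: a_minus_def free_algebra_simps)
  then have "cl p = cl r \<longleftrightarrow> p - r \<in> Uq_ideal"
    using A.quotient_eq_iff_same_a_r_cos[OF Uq_ideal_ideal assms] by (simp add: cl_def)
  also have "\<dots> \<longleftrightarrow> emb (p - r) = 0"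
    using emb_eq_zero emb_eq_zeroD free_algebra_diff_closed[OF assms] by blast
  finally show ?thesis by (simp add: emb_simps)
qed

lemma th_cl: "p \<in> Uq_free \<Longrightarrow> th (cl p) = emb p"
  unfolding th_def by (rule someI2[of _ p]) (auto simp: cl_eq_iff)

lemma Uq_unfold:
  "carrier Q = cl ` Uq_free" "\<one>\<^bsub>Q\<^esub> = cl 1"
  "p \<in> Uq_free \<Longrightarrow> r \<in> Uq_free \<Longrightarrow> cl p \<otimes>\<^bsub>Q\<^esub> cl r = cl (p * r)"
  "p \<in> Uq_free \<Longrightarrow> r \<in> Uq_free \<Longrightarrow> cl p \<oplus>\<^bsub>Q\<^esub> cl r = cl (p + r)"
  "p \<in> Uq_free \<Longrightarrow> c \<odot>\<^bsub>Q\<^esub> cl p = cl (scalar c * p)"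
proof -
  interpret I: ideal Uq_ideal "free_algebra (Uq_gens n)" by (rule Uq_ideal_ideal)
  note defs = Uq_def presented_algebra_def Let_def Uq_ideal_def[symmetric] ring.defs module.defs FactRing_def
  show "carrier Q = cl ` Uq_free" by (auto simp: defs A_RCOSETS_def' cl_def)
  show "\<one>\<^bsub>Q\<^esub> = cl 1" by (simp add: defs cl_def free_algebra_simps)
  show "p \<in> Uq_free \<Longrightarrow> r \<in> Uq_free \<Longrightarrow> cl p \<otimes>\<^bsub>Q\<^esub> cl r = cl (p * r)"
    by (simp add: defs cl_def I.rcoset_mult_add free_algebra_simps)
  show "p \<in> Uq_free \<Longrightarrow> r \<in> Uq_free \<Longrightarrow> cl p \<oplus>\<^bsub>Q\<^esub> cl r = cl (p + r)"
    by (simp add: defs cl_def I.a_rcos_sum free_algebra_simps)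
  show "p \<in> Uq_free \<Longrightarrow> c \<odot>\<^bsub>Q\<^esub> cl p = cl (scalar c * p)"
    by (simp add: defs cl_def I.rcoset_mult_add scalar_closed free_algebra_simps)
qed

interpretation Q: ring Q by (rule ring_Uq)

lemma th_inj:
  assumes "C \<in> carrier Q" "D \<in> carrier Q" "th C = th D"
  shows "C = D"
proof -
  obtain p r where pr: "p \<in> Uq_free" "r \<in> Uq_free" "C = cl p" "D = cl r"
    using assms(1,2) unfolding Uq_unfold(1) by blast
  then show ?thesis using assms(3) th_cl cl_eq_iff by metis
qed

lemma th_simps0:
  assumes "C \<in> carrier Q" "D \<in> carrier Q"
  shows "th (C \<otimes>\<^bsub>Q\<^esub> D) = th C * th D" "th (C \<oplus>\<^bsub>Q\<^esub> D) = th C + th D" "th (c \<odot>\<^bsub>Q\<^esub> C) = rs c * th C"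
    "th (\<ominus>\<^bsub>Q\<^esub> C) = - th C" "c \<odot>\<^bsub>Q\<^esub> C \<in> carrier Q"
proof -
  obtain p r where pr: "p \<in> Uq_free" "r \<in> Uq_free" "C = cl p" "D = cl r"
    using assms unfolding Uq_unfold(1) by blast
  show "th (C \<otimes>\<^bsub>Q\<^esub> D) = th C * th D" "th (C \<oplus>\<^bsub>Q\<^esub> D) = th C + th D" "th (c \<odot>\<^bsub>Q\<^esub> C) = rs c * th C"
    using pr by (simp_all add: Uq_unfold th_cl free_algebra_closed emb_simps)
  show "c \<odot>\<^bsub>Q\<^esub> C \<in> carrier Q"
    using pr by (simp add: Uq_unfold free_algebra_closed)
  have add: "th (C \<oplus>\<^bsub>Q\<^esub> D) = th C + th D" if "C \<in> carrier Q" "D \<in> carrier Q" for C D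
    using that by (auto simp: Uq_unfold th_cl free_algebra_closed emb_simps)
  have "th \<zero>\<^bsub>Q\<^esub> = th \<zero>\<^bsub>Q\<^esub> + th \<zero>\<^bsub>Q\<^esub>"
    using add[of "\<zero>\<^bsub>Q\<^esub>" "\<zero>\<^bsub>Q\<^esub>"] by simp
  then have "th \<zero>\<^bsub>Q\<^esub> = 0" by simp
  then show "th (\<ominus>\<^bsub>Q\<^esub> C) = - th C"
    using add[of "\<ominus>\<^bsub>Q\<^esub> C" C] assms(1) by (simp add: Q.l_neg eq_neg_iff_add_eq_0)
qed

lemma th_unary:
  assumes "C \<in> carrier Q"
  shows "th (c \<odot>\<^bsub>Q\<^esub> C) = rs c * th C" "th (\<ominus>\<^bsub>Q\<^esub> C) = - th C" "c \<odot>\<^bsub>Q\<^esub> C \<in> carrier Q"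
  using th_simps0(3-5)[OF assms assms] by auto

lemmas th_simps = th_simps0(1,2) th_unary

lemma th_one: "th \<one>\<^bsub>Q\<^esub> = 1"
  by (simp add: Uq_unfold(2) th_cl one_closed_free_algebra emb_simps)

lemma th_gens:
  assumes "i \<in> {1..n+1}"
  shows "uqE n q i \<in> carrier Q" "uqF n q i \<in> carrier Q" "uqK n q i \<in> carrier Q" "uqKi n q i \<in> carrier Q"
    "th (uqE n q i) = rE i" "th (uqF n q i) = rF i" "th (uqK n q i) = rK i" "th (uqKi n q i) = rKi i"
proof -
  have "uqE n q i = cl (letter (GE i))" "uqF n q i = cl (letter (GF i))"
    "uqK n q i = cl (letter (GK i))" "uqKi n q i = cl (letter (GKi i))"
    by (simp_all add: uqE_def uqF_def uqK_def uqKi_def generator_class_def cl_def Uq_ideal_def)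
  then show "uqE n q i \<in> carrier Q" "uqF n q i \<in> carrier Q" "uqK n q i \<in> carrier Q" "uqKi n q i \<in> carrier Q"
    "th (uqE n q i) = rE i" "th (uqF n q i) = rF i" "th (uqK n q i) = rK i" "th (uqKi n q i) = rKi i"
    using gens_closed[OF assms] by (simp_all add: Uq_unfold(1) th_cl rE_def rF_def rK_def rKi_def)
qed

lemma th_minus:
  assumes "C \<in> carrier Q" "D \<in> carrier Q"
  shows "th (C \<ominus>\<^bsub>Q\<^esub> D) = th C - th D"
  using assms by (simp add: a_minus_def th_simps)

lemma th_B:
  assumes i: "i \<in> {1..n+1}"
  shows "uqB n q i \<in> carrier Q" "th (uqB n q i) = rB i"
proof -
  have idx: "n \<in> {1..n+1}" "n + 1 \<in> {1..n+1}" using n_ge by auto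
  note g = th_gens[OF i] th_gens[OF idx(1)] th_gens[OF idx(2)]
  have "uqB n q i = uqF n q i \<ominus>\<^bsub>Q\<^esub> uqKi n q i \<otimes>\<^bsub>Q\<^esub> uqE n q (flip n i)"
    by (simp add: uqB_def Let_def flip_def)
  moreover note th_gens[OF flip_closed[OF i]]
  ultimately show "uqB n q i \<in> carrier Q" "th (uqB n q i) = rB i"
    using g by (simp_all add: th_minus th_simps rB_eq[OF i])
qed

definition kc :: "(uq_gen word \<Rightarrow>\<^sub>0 'k) set" where "kc = uqK n q n \<otimes>\<^bsub>Q\<^esub> uqKi n q (n+1)"
definition kic :: "(uq_gen word \<Rightarrow>\<^sub>0 'k) set" where "kic = uqKi n q n \<otimes>\<^bsub>Q\<^esub> uqK n q (n+1)"

lemma th_kc: "kc \<in> carrier Q" "kic \<in> carrier Q" "th kc = kap" "th kic = kapi"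
proof -
  have idx: "n \<in> {1..n+1}" "n + 1 \<in> {1..n+1}" using n_ge by auto
  note g = th_gens[OF idx(1)] th_gens[OF idx(2)]
  show "kc \<in> carrier Q" "kic \<in> carrier Q" "th kc = kap" "th kic = kapi"
    using g by (simp_all add: kc_def kic_def kap_def kapi_def th_simps)
qed

lemma theta_torus_gens_eq: "theta_torus_gens n q = {kc, kic}"
  by (simp add: theta_torus_gens_def kc_def kic_def)

subsection \<open>Generated subalgebras\<close>

lemma scalars_closed: "range (\<lambda>c. c \<odot>\<^bsub>Q\<^esub> \<one>\<^bsub>Q\<^esub>) \<subseteq> carrier Q" "th (c \<odot>\<^bsub>Q\<^esub> \<one>\<^bsub>Q\<^esub>) = rs c"
  using th_unary[of "\<one>\<^bsub>Q\<^esub>"] by (auto simp: th_one)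

lemma generated_subring:
  assumes "H \<subseteq> carrier Q"
  shows "subring (generated_subalgebra Q H) Q"
  unfolding generated_subalgebra_def
  using assms scalars_closed by (intro Q.generate_ring_is_subring) auto

lemma generated_incl: "h \<in> H \<Longrightarrow> h \<in> generated_subalgebra Q H" "c \<odot>\<^bsub>Q\<^esub> \<one>\<^bsub>Q\<^esub> \<in> generated_subalgebra Q H"
  unfolding generated_subalgebra_def by (auto intro: generate_ring.incl)

text \<open>In a type-class ring, compatibility with 0 and with negatives follows from additivity.
  The lemma compares T_nT_(n+1) with an automorphism on the torus, each followed by
  \<open>th\<close>.\<close>

lemma generated_agree:
  fixes f g :: "_ \<Rightarrow> 'r::ring_1"
  assumes H: "H \<subseteq> carrier Q" and C: "C \<in> generated_subalgebra Q H"
    and f: "\<And>C D. C \<in> generated_subalgebra Q H \<Longrightarrow> D \<in> generated_subalgebra Q H \<Longrightarrow>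
        f (C \<oplus>\<^bsub>Q\<^esub> D) = f C + f D \<and> f (C \<otimes>\<^bsub>Q\<^esub> D) = f C * f D"
    and g: "\<And>C D. C \<in> generated_subalgebra Q H \<Longrightarrow> D \<in> generated_subalgebra Q H \<Longrightarrow>
        g (C \<oplus>\<^bsub>Q\<^esub> D) = g C + g D \<and> g (C \<otimes>\<^bsub>Q\<^esub> D) = g C * g D"
    and scal: "\<And>c. f (c \<odot>\<^bsub>Q\<^esub> \<one>\<^bsub>Q\<^esub>) = g (c \<odot>\<^bsub>Q\<^esub> \<one>\<^bsub>Q\<^esub>)" and gens: "\<And>h. h \<in> H \<Longrightarrow> f h = g h"
  shows "f C = g C"
proof -
  let ?S = "generated_subalgebra Q H"
  note S = subringE[OF generated_subring[OF H]]
  have one: "1 \<odot>\<^bsub>Q\<^esub> \<one>\<^bsub>Q\<^esub> = \<one>\<^bsub>Q\<^esub>"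
    using scalars_closed by (intro th_inj) (auto simp: th_one)
  have zero: "f' \<zero>\<^bsub>Q\<^esub> = 0" if "\<And>C D. C \<in> ?S \<Longrightarrow> D \<in> ?S \<Longrightarrow> f' (C \<oplus>\<^bsub>Q\<^esub> D) = f' C + f' D"
    for f' :: "_ \<Rightarrow> 'r"
    using that[OF S(2) S(2)] by simp
  have neg: "f' (\<ominus>\<^bsub>Q\<^esub> C) = - f' C" if f': "\<And>C D. C \<in> ?S \<Longrightarrow> D \<in> ?S \<Longrightarrow> f' (C \<oplus>\<^bsub>Q\<^esub> D) = f' C + f' D"
      and C: "C \<in> ?S" for f' :: "_ \<Rightarrow> 'r" and C
  proof -
    have "C \<in> carrier Q" using C S(1) by auto
    then have "f' (\<ominus>\<^bsub>Q\<^esub> C \<oplus>\<^bsub>Q\<^esub> C) = 0" using zero[of f', OF f'] by (simp add: Q.l_neg)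
    then show ?thesis using f'[OF S(5)[OF C] C] by (simp add: eq_neg_iff_add_eq_0)
  qed
  have "C \<in> generate_ring Q (range (\<lambda>c. c \<odot>\<^bsub>Q\<^esub> \<one>\<^bsub>Q\<^esub>) \<union> H)"
    using C by (simp add: generated_subalgebra_def)
  then show ?thesis
  proof (induction rule: generate_ring.induct)
    case one
    then show ?case using scal[of 1] one[symmetric] \<open>1 \<odot>\<^bsub>Q\<^esub> \<one>\<^bsub>Q\<^esub> = \<one>\<^bsub>Q\<^esub>\<close> by simp
  next
    case (incl h)
    then show ?case using scal gens by auto
  next
    case (a_inv h)
    then have "h \<in> ?S" by (simp add: generated_subalgebra_def)
    then show ?case using neg[of f h] neg[of g h] f g a_inv by auto
  next
    case (eng_add h1 h2)
    then have "h1 \<in> ?S" "h2 \<in> ?S" by (simp_all add: generated_subalgebra_def)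
    then show ?case using f g eng_add by auto
  next
    case (eng_mult h1 h2)
    then have "h1 \<in> ?S" "h2 \<in> ?S" by (simp_all add: generated_subalgebra_def)
    then show ?case using f g eng_mult by auto
  qed
qed

abbreviation "A \<equiv> Uqk n q"
abbreviation "S \<equiv> carrier (Uqk n q)"
abbreviation "Bc \<equiv> uqB n q"

lemma S_def': "S = generated_subalgebra Q (Bc ` {1..n+1} \<union> {kc, kic})"
  by (simp add: Uqk_def theta_torus_gens_eq)

lemma gens_in_Q: "Bc ` {1..n+1} \<union> {kc, kic} \<subseteq> carrier Q"
  using th_B(1) th_kc by auto

lemma S_subring: "subring S Q"
  unfolding S_def' by (rule generated_subring[OF gens_in_Q])

lemma S_carrier: "C \<in> S \<Longrightarrow> C \<in> carrier Q"
  using subringE(1)[OF S_subring] by auto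

lemma S_one: "\<one>\<^bsub>Q\<^esub> \<in> S"
  by (rule subringE(3)[OF S_subring])

lemma S_gens: "j \<in> {1..n+1} \<Longrightarrow> Bc j \<in> S" "kc \<in> S" "kic \<in> S" "c \<odot>\<^bsub>Q\<^esub> \<one>\<^bsub>Q\<^esub> \<in> S"
  unfolding S_def' by (rule generated_incl; auto)+

lemma A_ops: "C \<otimes>\<^bsub>A\<^esub> D = C \<otimes>\<^bsub>Q\<^esub> D" "C \<oplus>\<^bsub>A\<^esub> D = C \<oplus>\<^bsub>Q\<^esub> D" "c \<odot>\<^bsub>A\<^esub> C = c \<odot>\<^bsub>Q\<^esub> C"
  "\<one>\<^bsub>A\<^esub> = \<one>\<^bsub>Q\<^esub>" "\<zero>\<^bsub>A\<^esub> = \<zero>\<^bsub>Q\<^esub>"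
  by (simp_all add: Uqk_def)

lemma scale_eq: "C \<in> carrier Q \<Longrightarrow> c \<odot>\<^bsub>Q\<^esub> C = (c \<odot>\<^bsub>Q\<^esub> \<one>\<^bsub>Q\<^esub>) \<otimes>\<^bsub>Q\<^esub> C"
  using scalars_closed by (intro th_inj) (auto simp: th_simps image_subset_iff)

lemma S_closed0:
  assumes "C \<in> S" "D \<in> S"
  shows "C \<otimes>\<^bsub>Q\<^esub> D \<in> S" "C \<oplus>\<^bsub>Q\<^esub> D \<in> S" "c \<odot>\<^bsub>Q\<^esub> C \<in> S" "\<ominus>\<^bsub>Q\<^esub> C \<in> S" "C \<ominus>\<^bsub>Q\<^esub> D \<in> S"
  using assms S_gens(4) scale_eq[OF S_carrier[OF assms(1)]] subringE(5-7)[OF S_subring]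
  by (auto simp: a_minus_def)

lemma S_closed_unary:
  assumes "C \<in> S"
  shows "c \<odot>\<^bsub>Q\<^esub> C \<in> S" "\<ominus>\<^bsub>Q\<^esub> C \<in> S"
  using S_closed0(3,4)[OF assms assms] by auto

lemmas S_closed = S_closed0(1,2,5) S_closed_unary

lemma ring_A: "ring A"
proof -
  have "ring (Q\<lparr>carrier := S\<rparr>)" using Q.subring_is_ring[OF S_subring] .
  moreover have "Q\<lparr>carrier := S\<rparr> = A" by (simp add: Uqk_def)
  ultimately show ?thesis by simp
qed

lemma A_minus:
  assumes "C \<in> S" "D \<in> S"
  shows "C \<ominus>\<^bsub>A\<^esub> D = C \<ominus>\<^bsub>Q\<^esub> D"
proof -
  interpret A: ring A by (rule ring_A)
  have "\<ominus>\<^bsub>A\<^esub> D = \<ominus>\<^bsub>Q\<^esub> D"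
  proof (rule A.minus_equality)
    show "\<ominus>\<^bsub>Q\<^esub> D \<oplus>\<^bsub>A\<^esub> D = \<zero>\<^bsub>A\<^esub>" using assms S_carrier by (simp add: A_ops Q.l_neg)
  qed (use assms S_closed in auto)
  then show ?thesis by (simp add: a_minus_def A_ops)
qed

lemma th_q_comm:
  assumes "C \<in> S" "D \<in> S"
  shows "q_comm A q C D \<in> S" "th (q_comm A q C D) = th C * th D - rs q * (th D * th C)"
  unfolding q_comm_def A_ops
  by (simp_all add: A_minus S_closed assms th_minus th_simps S_carrier)

lemma th_S: "th ` S = BB"
proof
  show "th ` S \<subseteq> BB"
  proof safe
    fix C assume "C \<in> S"
    then have "C \<in> generate_ring Q (range (\<lambda>c. c \<odot>\<^bsub>Q\<^esub> \<one>\<^bsub>Q\<^esub>) \<union> (Bc ` {1..n+1} \<union> {kc, kic}))"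
      by (simp add: S_def' generated_subalgebra_def)
    then have "C \<in> carrier Q \<and> th C \<in> BB"
    proof (induction rule: generate_ring.induct)
      case one
      then show ?case using BB_closed(1)[of 1] by (simp add: th_one)
    next
      case (incl h)
      then show ?case
        using scalars_closed th_B th_kc BB_closed(1-4) by auto
    qed (auto simp: th_simps intro: BB_closed)
    then show "th C \<in> BB" by simp
  qed
  have w: "residue_scalar.eval_word U.kval (Word l) \<in> th ` S" for l
  proof (induction l)
    case Nil
    then show ?case using S_gens(4)[of 1] scalars_closed(2)[of 1] by (metis imageI residue_scalar.eval_word_Nil residue_scalar.sc_one)
  next
    case (Cons g l)
    then obtain C where C: "C \<in> S" "residue_scalar.eval_word U.kval (Word l) = th C" by auto
    have "\<exists>D\<in>S. th D = U.kval g"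
    proof (cases g)
      case (KB j)
      show ?thesis
      proof (cases "j \<in> {1..n+1}")
        case True
        then show ?thesis using KB S_gens(1)[OF True] th_B(2)[OF True] by auto
      next
        case False
        have "th (0 \<odot>\<^bsub>Q\<^esub> \<one>\<^bsub>Q\<^esub>) = 0" using scalars_closed(2)[of 0] by simp
        then show ?thesis using KB rB_zero[OF False] S_gens(4)[of 0] by auto
      qed
    qed (use S_gens th_kc in auto)
    then obtain D where D: "D \<in> S" "th D = U.kval g" by blast
    have "residue_scalar.eval_word U.kval (Word (g # l)) = th (D \<otimes>\<^bsub>Q\<^esub> C)"
      using C D by (simp add: residue_scalar.eval_word_Cons th_simps S_carrier)
    then show ?case using S_closed(1)[OF D(1) C(1)] by blast
  qed
  show "BB \<subseteq> th ` S"
  proof -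
    have "residue_scalar.ev U.kval f \<in> th ` S" for f
    proof (induction f rule: poly_mapping_linear_induct)
      case (word l)
      then show ?case using w by (simp add: residue_scalar.ev_single)
    next
      case (scale c p)
      then obtain C where "C \<in> S" "residue_scalar.ev U.kval p = th C" by auto
      then have "residue_scalar.ev U.kval (scalar c * p) = th (c \<odot>\<^bsub>Q\<^esub> C)" "c \<odot>\<^bsub>Q\<^esub> C \<in> S"
        by (simp_all add: residue_scalar.ev_mult th_simps S_carrier S_closed)
      then show ?case by blast
    next
      case (add p r)
      then obtain C D where "C \<in> S" "residue_scalar.ev U.kval p = th C"
        "D \<in> S" "residue_scalar.ev U.kval r = th D" by auto
      then have "residue_scalar.ev U.kval (p + r) = th (C \<oplus>\<^bsub>Q\<^esub> D)" "C \<oplus>\<^bsub>Q\<^esub> D \<in> S"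
        by (simp_all add: residue_scalar.ev_add th_simps S_carrier S_closed)
      then show ?case by blast
    qed
    then show ?thesis by (auto simp: BB_def)
  qed
qed

lemma th_inj_on: "inj_on th S"
  using th_inj S_carrier by (auto simp: inj_on_def)

definition "thi = inv_into S th"

lemma thi: "u \<in> BB \<Longrightarrow> thi u \<in> S" "u \<in> BB \<Longrightarrow> th (thi u) = u" "C \<in> S \<Longrightarrow> thi (th C) = C" "C \<in> S \<Longrightarrow> th C \<in> BB"
  using th_S th_inj_on unfolding thi_def
  by (auto intro: inv_into_into f_inv_into_f)

text \<open>Brings a map of \<open>BB\<close> back to the carrier of the coideal subalgebra;
  \<open>restrict\<close> meets the normalisation in \<open>algebra_auto\<close>.\<close>

definition "conj_auto h = restrict (\<lambda>C. thi (h (th C))) S"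

text \<open>The two-sided inverse \<open>h'\<close> gives bijectivity. The last conclusion has the
  shape in which the main theorem expresses the inverse automorphism.\<close>

lemma conj_auto:
  assumes "hom_on BB h" "\<And>u. u \<in> BB \<Longrightarrow> h u \<in> BB" "\<And>u. u \<in> BB \<Longrightarrow> h' u \<in> BB"
    "\<And>u. u \<in> BB \<Longrightarrow> h (h' u) = u" "\<And>u. u \<in> BB \<Longrightarrow> h' (h u) = u"
  shows "conj_auto h \<in> algebra_auto A" "C \<in> S \<Longrightarrow> th (conj_auto h C) = h (th C)" "C \<in> S \<Longrightarrow> conj_auto h C \<in> S"
    "restrict (inv_into S (conj_auto h)) S = conj_auto h'"
proof -
  show th: "th (conj_auto h C) = h (th C)" and cl: "conj_auto h C \<in> S" if "C \<in> S" for C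
    using that assms thi by (auto simp: conj_auto_def)
  have th': "th (conj_auto h' C) = h' (th C)" and cl': "conj_auto h' C \<in> S" if "C \<in> S" for C
    using that assms thi by (auto simp: conj_auto_def)
  have inv: "conj_auto h (conj_auto h' C) = C" and inv': "conj_auto h' (conj_auto h C) = C"
    if C: "C \<in> S" for C
    by (rule th_inj[OF S_carrier S_carrier]; simp add: C th cl th' cl' assms(4,5) thi(4))+
  have bij: "bij_betw (conj_auto h) S S"
    by (rule bij_betw_byWitness[where f' = "conj_auto h'"]) (use inv inv' cl cl' in auto)
  have hom: "conj_auto h (C \<otimes>\<^bsub>Q\<^esub> D) = conj_auto h C \<otimes>\<^bsub>Q\<^esub> conj_auto h D"
    "conj_auto h (C \<oplus>\<^bsub>Q\<^esub> D) = conj_auto h C \<oplus>\<^bsub>Q\<^esub> conj_auto h D"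
    "conj_auto h (c \<odot>\<^bsub>Q\<^esub> C) = c \<odot>\<^bsub>Q\<^esub> conj_auto h C" if CD: "C \<in> S" "D \<in> S" for C D c
  proof -
    note h = hom_on_BB[OF assms(1) thi(4)[OF CD(1)] thi(4)[OF CD(2)]]
    note h' = hom_on_BB[OF assms(1) BB_closed(1) thi(4)[OF CD(1)]]
    show "conj_auto h (C \<otimes>\<^bsub>Q\<^esub> D) = conj_auto h C \<otimes>\<^bsub>Q\<^esub> conj_auto h D"
      by (rule th_inj[OF S_carrier S_carrier]) (simp_all add: CD S_closed cl th th_simps S_carrier h)
    show "conj_auto h (C \<oplus>\<^bsub>Q\<^esub> D) = conj_auto h C \<oplus>\<^bsub>Q\<^esub> conj_auto h D"
      by (rule th_inj[OF S_carrier S_carrier]) (simp_all add: CD S_closed cl th th_simps S_carrier h)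
    show "conj_auto h (c \<odot>\<^bsub>Q\<^esub> C) = c \<odot>\<^bsub>Q\<^esub> conj_auto h C"
      by (rule th_inj[OF S_carrier S_carrier]) (simp_all add: CD S_closed cl th th_simps S_carrier h')
  qed
  have "conj_auto h \<one>\<^bsub>Q\<^esub> = \<one>\<^bsub>Q\<^esub>"
  proof (rule th_inj[OF S_carrier S_carrier])
    show "th (conj_auto h \<one>\<^bsub>Q\<^esub>) = th \<one>\<^bsub>Q\<^esub>"
      using hom_on_BB(3)[OF assms(1) BB_closed(1) BB_closed(1), of 1] by (simp add: th th_one S_one)
  qed (use cl S_one in auto)
  then have "conj_auto h \<in> ring_iso A A"
    using bij hom cl by (auto simp: ring_iso_def ring_hom_def A_ops)
  then show "conj_auto h \<in> algebra_auto A"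
    using hom by (auto simp: algebra_auto_def A_ops conj_auto_def)
  show "restrict (inv_into S (conj_auto h)) S = conj_auto h'"
  proof
    fix C
    show "restrict (inv_into S (conj_auto h)) S C = conj_auto h' C"
    proof (cases "C \<in> S")
      case True
      then have "inv_into S (conj_auto h) C = conj_auto h' C"
        using bij inv cl' by (intro inv_into_f_eq) (simp_all add: bij_betw_def)
      then show ?thesis using True by simp
    qed (simp add: conj_auto_def)
  qed
qed

text \<open>The opposite direction to \<open>conj_auto\<close>: it lets the given automorphisms
  tau_i be computed with inside the ring type.\<close>

definition "hat f u = th (f (thi u))"

lemma hat:
  assumes "f \<in> algebra_auto A"
  shows "hom_on BB (hat f)" "u \<in> BB \<Longrightarrow> hat f u \<in> BB" "C \<in> S \<Longrightarrow> f C \<in> S" "C \<in> S \<Longrightarrow> hat f (th C) = th (f C)"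
proof -
  have f_in: "f C \<in> S" and f_scale: "f (c \<odot>\<^bsub>Q\<^esub> C) = c \<odot>\<^bsub>Q\<^esub> f C" if "C \<in> S" for C c
    using assms that by (auto simp: algebra_auto_def ring_iso_def ring_hom_def A_ops)
  have f: "f (C \<otimes>\<^bsub>Q\<^esub> D) = f C \<otimes>\<^bsub>Q\<^esub> f D" "f (C \<oplus>\<^bsub>Q\<^esub> D) = f C \<oplus>\<^bsub>Q\<^esub> f D"
    if "C \<in> S" "D \<in> S" for C D
    using assms that by (auto simp: algebra_auto_def ring_iso_def ring_hom_def A_ops)
  have f_one: "f \<one>\<^bsub>Q\<^esub> = \<one>\<^bsub>Q\<^esub>"
    using assms by (auto simp: algebra_auto_def ring_iso_def ring_hom_def A_ops)
  show "C \<in> S \<Longrightarrow> f C \<in> S" for C by (rule f_in)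
  show val: "C \<in> S \<Longrightarrow> hat f (th C) = th (f C)" for C by (simp add: hat_def thi)
  show "u \<in> BB \<Longrightarrow> hat f u \<in> BB" for u unfolding hat_def by (intro thi f_in)
  show "hom_on BB (hat f)"
    unfolding hom_on_def
  proof (intro conjI ballI allI)
    fix u v assume "u \<in> BB" "v \<in> BB"
    then obtain C D where CD: "C \<in> S" "D \<in> S" "u = th C" "v = th D" using th_S by blast
    have "hat f (th (C \<oplus>\<^bsub>Q\<^esub> D)) = th (f C) + th (f D)" "hat f (th (C \<otimes>\<^bsub>Q\<^esub> D)) = th (f C) * th (f D)"
      by (simp_all only: val[OF S_closed(1)[OF CD(1,2)]] val[OF S_closed(2)[OF CD(1,2)]] f[OF CD(1,2)]
          th_simps0(1,2)[OF S_carrier[OF f_in[OF CD(1)]] S_carrier[OF f_in[OF CD(2)]]])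
    then show "hat f (u + v) = hat f u + hat f v" "hat f (u * v) = hat f u * hat f v"
      unfolding CD(3,4) th_simps0(1,2)[OF S_carrier[OF CD(1)] S_carrier[OF CD(2)], symmetric]
        val[OF CD(1)] val[OF CD(2)] .
  next
    fix c
    have "hat f (th (c \<odot>\<^bsub>Q\<^esub> \<one>\<^bsub>Q\<^esub>)) = th (c \<odot>\<^bsub>Q\<^esub> f \<one>\<^bsub>Q\<^esub>)"
      using f_scale[OF S_one, of c] S_gens(4) by (simp add: val)
    then show "hat f (rs c) = rs c" by (simp add: f_one scalars_closed)
  qed
qed

lemma auto_eqI:
  assumes "f \<in> algebra_auto A" "g \<in> algebra_auto A"
    and "\<And>j. j \<in> {1..n+1} \<Longrightarrow> f (Bc j) = g (Bc j)" "f kc = g kc" "f kic = g kic"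
  shows "f = g"
proof (rule extensionalityI)
  show "f \<in> extensional S" "g \<in> extensional S" using assms by (auto simp: algebra_auto_def)
  fix C assume C: "C \<in> S"
  have "hat f (th C) = hat g (th C)"
  proof (rule hom_on_BB_eqI[OF hat(1)[OF assms(1)] hat(1)[OF assms(2)] _ _ _ thi(4)[OF C]])
    show "hat f (rB j) = hat g (rB j)" if "j \<in> {1..n+1}" for j
      using hat(4)[OF assms(1) S_gens(1)[OF that]] hat(4)[OF assms(2) S_gens(1)[OF that]] assms(3)[OF that] th_B(2)[OF that]
      by simp
    show "hat f kap = hat g kap" "hat f kapi = hat g kapi"
      using hat(4)[OF assms(1) S_gens(2)] hat(4)[OF assms(2) S_gens(2)]
        hat(4)[OF assms(1) S_gens(3)] hat(4)[OF assms(2) S_gens(3)] assms(4,5) th_kc by simp_all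
  qed
  then have "th (f C) = th (g C)" using hat(4)[OF assms(1) C] hat(4)[OF assms(2) C] by simp
  then show "f C = g C" using hat(3)[OF assms(1) C] hat(3)[OF assms(2) C] S_carrier th_inj by blast
qed

end

section \<open>The Lusztig automorphisms on the torus\<close>

locale uq_lusztig = uq_generic n q for n and q :: "'k::field" +
  fixes T :: "nat \<Rightarrow> (uq_gen word \<Rightarrow>\<^sub>0 'k) set \<Rightarrow> (uq_gen word \<Rightarrow>\<^sub>0 'k) set"
  assumes lusztig: "i \<in> {1..n+1} \<Longrightarrow> lusztig_auto n q i (T i)"
begin

interpretation Q: ring Q by (rule ring_Uq)

lemma T_hom:
  assumes i: "i \<in> {1..n+1}"
  shows "C \<in> carrier Q \<Longrightarrow> T i C \<in> carrier Q"
    "C \<in> carrier Q \<Longrightarrow> D \<in> carrier Q \<Longrightarrow> T i (C \<otimes>\<^bsub>Q\<^esub> D) = T i C \<otimes>\<^bsub>Q\<^esub> T i D"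
    "C \<in> carrier Q \<Longrightarrow> D \<in> carrier Q \<Longrightarrow> T i (C \<oplus>\<^bsub>Q\<^esub> D) = T i C \<oplus>\<^bsub>Q\<^esub> T i D"
    "T i \<one>\<^bsub>Q\<^esub> = \<one>\<^bsub>Q\<^esub>" "C \<in> carrier Q \<Longrightarrow> T i (c \<odot>\<^bsub>Q\<^esub> C) = c \<odot>\<^bsub>Q\<^esub> T i C"
    "j \<in> {1..n+1} \<Longrightarrow> T i (uqK n q j) = uqK n q j \<otimes>\<^bsub>Q\<^esub> (uqK n q i [^]\<^bsub>Q\<^esub> (- cartan_D n i j))"
  using lusztig[OF i] by (auto simp: lusztig_auto_def Let_def algebra_auto_def ring_iso_def ring_hom_def)

text \<open>\<open>lusztig_auto\<close> prescribes T_i on K_j only; its value on K_j^{-1} is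
  recovered from these equations.\<close>

lemma T_K_Ki:
  assumes i: "i \<in> {1..n+1}" and j: "j \<in> {1..n+1}"
  shows "th (T i (uqK n q j)) * th (T i (uqKi n q j)) = 1"
    "th (T i (uqKi n q j)) * th (T i (uqK n q j)) = 1"
proof -
  note g = th_gens[OF j]
  have "uqK n q j \<otimes>\<^bsub>Q\<^esub> uqKi n q j = \<one>\<^bsub>Q\<^esub>" "uqKi n q j \<otimes>\<^bsub>Q\<^esub> uqK n q j = \<one>\<^bsub>Q\<^esub>"
    by (rule th_inj; simp add: g th_simps th_one Uq_relations(1,2)[OF j j])+
  from this[THEN arg_cong[where f = "\<lambda>C. th (T i C)"]]
  show "th (T i (uqK n q j)) * th (T i (uqKi n q j)) = 1"
    "th (T i (uqKi n q j)) * th (T i (uqK n q j)) = 1"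
    by (simp_all add: T_hom[OF i] g th_simps th_one)
qed

lemma K_pow:
  assumes i: "i \<in> {1..n+1}"
  shows "uqK n q i [^]\<^bsub>Q\<^esub> (0::int) = \<one>\<^bsub>Q\<^esub>" "uqK n q i [^]\<^bsub>Q\<^esub> (1::int) = uqK n q i"
    "uqK n q i [^]\<^bsub>Q\<^esub> (-2::int) = uqKi n q i \<otimes>\<^bsub>Q\<^esub> uqKi n q i"
proof -
  note g = th_gens[OF i]
  show "uqK n q i [^]\<^bsub>Q\<^esub> (0::int) = \<one>\<^bsub>Q\<^esub>" by simp
  show "uqK n q i [^]\<^bsub>Q\<^esub> (1::int) = uqK n q i"
    using g by (simp add: int_pow_def2)
  have two: "uqK n q i [^]\<^bsub>Q\<^esub> (2::nat) = uqK n q i \<otimes>\<^bsub>Q\<^esub> uqK n q i"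
    using g by (simp add: numeral_2_eq_2)
  note r = Uq_relations(1,2)[OF i i]
  have "uqKi n q i \<otimes>\<^bsub>Q\<^esub> uqKi n q i = inv\<^bsub>Q\<^esub> (uqK n q i \<otimes>\<^bsub>Q\<^esub> uqK n q i)"
  proof (rule Q.inv_unique')
    show "uqK n q i \<otimes>\<^bsub>Q\<^esub> uqK n q i \<otimes>\<^bsub>Q\<^esub> (uqKi n q i \<otimes>\<^bsub>Q\<^esub> uqKi n q i) = \<one>\<^bsub>Q\<^esub>"
      "uqKi n q i \<otimes>\<^bsub>Q\<^esub> uqKi n q i \<otimes>\<^bsub>Q\<^esub> (uqK n q i \<otimes>\<^bsub>Q\<^esub> uqK n q i) = \<one>\<^bsub>Q\<^esub>"
      by (rule th_inj; simp add: g th_simps th_one mult.assoc mult_assoc_ext[OF r(1)] mult_assoc_ext[OF r(2)] r)+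
  qed (use g in auto)
  then show "uqK n q i [^]\<^bsub>Q\<^esub> (-2::int) = uqKi n q i \<otimes>\<^bsub>Q\<^esub> uqKi n q i"
    by (simp add: int_pow_def2 two)
qed

lemma T_diag:
  assumes i: "i \<in> {1..n+1}"
  shows "T i (uqK n q i) = uqKi n q i" "T i (uqKi n q i) = uqK n q i"
proof -
  note g = th_gens[OF i] and r = Uq_relations(1,2)[OF i i]
  have "th (T i (uqK n q i)) = rKi i"
    by (simp add: T_hom(6)[OF i i] K_pow[OF i] th_simps g mult_assoc_ext[OF r(1)])
  then show *: "T i (uqK n q i) = uqKi n q i"
    using g by (intro th_inj) (simp_all add: T_hom[OF i])
  have "th (T i (uqKi n q i)) = rK i * (rKi i * th (T i (uqKi n q i)))"
    by (simp add: mult.assoc[symmetric] r)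
  also have "\<dots> = rK i" using T_K_Ki(1)[OF i i] by (simp add: * g)
  finally show "T i (uqKi n q i) = uqK n q i"
    using g by (intro th_inj) (simp_all add: T_hom[OF i])
qed

lemma T_off:
  assumes i: "i \<in> {1..n+1}" and j: "j \<in> {1..n+1}" and a: "cartan_D n i j = 0"
  shows "T i (uqK n q j) = uqK n q j" "T i (uqKi n q j) = uqKi n q j"
proof -
  note g = th_gens[OF j] and r = Uq_relations(1,2)[OF j j]
  show *: "T i (uqK n q j) = uqK n q j"
    using g by (simp add: T_hom(6)[OF i j] a)
  have "th (T i (uqKi n q j)) = rKi j * (rK j * th (T i (uqKi n q j)))"
    by (simp add: mult.assoc[symmetric] r)
  also have "\<dots> = rKi j" using T_K_Ki(1)[OF i j] by (simp add: * g)
  finally show "T i (uqKi n q j) = uqKi n q j"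
    using g by (intro th_inj) (simp_all add: T_hom[OF i])
qed

lemma idx: "n \<in> {1..n+1}" "n + 1 \<in> {1..n+1}" "n - 1 \<in> {1..n+1}" "n - 2 \<in> {1..n+1}"
  using n_ge by auto

text \<open>The nodes n and n+1 are not joined, so each of T_n, T_(n+1) inverts its own K and fixes
  the other one.\<close>

lemma T_end_kc: "T n (T (n+1) kc) = kic" "T n (T (n+1) kic) = kc"
proof -
  note a = cartan_D_end(3,4)[OF n_ge]
  note g = th_gens[OF idx(1)] th_gens[OF idx(2)]
  note t = T_diag[OF idx(1)] T_diag[OF idx(2)] T_off[OF idx(1,2) a(1)] T_off[OF idx(2,1) a(2)]
    T_hom(2)[OF idx(1)] T_hom(2)[OF idx(2)]
  show "T n (T (n+1) kc) = kic" "T n (T (n+1) kic) = kc"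
    unfolding kc_def kic_def by (simp_all only: t g)
qed

text \<open>Below n the Cartan entries at n and n+1 agree, so T_i multiplies K_n and K_(n+1) by the
  same power of K_i, which cancels in the quotient.\<close>

lemma T_small_kc:
  assumes "i \<in> {1..n-1}"
  shows "T i kc = kc" "T i kic = kic"
proof -
  have i: "i \<in> {1..n+1}" "i < n" using assms n_ge by auto
  note g = th_gens[OF idx(1)] th_gens[OF idx(2)] and gi = th_gens[OF i(1)]
  let ?P = "uqK n q i [^]\<^bsub>Q\<^esub> (- cartan_D n i n)"
  have a: "cartan_D n i (n+1) = cartan_D n i n"
    using cartan_D_flip(1)[OF i(2), of n] by (simp add: flip_def)
  have "cartan_D n i n = 0 \<or> cartan_D n i n = -1" using i(2) by (auto simp: cartan_D_def)
  then have P: "?P \<in> carrier Q" using K_pow[OF i(1)] gi by auto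
  note t = T_hom[OF i(1)]
  have tK: "th (T i (uqK n q n)) = rK n * th ?P" "th (T i (uqK n q (n+1))) = rK (n+1) * th ?P"
    using P g by (simp_all only: t(6)[OF idx(1)] t(6)[OF idx(2)] a th_simps)
  let ?R = "th (T i (uqKi n q (n+1)))"
  \<comment> \<open>The image of K_(n+1)^{-1} is isolated from the equation T_i(K_(n+1))
    T_i(K_(n+1)^{-1}) = 1.\<close>
  have "rKi (n+1) = rKi (n+1) * (rK (n+1) * th ?P * ?R)"
    using T_K_Ki(1)[OF i(1) idx(2)] by (simp only: tK mult_1_right)
  also have "\<dots> = th ?P * ?R"
    by (simp only: mult.assoc mult_assoc_ext[OF Uq_relations(2)[OF idx(2,2)]] mult_1_left)
  finally have "th ?P * ?R = rKi (n+1)" by simp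
  moreover have "th (T i kc) = th (T i (uqK n q n)) * ?R"
    unfolding kc_def using g by (simp only: t th_simps)
  ultimately have kc': "th (T i kc) = kap" by (simp only: tK mult.assoc kap_def)
  then show "T i kc = kc" using th_kc by (intro th_inj) (simp_all add: t)
  have "kic \<otimes>\<^bsub>Q\<^esub> kc = \<one>\<^bsub>Q\<^esub>"
    by (rule th_inj) (simp_all add: th_simps th_kc th_one kap_kapi)
  from arg_cong[OF this, of "\<lambda>C. th (T i C)"]
  have *: "th (T i kic) * kap = 1" by (simp add: t th_kc th_simps kc' th_one)
  have "th (T i kic) = th (T i kic) * kap * kapi" by (simp only: mult.assoc kap_kapi mult_1_right)
  then have "th (T i kic) = kapi" by (simp only: * mult_1_left)
  then show "T i kic = kic" using th_kc by (intro th_inj) (simp_all add: t)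
qed

lemma theta_torus_eq: "theta_torus n q = generated_subalgebra Q {kc, kic}"
  by (simp add: theta_torus_def theta_torus_gens_eq)

lemma torus_gens: "kc \<in> theta_torus n q" "kic \<in> theta_torus n q"
  unfolding theta_torus_eq by (auto intro: generated_incl)

lemma theta_torus_subset: "theta_torus n q \<subseteq> S"
  unfolding theta_torus_eq generated_subalgebra_def
proof (rule Q.generate_ring_min_subring1[OF _ S_subring])
  show "range (\<lambda>c. c \<odot>\<^bsub>Q\<^esub> \<one>\<^bsub>Q\<^esub>) \<union> {kc, kic} \<subseteq> S" using S_gens by auto
  show "range (\<lambda>c. c \<odot>\<^bsub>Q\<^esub> \<one>\<^bsub>Q\<^esub>) \<union> {kc, kic} \<subseteq> carrier Q" using scalars_closed(1) th_kc by auto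
qed

lemma torus_agree:
  assumes f: "f \<in> algebra_auto A" "f kc = kic" "f kic = kc" and "C \<in> theta_torus n q"
  shows "f C = T n (T (n+1) C)"
proof -
  have sub: "C \<in> S" "C \<in> carrier Q" if "C \<in> generated_subalgebra Q {kc, kic}" for C
    using that theta_torus_subset S_carrier unfolding theta_torus_eq by auto
  have "th (f C) = th (T n (T (n+1) C))"
  proof (rule generated_agree[of "{kc, kic}" C "\<lambda>C. th (f C)" "\<lambda>C. th (T n (T (n+1) C))"])
    show "{kc, kic} \<subseteq> carrier Q" using th_kc by auto
    show "C \<in> generated_subalgebra Q {kc, kic}" using assms(4) by (simp add: theta_torus_eq)
    fix C D assume CD: "C \<in> generated_subalgebra Q {kc, kic}" "D \<in> generated_subalgebra Q {kc, kic}"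
    have "f (C \<oplus>\<^bsub>Q\<^esub> D) = f C \<oplus>\<^bsub>Q\<^esub> f D \<and> f (C \<otimes>\<^bsub>Q\<^esub> D) = f C \<otimes>\<^bsub>Q\<^esub> f D \<and> f C \<in> S \<and> f D \<in> S"
      using f(1) sub[OF CD(1)] sub[OF CD(2)] by (auto simp: algebra_auto_def ring_iso_def ring_hom_def A_ops)
    then show "th (f (C \<oplus>\<^bsub>Q\<^esub> D)) = th (f C) + th (f D) \<and> th (f (C \<otimes>\<^bsub>Q\<^esub> D)) = th (f C) * th (f D)"
      by (simp add: th_simps S_carrier)
    show "th (T n (T (n+1) (C \<oplus>\<^bsub>Q\<^esub> D))) = th (T n (T (n+1) C)) + th (T n (T (n+1) D)) \<and>
        th (T n (T (n+1) (C \<otimes>\<^bsub>Q\<^esub> D))) = th (T n (T (n+1) C)) * th (T n (T (n+1) D))"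
      using sub[OF CD(1)] sub[OF CD(2)] T_hom[OF idx(1)] T_hom[OF idx(2)] by (simp add: th_simps)
  next
    fix c
    have "f (c \<odot>\<^bsub>Q\<^esub> \<one>\<^bsub>Q\<^esub>) = c \<odot>\<^bsub>Q\<^esub> \<one>\<^bsub>Q\<^esub>"
      using f(1) S_one by (auto simp: algebra_auto_def ring_iso_def ring_hom_def A_ops)
    then show "th (f (c \<odot>\<^bsub>Q\<^esub> \<one>\<^bsub>Q\<^esub>)) = th (T n (T (n+1) (c \<odot>\<^bsub>Q\<^esub> \<one>\<^bsub>Q\<^esub>)))"
      using T_hom(4,5)[OF idx(1)] T_hom(4,5)[OF idx(2)] by simp
  next
    fix h assume "h \<in> {kc, kic}"
    then show "th (f h) = th (T n (T (n+1) h))" using f T_end_kc by auto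
  qed
  then show ?thesis
    using hat(3)[OF f(1)] sub assms(4) T_hom(1)[OF idx(1)] T_hom(1)[OF idx(2)] S_carrier
    unfolding theta_torus_eq by (intro th_inj) auto
qed

section \<open>The operators at the end of the diagram\<close>

text \<open>Copied literally from \<open>is_tau_n_minus\<close>, so that
  \<open>is_tau_n_minus_iff\<close> holds by reflexivity and the formula can be studied apart from
  the automorphism.\<close>

definition "expr_minus j =
   (if j = n - 1 then
      inverse q \<odot>\<^bsub>A\<^esub> q_comm A q (Bc n) (q_comm A q (Bc (n+1)) (Bc (n-1)))
        \<oplus>\<^bsub>A\<^esub> Bc (n-1) \<otimes>\<^bsub>A\<^esub> uqK n q n \<otimes>\<^bsub>A\<^esub> uqKi n q (n+1)
    else if j = n then inverse q \<odot>\<^bsub>A\<^esub> (uqK n q n \<otimes>\<^bsub>A\<^esub> uqKi n q (n+1) \<otimes>\<^bsub>A\<^esub> Bc (n+1))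
    else if j = n + 1 then inverse q \<odot>\<^bsub>A\<^esub> (uqK n q (n+1) \<otimes>\<^bsub>A\<^esub> uqKi n q n \<otimes>\<^bsub>A\<^esub> Bc n)
    else Bc j)"

definition "expr_plus j =
   (if j = n - 1 then
      inverse q \<odot>\<^bsub>A\<^esub> q_comm A q (q_comm A q (Bc (n-1)) (Bc n)) (Bc (n+1))
        \<oplus>\<^bsub>A\<^esub> Bc (n-1) \<otimes>\<^bsub>A\<^esub> uqK n q n \<otimes>\<^bsub>A\<^esub> uqKi n q (n+1)
    else if j = n then q \<odot>\<^bsub>A\<^esub> (uqK n q (n+1) \<otimes>\<^bsub>A\<^esub> uqKi n q n \<otimes>\<^bsub>A\<^esub> Bc (n+1))
    else if j = n + 1 then q \<odot>\<^bsub>A\<^esub> (uqK n q n \<otimes>\<^bsub>A\<^esub> uqKi n q (n+1) \<otimes>\<^bsub>A\<^esub> Bc n)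
    else Bc j)"

lemma is_tau_n_minus_iff: "is_tau_n_minus n q T f \<longleftrightarrow> f \<in> algebra_auto A \<and>
    (\<forall>x \<in> theta_torus n q. f x = T n (T (n+1) x)) \<and> (\<forall>j \<in> {1..n+1}. f (Bc j) = expr_minus j)"
  unfolding is_tau_n_minus_def Let_def expr_minus_def by (rule refl)

lemma is_tau_n_iff: "is_tau_n n q T f \<longleftrightarrow> f \<in> algebra_auto A \<and>
    (\<forall>x \<in> theta_torus n q. f x = T n (T (n+1) x)) \<and> (\<forall>j \<in> {1..n+1}. f (Bc j) = expr_plus j)"
  unfolding is_tau_n_def Let_def expr_plus_def by (rule refl)

lemma kic_alt: "uqK n q (n+1) \<otimes>\<^bsub>Q\<^esub> uqKi n q n = kic"
proof (rule th_inj)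
  note g = th_gens[OF idx(1)] th_gens[OF idx(2)]
  show "th (uqK n q (n+1) \<otimes>\<^bsub>Q\<^esub> uqKi n q n) = th kic"
    using g K_rules(6)[OF idx(1,2)] by (simp only: th_simps th_kc kapi_def)
qed (use th_gens[OF idx(1)] th_gens[OF idx(2)] th_kc in auto)

lemma x_kc: "Bc (n-1) \<otimes>\<^bsub>Q\<^esub> uqK n q n \<otimes>\<^bsub>Q\<^esub> uqKi n q (n+1) = Bc (n-1) \<otimes>\<^bsub>Q\<^esub> kc"
  unfolding kc_def
  by (rule Q.m_assoc) (use th_gens[OF idx(1)] th_gens[OF idx(2)] th_B(1)[OF idx(3)] in auto)

lemma th_expr:
  assumes j: "j \<in> {1..n+1}"
  shows "expr_minus j \<in> S" "th (expr_minus j) = G.image_minus j"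
    "expr_plus j \<in> S" "th (expr_plus j) = G.image_plus j"
proof -
  note b = S_gens(1)[OF idx(1)] S_gens(1)[OF idx(2)] S_gens(1)[OF idx(3)] S_gens(1)[OF j] S_gens(2,3)
  note t = th_B(2)[OF idx(1)] th_B(2)[OF idx(2)] th_B(2)[OF idx(3)] th_B(2)[OF j] th_kc(3,4)
  have n: "n \<noteq> n - 1" "n + 1 \<noteq> n - 1" "n + 1 \<noteq> n" using n_ge by auto
  note e = expr_minus_def expr_plus_def A_ops kc_def[symmetric] kic_alt x_kc
  note simps = if_True if_False n refl b t th_q_comm S_closed th_simps S_carrier
  consider "j = n - 1" | "j = n" | "j = n + 1" | "j \<noteq> n - 1" "j \<noteq> n" "j \<noteq> n + 1" by blast
  then have "expr_minus j \<in> S \<and> th (expr_minus j) = G.image_minus j \<and> expr_plus j \<in> S \<and> th (expr_plus j) = G.image_plus j"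
  proof cases
    case 1
    show ?thesis unfolding 1 G.image_minus_simps(1) G.image_plus_simps(1) G.S4.x1_altdef G.S4.x2_def e
      by (simp only: simps simp_thms)
  next
    case 2
    show ?thesis unfolding 2 G.image_minus_simps(2) G.image_plus_simps(2) G.S4.b1_def G.S4.b2_def e
      by (simp only: simps simp_thms)
  next
    case 3
    show ?thesis unfolding 3 G.image_minus_simps(3) G.image_plus_simps(3) G.S4.c1_def G.S4.c2_def e
      by (simp only: simps simp_thms)
  next
    case 4
    then show ?thesis using b t G.image_minus_simps(4)[OF 4] G.image_plus_simps(4)[OF 4]
      by (simp add: expr_minus_def expr_plus_def)
  qed
  then show "expr_minus j \<in> S" "th (expr_minus j) = G.image_minus j"
    "expr_plus j \<in> S" "th (expr_plus j) = G.image_plus j" by blast+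
qed

lemma image_in_BB: "G.image_minus j \<in> BB" "G.image_plus j \<in> BB"
proof -
  have "G.S4.x1 \<in> BB" "G.S4.b1 \<in> BB" "G.S4.c1 \<in> BB" "G.S4.x2 \<in> BB" "G.S4.b2 \<in> BB" "G.S4.c2 \<in> BB"
    unfolding G.S4.x1_altdef G.S4.b1_def G.S4.c1_def G.S4.x2_def G.S4.b2_def G.S4.c2_def
    by (intro BB_closed)+
  then show "G.image_minus j \<in> BB" "G.image_plus j \<in> BB"
    using BB_closed(2)[of j] by (auto simp: G.image_minus_def G.image_plus_def)
qed

end

context uq_generic
begin

text \<open>The new generators are polynomials in the old ones, so a homomorphism acts on them by
  substitution. Here \<open>h\<close> is taken to be tau_n^-, tau_n or one of the tau_i.\<close>

lemma hom_images:
  assumes "hom_on BB h"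
  shows "h G.S4.x1 = rs (inverse q) * (h (rB n) * (h (rB (n+1)) * h (rB (n-1)) - rs q * (h (rB (n-1)) * h (rB (n+1))))
      - rs q * ((h (rB (n+1)) * h (rB (n-1)) - rs q * (h (rB (n-1)) * h (rB (n+1)))) * h (rB n))) + h (rB (n-1)) * h kap"
    "h G.S4.x2 = rs (inverse q) * ((h (rB (n-1)) * h (rB n) - rs q * (h (rB n) * h (rB (n-1)))) * h (rB (n+1))
      - rs q * (h (rB (n+1)) * (h (rB (n-1)) * h (rB n) - rs q * (h (rB n) * h (rB (n-1)))))) + h (rB (n-1)) * h kap"
    "h G.S4.b1 = rs (inverse q) * (h kap * h (rB (n+1)))" "h G.S4.c1 = rs (inverse q) * (h kapi * h (rB n))"
    "h G.S4.b2 = rs q * (h kapi * h (rB (n+1)))" "h G.S4.c2 = rs q * (h kap * h (rB n))"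
proof -
  note H = hom_on_BB(1,2,5)[OF assms] hom_on_BB(3)[OF assms BB_closed(1) BB_closed(1)] BB_closed
  show "h G.S4.x1 = rs (inverse q) * (h (rB n) * (h (rB (n+1)) * h (rB (n-1)) - rs q * (h (rB (n-1)) * h (rB (n+1))))
      - rs q * ((h (rB (n+1)) * h (rB (n-1)) - rs q * (h (rB (n-1)) * h (rB (n+1)))) * h (rB n))) + h (rB (n-1)) * h kap"
    unfolding G.S4.x1_altdef by (simp only: H)
  show "h G.S4.x2 = rs (inverse q) * ((h (rB (n-1)) * h (rB n) - rs q * (h (rB n) * h (rB (n-1)))) * h (rB (n+1))
      - rs q * (h (rB (n+1)) * (h (rB (n-1)) * h (rB n) - rs q * (h (rB n) * h (rB (n-1)))))) + h (rB (n-1)) * h kap"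
    unfolding G.S4.x2_def by (simp only: H)
  show "h G.S4.b1 = rs (inverse q) * (h kap * h (rB (n+1)))" "h G.S4.c1 = rs (inverse q) * (h kapi * h (rB n))"
    "h G.S4.b2 = rs q * (h kapi * h (rB (n+1)))" "h G.S4.c2 = rs q * (h kap * h (rB n))"
    unfolding G.S4.b1_def G.S4.c1_def G.S4.b2_def G.S4.c2_def by (simp_all only: H)
qed

lemma hom_on_comp:
  assumes "hom_on BB h" "hom_on BB g" "\<And>u. u \<in> BB \<Longrightarrow> g u \<in> BB"
  shows "hom_on BB (\<lambda>u. h (g u))"
  using assms by (simp add: hom_on_def)

lemma hom_on_id: "hom_on BB (\<lambda>u. u)"
  by (simp add: hom_on_def)

definition is_minus :: "((uq_gen word \<Rightarrow>\<^sub>0 'k) residues \<Rightarrow> (uq_gen word \<Rightarrow>\<^sub>0 'k) residues) \<Rightarrow> bool" where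
  "is_minus h \<longleftrightarrow> hom_on BB h \<and> (\<forall>u\<in>BB. h u \<in> BB) \<and> (\<forall>j. h (rB j) = G.image_minus j) \<and> h kap = kapi \<and> h kapi = kap"

definition is_plus :: "((uq_gen word \<Rightarrow>\<^sub>0 'k) residues \<Rightarrow> (uq_gen word \<Rightarrow>\<^sub>0 'k) residues) \<Rightarrow> bool" where
  "is_plus h \<longleftrightarrow> hom_on BB h \<and> (\<forall>u\<in>BB. h u \<in> BB) \<and> (\<forall>j. h (rB j) = G.image_plus j) \<and> h kap = kapi \<and> h kapi = kap"

lemma rs_cancel: "rs q * (rs (inverse q) * u) = u" "rs (inverse q) * (rs q * u) = u"
  by (simp_all only: mult_assoc_ext[OF q_qi] mult_assoc_ext[OF qi_q] mult_1_left)

lemma kap_cancel: "kap * (kapi * u) = u" "kapi * (kap * u) = u"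
  by (simp_all only: mult_assoc_ext[OF kap_kapi(1)] mult_assoc_ext[OF kap_kapi(2)] mult_1_left)

text \<open>Both composites are homomorphisms and are compared with the identity on generators. Only
  B_(n-1) needs a real computation; at n and n+1 the scalars and torus factors cancel.\<close>

lemma minus_plus:
  assumes m: "is_minus h" and p: "is_plus g" and u: "u \<in> BB"
  shows "h (g u) = u" "g (h u) = u"
proof -
  have hm: "hom_on BB h" "u \<in> BB \<Longrightarrow> h u \<in> BB" "h (rB j) = G.image_minus j" "h kap = kapi" "h kapi = kap" for u j
    using m by (auto simp: is_minus_def)
  have hp: "hom_on BB g" "u \<in> BB \<Longrightarrow> g u \<in> BB" "g (rB j) = G.image_plus j" "g kap = kapi" "g kapi = kap" for u j
    using p by (auto simp: is_plus_def)
  note im = G.image_minus_simps(1-3) G.image_plus_simps(1-3)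
  have central: "kap * (rs c * u) = rs c * (kap * u)" "kapi * (rs c * u) = rs c * (kapi * u)" for c u
    by (rule residue_scalar.sc_left_commute)+
  show "h (g u) = u"
  proof (rule hom_on_BB_eqI[OF hom_on_comp[OF hm(1) hp(1,2)] hom_on_id _ _ _ u])
    fix j
    consider "j = n - 1" | "j = n" | "j = n + 1" | "j \<noteq> n - 1" "j \<noteq> n" "j \<noteq> n + 1" by blast
    then show "h (g (rB j)) = rB j"
    proof cases
      case 1
      show ?thesis unfolding 1 hp(3) im hom_images(2)[OF hm(1)] hm(3,4) by (rule G.S4.inverse_after_image)
    next
      case 2
      show ?thesis unfolding 2 hp(3) im hom_images(5)[OF hm(1)] hm(3,5) G.S4.c1_def central
        by (simp only: rs_cancel kap_cancel)
    next
      case 3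
      show ?thesis unfolding 3 hp(3) im hom_images(6)[OF hm(1)] hm(3,4) G.S4.b1_def central
        by (simp only: rs_cancel kap_cancel)
    next
      case 4
      show ?thesis by (simp only: hp(3) hm(3) G.image_minus_simps(4)[OF 4] G.image_plus_simps(4)[OF 4])
    qed
  qed (simp_all only: hm hp)
  show "g (h u) = u"
  proof (rule hom_on_BB_eqI[OF hom_on_comp[OF hp(1) hm(1,2)] hom_on_id _ _ _ u])
    fix j
    consider "j = n - 1" | "j = n" | "j = n + 1" | "j \<noteq> n - 1" "j \<noteq> n" "j \<noteq> n + 1" by blast
    then show "g (h (rB j)) = rB j"
    proof cases
      case 1
      show ?thesis unfolding 1 hm(3) im hom_images(1)[OF hp(1)] hp(3,4) by (rule G.S4.image_after_inverse)
    next
      case 2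
      show ?thesis unfolding 2 hm(3) im hom_images(3)[OF hp(1)] hp(3,4) G.S4.c2_def central
        by (simp only: rs_cancel kap_cancel)
    next
      case 3
      show ?thesis unfolding 3 hm(3) im hom_images(4)[OF hp(1)] hp(3,5) G.S4.b2_def central
        by (simp only: rs_cancel kap_cancel)
    next
      case 4
      show ?thesis by (simp only: hp(3) hm(3) G.image_minus_simps(4)[OF 4] G.image_plus_simps(4)[OF 4])
    qed
  qed (simp_all only: hm hp)
qed

end

context uq_lusztig
begin

lemma end_homs: obtains h g where "is_minus h" "is_plus g"
proof -
  obtain h where "hom_on BB h" "\<And>u. u \<in> BB \<Longrightarrow> h u \<in> BB" "\<And>j. h (rB j) = G.image_minus j" "h kap = kapi" "h kapi = kap"
    using extend_tuple[OF G.kolb_tuple_image_minus image_in_BB(1) BB_closed(4,3)] by blast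
  moreover obtain g where "hom_on BB g" "\<And>u. u \<in> BB \<Longrightarrow> g u \<in> BB" "\<And>j. g (rB j) = G.image_plus j" "g kap = kapi" "g kapi = kap"
    using extend_tuple[OF G.kolb_tuple_image_plus image_in_BB(2) BB_closed(4,3)] by blast
  ultimately have "is_minus h" "is_plus g" unfolding is_minus_def is_plus_def by blast+
  then show ?thesis by (rule that)
qed

lemma conj_auto_values:
  assumes h: "conj_auto h \<in> algebra_auto A" "\<And>C. C \<in> S \<Longrightarrow> th (conj_auto h C) = h (th C)"
    and k: "h kap = kapi" "h kapi = kap"
  shows "\<forall>C\<in>theta_torus n q. conj_auto h C = T n (T (n+1) C)"
proof -
  have "conj_auto h kc = kic" "conj_auto h kic = kc"
    by (rule th_inj[OF S_carrier S_carrier], simp_all only: hat(3)[OF h(1)] S_gens(2,3) h(2) th_kc k)+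
  then show ?thesis using torus_agree[OF h(1)] by blast
qed

lemma conj_minus:
  assumes "is_minus h" "is_plus g"
  shows "is_tau_n_minus n q T (conj_auto h)" "is_tau_n n q T (conj_auto g)"
    "restrict (inv_into S (conj_auto h)) S = conj_auto g" "C \<in> S \<Longrightarrow> th (conj_auto g C) = g (th C)"
proof -
  have hm: "hom_on BB h" "\<And>u. u \<in> BB \<Longrightarrow> h u \<in> BB" "\<And>j. h (rB j) = G.image_minus j" "h kap = kapi" "h kapi = kap"
    using assms(1) by (auto simp: is_minus_def)
  have hp: "hom_on BB g" "\<And>u. u \<in> BB \<Longrightarrow> g u \<in> BB" "\<And>j. g (rB j) = G.image_plus j" "g kap = kapi" "g kapi = kap"
    using assms(2) by (auto simp: is_plus_def)
  note cm = conj_auto[OF hm(1,2) hp(2) minus_plus[OF assms]]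
  note cp = conj_auto[OF hp(1,2) hm(2) minus_plus(2,1)[OF assms]]
  show "restrict (inv_into S (conj_auto h)) S = conj_auto g" by (rule cm)
  show "C \<in> S \<Longrightarrow> th (conj_auto g C) = g (th C)" for C by (rule cp)
  have "conj_auto h (Bc j) = expr_minus j" "conj_auto g (Bc j) = expr_plus j" if j: "j \<in> {1..n+1}" for j
    by (rule th_inj[OF S_carrier S_carrier],
        simp_all only: cm(2,3) cp(2,3) S_gens(1)[OF j] th_expr[OF j] th_B(2)[OF j] hm(3) hp(3))+
  then show "is_tau_n_minus n q T (conj_auto h)" "is_tau_n n q T (conj_auto g)"
    unfolding is_tau_n_minus_iff is_tau_n_iff
    using cm(1) cp(1) conj_auto_values[OF cm(1,2) hm(4,5)] conj_auto_values[OF cp(1,2) hp(4,5)] by auto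
qed

lemma is_tau_n_minus_unique: "is_tau_n_minus n q T f \<Longrightarrow> is_tau_n_minus n q T g \<Longrightarrow> f = g"
  unfolding is_tau_n_minus_iff by (rule auto_eqI) (use torus_gens in auto)

lemma is_tau_n_unique: "is_tau_n n q T f \<Longrightarrow> is_tau_n n q T g \<Longrightarrow> f = g"
  unfolding is_tau_n_iff by (rule auto_eqI) (use torus_gens in auto)

lemma hat_tau:
  assumes f: "is_tau n q T i f" and i: "i \<in> {1..n-1}"
  shows "f \<in> algebra_auto A" "hat f kap = kap" "hat f kapi = kapi"
    "j \<in> {1..n+1} \<Longrightarrow> hat f (rB j) = (if cartan_D n i j = -1 then rB j * rB i - rs q * (rB i * rB j) else rB j)"
proof -
  have i': "i \<in> {1..n+1}" using i by auto
  show auto: "f \<in> algebra_auto A" using f by (simp add: is_tau_def Let_def)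
  have "f kc = kc" "f kic = kic"
    using f torus_gens T_small_kc[OF i] by (auto simp: is_tau_def Let_def)
  then show "hat f kap = kap" "hat f kapi = kapi"
    using hat(4)[OF auto S_gens(2)] hat(4)[OF auto S_gens(3)] th_kc by simp_all
  assume j: "j \<in> {1..n+1}"
  have "f (Bc j) = (if cartan_D n i j = -1 then q_comm A q (Bc j) (Bc i) else Bc j)"
    using f j by (simp add: is_tau_def Let_def)
  then show "hat f (rB j) = (if cartan_D n i j = -1 then rB j * rB i - rs q * (rB i * rB j) else rB j)"
    using hat(4)[OF auto S_gens(1)[OF j]] th_q_comm(2)[OF S_gens(1)[OF j] S_gens(1)[OF i']] th_B(2)[OF j] th_B(2)[OF i']
    by simp
qed

text \<open>Both sides are homomorphisms, so generators suffice. The cases are the four nodes n-2,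
  ..., n+1 and the nodes further away, which both operators fix.\<close>

lemma braid_relation:
  assumes f: "is_tau n q T (n - 1) f" and p: "is_minus h" "is_plus g" and u: "u \<in> BB"
  shows "hat f (g (hat f (g u))) = g (hat f (g (hat f u)))"
proof -
  have i: "n - 1 \<in> {1..n-1}" using n_ge by auto
  note s = hat_tau[OF f i]
  note s_hom = hat(1,2)[OF s(1)]
  have g: "hom_on BB g" "\<And>u. u \<in> BB \<Longrightarrow> g u \<in> BB" "\<And>j. g (rB j) = G.image_plus j" "g kap = kapi" "g kapi = kap"
    using p(2) by (auto simp: is_plus_def)
  note S = hom_on_BB(1,2,5)[OF s_hom(1)] hom_on_BB(3)[OF s_hom(1) BB_closed(1) BB_closed(1)]
  note G = hom_on_BB(1,2,5)[OF g(1)] hom_on_BB(3)[OF g(1) BB_closed(1) BB_closed(1)]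
  have a: "cartan_D n (n - 1) n = -1" "cartan_D n (n - 1) (n + 1) = -1" "cartan_D n (n - 1) (n - 2) = -1"
    "cartan_D n (n - 1) (n - 1) \<noteq> -1"
    using cartan_D_values[OF n_ge] by auto
  have sv: "hat f (rB n) = G.S4.w" "hat f (rB (n+1)) = G.S4.z" "hat f (rB (n-1)) = rB (n-1)"
    "hat f (rB (n-2)) = rB (n-2) * rB (n-1) - rs q * (rB (n-1) * rB (n-2))"
    using s(4)[OF idx(1)] s(4)[OF idx(2)] s(4)[OF idx(3)] s(4)[OF idx(4)]
    by (simp_all only: a if_True if_False G.S4.w_def G.S4.z_def simp_thms)
  have n2: "n - 2 \<noteq> n - 1" "n - 2 \<noteq> n" "n - 2 \<noteq> n + 1" using n_ge by auto
  note gv = g(3)[of n, unfolded G.image_plus_simps(2)] g(3)[of "n+1", unfolded G.image_plus_simps(3)]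
    g(3)[of "n-1", unfolded G.image_plus_simps(1)] g(3)[of "n-2", unfolded G.image_plus_simps(4)[OF n2]]
  have in_BB: "G.S4.x2 \<in> BB" "G.S4.b2 \<in> BB" "G.S4.c2 \<in> BB" "G.S4.x1 \<in> BB" "G.S4.w \<in> BB" "G.S4.z \<in> BB"
    using image_in_BB(2)[of "n-1"] image_in_BB(2)[of n] image_in_BB(2)[of "n+1"] image_in_BB(1)[of "n-1"]
      s_hom(2)[OF BB_closed(2)[of n]] s_hom(2)[OF BB_closed(2)[of "n+1"]]
    by (simp_all only: G.image_plus_simps G.image_minus_simps sv)
  have x1: "hat f G.S4.x2 = G.S4.x1"
  proof -
    have "hat f G.S4.x2 = rs (inverse q) * ((rB (n-1) * G.S4.w - rs q * (G.S4.w * rB (n-1))) * G.S4.z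
      - rs q * (G.S4.z * (rB (n-1) * G.S4.w - rs q * (G.S4.w * rB (n-1))))) + rB (n-1) * kap"
      unfolding hom_images(2)[OF s_hom(1)] sv s(2) by (rule refl)
    then show ?thesis by (simp only: G.S4.braid_x)
  qed
  \<comment> \<open>\<open>x1\<close> is the image of B_(n-1) under tau_n^-, which tau_n
    undoes.\<close>
  have gx1: "g G.S4.x1 = rB (n-1)"
    using minus_plus(2)[OF p BB_closed(2)[of "n-1"]] p(1) by (simp only: is_minus_def G.image_minus_simps)
  have sts_b: "hat f (g G.S4.w) = rB (n+1)"
    unfolding G.S4.w_def
    by (simp only: G gv BB_closed in_BB S x1 hom_images(5)[OF s_hom(1)] sv s(3) G.S4.braid_b)
  have sts_c: "hat f (g G.S4.z) = rB n"
    unfolding G.S4.z_def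
    by (simp only: G gv BB_closed in_BB S x1 hom_images(6)[OF s_hom(1)] sv s(2) G.S4.braid_c)
  show ?thesis
  proof (rule hom_on_BB_eqI[OF hom_on_comp[OF s_hom(1) hom_on_comp[OF g(1) hom_on_comp[OF s_hom(1) g(1,2)]]]
        hom_on_comp[OF g(1) hom_on_comp[OF s_hom(1) hom_on_comp[OF g(1) s_hom(1,2)]]] _ _ _ u])
    fix j assume j: "j \<in> {1..n+1}"
    consider "j = n - 1" | "j = n" | "j = n + 1" | "j = n - 2" | "j < n - 2"
      using j unfolding atLeastAtMost_iff by linarith
    then show "hat f (g (hat f (g (rB j)))) = g (hat f (g (hat f (rB j))))"
    proof cases
      case 1
      show ?thesis unfolding 1 by (simp only: gv sv x1 gx1)
    next
      case 2
      \<comment> \<open>tau_n turns the prefactor \<open>kapi\<close> of \<open>b2\<close> into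
        \<open>kap\<close>, and \<open>sts_c\<close> turns \<open>z\<close> into B_n. The result is
        \<open>c2\<close>, the image under tau_n of B_(n+1), as on the other side.\<close>
      have "hat f (g (hat f G.S4.b2)) = rs q * (kap * rB n)"
        unfolding G.S4.b2_def by (simp only: S G BB_closed sv s in_BB g sts_c)
      then show ?thesis unfolding 2 gv(1) sv(1) sts_b gv(2) by (simp only: G.S4.c2_def)
    next
      case 3
      have "hat f (g (hat f G.S4.c2)) = rs q * (kapi * rB (n+1))"
        unfolding G.S4.c2_def by (simp only: S G BB_closed sv s in_BB g sts_b)
      then show ?thesis unfolding 3 gv(2) sv(2) sts_c gv(1) by (simp only: G.S4.b2_def)
    next
      case 4
      show ?thesis
        unfolding 4 gv(4) sv(4)
        by (simp only: S G BB_closed in_BB gv sv x1 gx1) (rule G.S4.braid_y)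
    next
      case 5
      then have ne: "j \<noteq> n - 1" "j \<noteq> n" "j \<noteq> n + 1" by linarith+
      have "hat f (rB j) = rB j" using s(4)[OF j] cartan_D_values(9)[OF n_ge 5] by simp
      moreover have "g (rB j) = rB j" using g(3)[of j] G.image_plus_simps(4)[OF ne] by simp
      ultimately show ?thesis by simp
    qed
  qed (simp_all only: s g s_hom)
qed

text \<open>The two operators interact only at B_(n-1) with i = n-2, where \<open>x2_y\<close>
  applies. In the other cases tau_i fixes all ingredients of the image under tau_n, or tau_n fixes
  both B_i and B_j.\<close>

lemma commuting_relation:
  assumes f: "is_tau n q T i f" and i: "i \<in> {1..n-2}" and p: "is_plus g" and u: "u \<in> BB"
  shows "g (hat f u) = hat f (g u)"
proof -
  have i': "i \<in> {1..n-1}" "i \<in> {1..n+1}" "i < n - 1" using i n_ge by auto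
  note s = hat_tau[OF f i'(1)]
  note s_hom = hat(1,2)[OF s(1)]
  have g: "hom_on BB g" "\<And>u. u \<in> BB \<Longrightarrow> g u \<in> BB" "\<And>j. g (rB j) = G.image_plus j" "g kap = kapi" "g kapi = kap"
    using p by (auto simp: is_plus_def)
  note S = hom_on_BB(1,2,5)[OF s_hom(1)] hom_on_BB(3)[OF s_hom(1) BB_closed(1) BB_closed(1)]
  note G = hom_on_BB(1,2,5)[OF g(1)] hom_on_BB(3)[OF g(1) BB_closed(1) BB_closed(1)]
  have a: "cartan_D n i n = 0" "cartan_D n i (n + 1) = 0"
    using cartan_D_values(7,8)[OF n_ge i'(3)] by (simp_all add: cartan_D_sym[of n i])
  have sv: "hat f (rB n) = rB n" "hat f (rB (n+1)) = rB (n+1)"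
    using s(4)[OF idx(1)] s(4)[OF idx(2)] a by simp_all
  have old: "g (rB j) = rB j" if "j \<noteq> n - 1" "j \<noteq> n" "j \<noteq> n + 1" for j
    using g(3)[of j] G.image_plus_simps(4)[OF that] by simp
  have gi: "g (rB i) = rB i" using i'(3) by (intro old) linarith+
  note gv = g(3)[of n, unfolded G.image_plus_simps(2)] g(3)[of "n+1", unfolded G.image_plus_simps(3)]
    g(3)[of "n-1", unfolded G.image_plus_simps(1)]
  show ?thesis
  proof (rule hom_on_BB_eqI[OF hom_on_comp[OF g(1) s_hom] hom_on_comp[OF s_hom(1) g(1,2)] _ _ _ u])
    fix j assume j: "j \<in> {1..n+1}"
    consider "j = n - 1" "i = n - 2" | "j = n - 1" "i < n - 2" | "j = n" | "j = n + 1" | "j \<noteq> n - 1" "j \<noteq> n" "j \<noteq> n + 1"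
      using i'(3) by linarith
    then show "g (hat f (rB j)) = hat f (g (rB j))"
    proof cases
      case 1
      have x: "hat f (rB (n-1)) = rB (n-1) * rB i - rs q * (rB i * rB (n-1))"
        using s(4)[OF idx(3)] cartan_D_values(6)[OF n_ge] 1(2) by simp
      have "hat f G.S4.x2 = G.S4.x2 * rB i - rs q * (rB i * G.S4.x2)"
        unfolding hom_images(2)[OF s_hom(1)] sv x s(2) 1(2) by (rule G.S4.x2_y)
      moreover have "g (hat f (rB (n-1))) = G.S4.x2 * rB i - rs q * (rB i * G.S4.x2)"
        unfolding x by (simp only: G BB_closed gv gi)
      ultimately show ?thesis unfolding 1(1) gv by simp
    next
      case 2
      have x: "hat f (rB (n-1)) = rB (n-1)"
        using s(4)[OF idx(3)] cartan_D_values(9)[OF n_ge 2(2)] by (simp add: cartan_D_sym[of n i])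
      have "hat f G.S4.x2 = G.S4.x2"
        unfolding hom_images(2)[OF s_hom(1)] sv x s(2) by (simp only: G.S4.x2_def)
      then show ?thesis unfolding 2(1) x gv by simp
    next
      case 3
      show ?thesis unfolding 3 sv gv hom_images(5)[OF s_hom(1)] s by (simp only: G.S4.b2_def)
    next
      case 4
      show ?thesis unfolding 4 sv gv hom_images(6)[OF s_hom(1)] s by (simp only: G.S4.c2_def)
    next
      case 5
      show ?thesis
      proof (cases "cartan_D n i j = -1")
        case True
        then have "hat f (rB j) = rB j * rB i - rs q * (rB i * rB j)" using s(4)[OF j] by simp
        then show ?thesis by (simp only: old[OF 5] G BB_closed gi)
      next
        case False
        then have "hat f (rB j) = rB j" using s(4)[OF j] by simp
        then show ?thesis by (simp only: old[OF 5])
      qed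
    qed
  qed (simp_all only: s g)
qed

end

theorem theorem4p9:
  fixes n :: nat
    and q q_half :: "'k::field"
    and T \<tau> :: "nat \<Rightarrow> (uq_gen word \<Rightarrow>\<^sub>0 'k) set \<Rightarrow> (uq_gen word \<Rightarrow>\<^sub>0 'k) set"
  assumes "n + 1 \<ge> 4"
    and "q \<noteq> 0"
    and "\<forall>m::nat. m > 0 \<longrightarrow> q ^ m \<noteq> 1"
    and "q_half ^ 2 = q"
    and "\<forall>i \<in> {1..n+1}. lusztig_auto n q i (T i)"
    and "\<forall>i \<in> {1..n-1}. is_tau n q T i (\<tau> i)"
  shows
    "(\<exists>!\<tau>nm. is_tau_n_minus n q T \<tau>nm) \<and>
     (\<forall>\<tau>nm \<tau>n.
        is_tau_n_minus n q T \<tau>nm \<and>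
        \<tau>n = restrict (inv_into (carrier (Uqk n q)) \<tau>nm) (carrier (Uqk n q)) \<longrightarrow>
          is_tau_n n q T \<tau>n \<and>
          (\<forall>g. is_tau_n n q T g \<longrightarrow> g = \<tau>n) \<and>
          (\<forall>x \<in> carrier (Uqk n q).
             \<tau> (n-1) (\<tau>n (\<tau> (n-1) (\<tau>n x))) = \<tau>n (\<tau> (n-1) (\<tau>n (\<tau> (n-1) x)))) \<and>
          (\<forall>j \<in> {1..n-2}. \<forall>x \<in> carrier (Uqk n q). \<tau>n (\<tau> j x) = \<tau> j (\<tau>n x)))"
proof -
  interpret uq_lusztig n q T
    using assms by unfold_locales auto
  obtain h g where hg: "is_minus h" "is_plus g" by (rule end_homs)
  note c = conj_minus[OF hg]
  have auto: "conj_auto g \<in> algebra_auto A" using c(2) by (simp only: is_tau_n_iff)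
  have tau: "is_tau n q T i (\<tau> i)" if "i \<in> {1..n-1}" for i using assms(6) that by blast
  have i: "n - 1 \<in> {1..n-1}" using n_ge by auto
  note s = hat_tau(1)[OF tau[OF i] i]
  note closed = hat(3)[OF auto] hat(3)[OF s]
  have braid: "\<tau> (n-1) (conj_auto g (\<tau> (n-1) (conj_auto g C))) = conj_auto g (\<tau> (n-1) (conj_auto g (\<tau> (n-1) C)))"
    if C: "C \<in> S" for C
  proof (rule th_inj[OF S_carrier S_carrier])
    show "th (\<tau> (n-1) (conj_auto g (\<tau> (n-1) (conj_auto g C)))) = th (conj_auto g (\<tau> (n-1) (conj_auto g (\<tau> (n-1) C))))"
      using braid_relation[OF tau[OF i] hg thi(4)[OF C]]
      by (simp only: C closed c(4) hat(4)[OF s, symmetric])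
  qed (simp_all only: C closed)
  have commute: "conj_auto g (\<tau> j C) = \<tau> j (conj_auto g C)" if j: "j \<in> {1..n-2}" and C: "C \<in> S" for j C
  proof -
    have j': "j \<in> {1..n-1}" using j by auto
    note s = hat_tau(1)[OF tau[OF j'] j']
    note closed = hat(3)[OF auto] hat(3)[OF s]
    show ?thesis
    proof (rule th_inj[OF S_carrier S_carrier])
      show "th (conj_auto g (\<tau> j C)) = th (\<tau> j (conj_auto g C))"
        using commuting_relation[OF tau[OF j'] j hg(2) thi(4)[OF C]]
        by (simp only: C closed c(4) hat(4)[OF s, symmetric])
    qed (simp_all only: C closed)
  qed
  have "\<exists>!\<tau>nm. is_tau_n_minus n q T \<tau>nm"
    using c(1) is_tau_n_minus_unique by blast
  moreover have "is_tau_n n q T \<tau>n \<and> (\<forall>g. is_tau_n n q T g \<longrightarrow> g = \<tau>n) \<and>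
      (\<forall>x \<in> S. \<tau> (n-1) (\<tau>n (\<tau> (n-1) (\<tau>n x))) = \<tau>n (\<tau> (n-1) (\<tau>n (\<tau> (n-1) x)))) \<and>
      (\<forall>j \<in> {1..n-2}. \<forall>x \<in> S. \<tau>n (\<tau> j x) = \<tau> j (\<tau>n x))"
    if "is_tau_n_minus n q T \<tau>nm" "\<tau>n = restrict (inv_into S \<tau>nm) S" for \<tau>nm \<tau>n
  proof -
    \<comment> \<open>Uniqueness identifies an arbitrary candidate with the constructed
      automorphism, whose restricted inverse is already known to be
      \<open>conj_auto g\<close>.\<close>
    have "\<tau>nm = conj_auto h" using is_tau_n_minus_unique[OF that(1) c(1)] .
    then have "\<tau>n = conj_auto g" using that(2) c(3) by simp
    then show ?thesis using c(2) is_tau_n_unique[OF _ c(2)] braid commute by blast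
  qed
  ultimately show ?thesis by blast
qed

end
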